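(* Let $G$ be an acyclic mixed graph with mixed components $G_1,\dots,G_k$. Then: (i) $G$ is rationally identifiable if and only if every $G_j$ is rationally identifiable, and $G$ is generically identifiable if and only if every $G_j$ is generically identifiable; (ii) $\phi_G$ is generically infinite-to-one if and only if $\phi_{G_j}$ is generically infinite-to-one for some $j$; (iii) if each $G_j$ is generically $h_j$-to-one with $h_j<\infty$, then $G$ is generically $h$-to-one with $h=\prod_{j=1}^k h_j$.
   Context: A mixed graph is $G=(V,D,B)$ with $V$ a finite node set (here $V=[m]$), $D$ directed edges $v\to w$, $B$ symmetric bidirected edges $v\leftrightarrow w$, no self-loops; acyclic if $(V,D)$ has no directed cycle. $\mathrm{pa}(v)=\{w:w\to v\in D\}$. For a mixed graph on node set $V$: $\mathbb{R}^D_{\mathrm{reg}}$ is the set of real $V\times V$ matrices $\Lambda$ with $\lambda_{vw}=0$ for $v\to w\notin D$ and $I-\Lambda$ invertible; $\mathrm{PD}(B)$ the positive definite symmetric $\Omega$ with $\omega_{vw}=0$ for $v\ne w$, $v\leftrightarrow w\notin B$; $\Theta=\mathbb{R}^D_{\mathrm{reg}}\times\mathrm{PD}(B)$; $\phi_G(\Lambda,\Omega)=(I-\Lambda)^{-T}\Omega(I-\Lambda)^{-1}$. A proper algebraic subset of $\Theta$ is the zero set in $\Theta$ of polynomials in the entries, not all of $\Theta$. $G$ is rationally identifiable if there exist a proper algebraic subset $W$ and a rational map $\psi$ with $\psi\circ\phi_G=\mathrm{id}$ on $\Theta\setminus W$; generically identifiable if $\phi_G$ is injective on $\Theta\setminus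 W$ for some proper algebraic subset $W$; $\phi_G$ is generically infinite-to-one if the fibers $\{(\Lambda',\Omega')\in\Theta:\phi_G(\Lambda',\Omega')=\phi_G(\Lambda,\Omega)\}$ are infinite outside a proper algebraic subset. $G$ is generically $h$-to-one ($h\in\mathbb{N}\cup\{\infty\}$) if the complex extension of $\phi_G$, defined on pairs $(\Lambda,\Omega)$ of complex matrices with the same support constraints, $I-\Lambda$ invertible and $\Omega$ symmetric, has fibers of cardinality $h$ outside a proper algebraic subset. Mixed components: let $C_1,\dots,C_k$ be the node sets of the connected components of the bidirected graph $(V,B)$. For $j\in[k]$ let $V_j=C_j\cup\bigcup_{v\in C_j}\mathrm{pa}(v)$, $D_j=\{v\to w\in D: v\in V_j, w\in C_j\}$, $B_j=B\cap(C_j\times C_j)$, and $G_j=(V_j,D_j,B_j)$. *)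

theory Defs
  imports Complex_Main "HOL-Library.Extended_Nat"
begin

section \<open>Mixed graphs\<close>

text \<open>A mixed graph: finite node set, directed edges (v,w) meaning v -> w,
  bidirected edges stored symmetrically.\<close>

record mgraph =
  nodes :: "nat set"
  dedges :: "(nat \<times> nat) set"
  bedges :: "(nat \<times> nat) set"

definition mixed_graph :: "mgraph \<Rightarrow> bool" where
  "mixed_graph G \<longleftrightarrow> finite (nodes G)
     \<and> dedges G \<subseteq> nodes G \<times> nodes G \<and> bedges G \<subseteq> nodes G \<times> nodes G
     \<and> (\<forall>v. (v, v) \<notin> dedges G) \<and> (\<forall>v. (v, v) \<notin> bedges G)
     \<and> sym (bedges G)"

definition acyclic_mg :: "mgraph \<Rightarrow> bool" where
  "acyclic_mg G \<longleftrightarrow> acyclic (dedges G)"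

definition pa :: "mgraph \<Rightarrow> nat \<Rightarrow> nat set" where
  "pa G v = {w. (w, v) \<in> dedges G}"

text \<open>Node sets of the connected components of the bidirected graph (V,B).\<close>
definition bicomponents :: "mgraph \<Rightarrow> nat set set" where
  "bicomponents G = nodes G // ((bedges G)\<^sup>*)"

text \<open>The mixed component G_C associated with a bidirected component C.\<close>
definition mixed_component :: "mgraph \<Rightarrow> nat set \<Rightarrow> mgraph" where
  "mixed_component G C =
     (let VC = C \<union> (\<Union>v\<in>C. pa G v) in
      \<lparr> nodes = VC,
        dedges = {(v, w). (v, w) \<in> dedges G \<and> v \<in> VC \<and> w \<in> C},
        bedges = bedges G \<inter> (C \<times> C) \<rparr>)"

section \<open>Matrices indexed by a finite node set\<close>

type_synonym 'a mat = "nat \<Rightarrow> nat \<Rightarrow> 'a"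

definition mmult :: "nat set \<Rightarrow> 'a::comm_ring_1 mat \<Rightarrow> 'a mat \<Rightarrow> 'a mat" where
  "mmult V A B = (\<lambda>v w. \<Sum>u\<in>V. A v u * B u w)"

definition idm :: "nat set \<Rightarrow> 'a::comm_ring_1 mat" where
  "idm V = (\<lambda>v w. if v \<in> V \<and> v = w then 1 else 0)"

definition mtrans :: "'a mat \<Rightarrow> 'a mat" where
  "mtrans A = (\<lambda>v w. A w v)"

definition extensional_on :: "nat set \<Rightarrow> 'a::zero mat \<Rightarrow> bool" where
  "extensional_on V A \<longleftrightarrow> (\<forall>v w. v \<notin> V \<or> w \<notin> V \<longrightarrow> A v w = 0)"

definition invertible_on :: "nat set \<Rightarrow> 'a::comm_ring_1 mat \<Rightarrow> bool" where
  "invertible_on V A \<longleftrightarrow>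
     (\<exists>N. mmult V A N = idm V \<and> mmult V N A = idm V)"

definition minv :: "nat set \<Rightarrow> 'a::comm_ring_1 mat \<Rightarrow> 'a mat" where
  "minv V A = (THE N. extensional_on V N \<and> mmult V A N = idm V \<and> mmult V N A = idm V)"

definition I_minus :: "nat set \<Rightarrow> 'a::comm_ring_1 mat \<Rightarrow> 'a mat" where
  "I_minus V L = (\<lambda>v w. idm V v w - L v w)"

text \<open>The parametrization phi_G(Lambda, Omega) = (I-Lambda)^{-T} Omega (I-Lambda)^{-1}.\<close>
definition phi :: "mgraph \<Rightarrow> ('a::comm_ring_1 mat \<times> 'a mat) \<Rightarrow> 'a mat" where
  "phi G \<theta> = (let V = nodes G; N = minv V (I_minus V (fst \<theta>))
              in mmult V (mmult V (mtrans N) (snd \<theta>)) N)"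

section \<open>Parameter spaces\<close>

text \<open>Support constraints, regularity of I - Lambda, symmetry of Omega
  (common to the real and complex parameter spaces).\<close>
definition supp_ok :: "mgraph \<Rightarrow> 'a::comm_ring_1 mat \<Rightarrow> 'a mat \<Rightarrow> bool" where
  "supp_ok G L Om \<longleftrightarrow>
     (\<forall>v w. (v, w) \<notin> dedges G \<longrightarrow> L v w = 0)
   \<and> invertible_on (nodes G) (I_minus (nodes G) L)
   \<and> extensional_on (nodes G) Om
   \<and> (\<forall>v w. Om v w = Om w v)
   \<and> (\<forall>v w. v \<noteq> w \<and> (v, w) \<notin> bedges G \<longrightarrow> Om v w = 0)"

definition posdef_on :: "nat set \<Rightarrow> real mat \<Rightarrow> bool" where
  "posdef_on V Om \<longleftrightarrow>
     (\<forall>x :: nat \<Rightarrow> real. (\<forall>v. v \<notin> V \<longrightarrow> x v = 0) \<and> (\<exists>v\<in>V. x v \<noteq> 0)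
        \<longrightarrow> (\<Sum>v\<in>V. \<Sum>w\<in>V. x v * Om v w * x w) > 0)"

text \<open>Theta = R^D_reg x PD(B).\<close>
definition Theta :: "mgraph \<Rightarrow> (real mat \<times> real mat) set" where
  "Theta G = {(L, Om). supp_ok G L Om \<and> posdef_on (nodes G) Om}"

text \<open>Complex parameter space (Omega only complex symmetric).\<close>
definition ThetaC :: "mgraph \<Rightarrow> (complex mat \<times> complex mat) set" where
  "ThetaC G = {(L, Om). supp_ok G L Om}"

section \<open>Polynomial functions and algebraic subsets\<close>

text \<open>Polynomial functions (coefficients in 'a) in a given set of coordinate functions.\<close>
inductive_set polyfuns :: "('x \<Rightarrow> 'a::comm_ring_1) set \<Rightarrow> ('x \<Rightarrow> 'a) set"
  for X :: "('x \<Rightarrow> 'a) set" where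
  const: "(\<lambda>_. c) \<in> polyfuns X"
| coord: "f \<in> X \<Longrightarrow> f \<in> polyfuns X"
| add: "f \<in> polyfuns X \<Longrightarrow> g \<in> polyfuns X \<Longrightarrow> (\<lambda>x. f x + g x) \<in> polyfuns X"
| mult: "f \<in> polyfuns X \<Longrightarrow> g \<in> polyfuns X \<Longrightarrow> (\<lambda>x. f x * g x) \<in> polyfuns X"

text \<open>Coordinates of the parameter space: the entries of Lambda and Omega.\<close>
definition param_coords :: "mgraph \<Rightarrow> ('a mat \<times> 'a mat \<Rightarrow> 'a) set" where
  "param_coords G = {(\<lambda>\<theta>. fst \<theta> v w) | v w. v \<in> nodes G \<and> w \<in> nodes G}
                  \<union> {(\<lambda>\<theta>. snd \<theta> v w) | v w. v \<in> nodes G \<and> w \<in> nodes G}"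

text \<open>Coordinates of the covariance space: the entries of Sigma.\<close>
definition cov_coords :: "mgraph \<Rightarrow> ('a mat \<Rightarrow> 'a) set" where
  "cov_coords G = {(\<lambda>S. S v w) | v w. v \<in> nodes G \<and> w \<in> nodes G}"

text \<open>W is a proper algebraic subset of the parameter set T: the zero set in T
  of finitely many polynomials in the entries, and not all of T.\<close>
definition proper_alg_subset ::
  "mgraph \<Rightarrow> ('a::comm_ring_1 mat \<times> 'a mat) set \<Rightarrow> ('a mat \<times> 'a mat) set \<Rightarrow> bool" where
  "proper_alg_subset G T W \<longleftrightarrow>
     (\<exists>P. finite P \<and> P \<subseteq> polyfuns (param_coords G)
          \<and> W = {\<theta> \<in> T. \<forall>p\<in>P. p \<theta> = 0} \<and> W \<noteq> T)"

section \<open>Identifiability notions\<close>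

text \<open>Rational identifiability: a rational map psi (each coordinate a quotient of
  polynomials in the entries of Sigma, with nonvanishing denominator on phi(Theta \ W))
  with psi o phi = id on Theta \ W.\<close>
definition rationally_identifiable :: "mgraph \<Rightarrow> bool" where
  "rationally_identifiable G \<longleftrightarrow>
     (\<exists>W pL qL pO qO. proper_alg_subset G (Theta G) W
        \<and> (\<forall>v w. pL v w \<in> polyfuns (cov_coords G) \<and> qL v w \<in> polyfuns (cov_coords G)
                \<and> pO v w \<in> polyfuns (cov_coords G) \<and> qO v w \<in> polyfuns (cov_coords G))
        \<and> (\<forall>\<theta> \<in> Theta G - W. \<forall>v\<in>nodes G. \<forall>w\<in>nodes G.
              qL v w (phi G \<theta>) \<noteq> 0 \<and> fst \<theta> v w = pL v w (phi G \<theta>) / qL v w (phi G \<theta>)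
            \<and> qO v w (phi G \<theta>) \<noteq> 0 \<and> snd \<theta> v w = pO v w (phi G \<theta>) / qO v w (phi G \<theta>)))"

definition generically_identifiable :: "mgraph \<Rightarrow> bool" where
  "generically_identifiable G \<longleftrightarrow>
     (\<exists>W. proper_alg_subset G (Theta G) W \<and> inj_on (phi G) (Theta G - W))"

definition fiber :: "mgraph \<Rightarrow> ('a::comm_ring_1 mat \<times> 'a mat) set \<Rightarrow> ('a mat \<times> 'a mat) \<Rightarrow> ('a mat \<times> 'a mat) set" where
  "fiber G T \<theta> = {\<theta>' \<in> T. phi G \<theta>' = phi G \<theta>}"

definition generically_infinite_to_one :: "mgraph \<Rightarrow> bool" where
  "generically_infinite_to_one G \<longleftrightarrow>
     (\<exists>W. proper_alg_subset G (Theta G) W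
          \<and> (\<forall>\<theta> \<in> Theta G - W. infinite (fiber G (Theta G) \<theta>)))"

definition ecard :: "'b set \<Rightarrow> enat" where
  "ecard A = (if finite A then enat (card A) else \<infinity>)"

text \<open>Generically h-to-one, via the complex extension of phi.\<close>
definition generically_h_to_one :: "mgraph \<Rightarrow> enat \<Rightarrow> bool" where
  "generically_h_to_one G h \<longleftrightarrow>
     (\<exists>W. proper_alg_subset G (ThetaC G) W
          \<and> (\<forall>\<theta> \<in> ThetaC G - W. ecard (fiber G (ThetaC G) \<theta>) = h))"

end

(* Order the nodes topologically and write Omega = U^T D U with U unit upper triangular and block
   diagonal along the bidirected components, D diagonal. With M = (I - Lambda) U^{-1}, again unit
   upper triangular, M^T Sigma M = D determines M and D rationally from Sigma, and conversely. The
   columns of M and the entries of D belonging to a component C depend only on the parameters of G_C,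
   and up to trivial columns they are the corresponding data of G_C. Hence Sigma and the family of all
   Sigma_C determine each other rationally, so the fibers of phi_G are products of fibers of the
   phi_{G_C}. In the real case the factorization always exists; in the complex case it exists where
   the pivots of Omega do not vanish. *)
theory Submission
  imports Defs "HOL-Computational_Algebra.Polynomial" "HOL-Library.FuncSet"
begin

section \<open>Matrices and unit triangular matrices\<close>

text \<open>The obstacle is that \<open>G_C\<close> has parameters without counterpart in
  \<open>G\<close>: a parent of \<open>C\<close> outside \<open>C\<close> is a source of
  \<open>G_C\<close> with a free variance. Every restriction to \<open>G_C\<close> therefore carries
  filler variances \<open>E\<close>. A source variance is a diagonal entry of the covariance matrix
  of \<open>G_C\<close>, hence visible from it and constant on fibers. The fillers must be nonzero,
  being pivots of the restricted factorization, and they must come from suitable points of the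
  components, since a polynomial that is generic on \<open>G_C\<close> may vanish identically once
  the sources get, say, variance 1. \<open>M\<close> is used instead of its inverse, the triangular
  factor of Sigma, because a column of \<open>(I - Lambda)^-1\<close> sees all ancestors, a column
  of \<open>I - Lambda\<close> only the parents. "Determines" and "determines rationally" are one
  statement, membership in a class of functions closed under ring operations and under inversion of
  functions without zeros. Quotients of polynomials in Sigma give the rational version; functions on
  two points with equal values give fibers and injectivity. A factorization at one point of a fiber
  passes to the whole fiber, so only the base point has to be generic.\<close>

lemma mmult_assoc: "mmult V (mmult V A B) C = mmult V A (mmult V B C)"
  unfolding mmult_def
  by (intro ext) (simp add: sum_distrib_left sum_distrib_right mult.assoc, rule sum.swap)

lemma mmult_idm_right:
  assumes "finite V" "extensional_on V A"
  shows "mmult V A (idm V) = A"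
proof (intro ext)
  fix v w
  have "mmult V A (idm V) v w = (\<Sum>u\<in>V. if u = w then A v w else 0)"
    unfolding mmult_def idm_def by (rule sum.cong) auto
  also have "\<dots> = A v w"
    using assms by (auto simp: extensional_on_def)
  finally show "mmult V A (idm V) v w = A v w" .
qed

lemma mmult_idm_left:
  assumes "finite V" "extensional_on V A"
  shows "mmult V (idm V) A = A"
proof (intro ext)
  fix v w
  have "mmult V (idm V) A v w = (\<Sum>u\<in>V. if v = u then A v w else 0)"
    unfolding mmult_def idm_def by (rule sum.cong) auto
  also have "\<dots> = A v w"
    using assms by (auto simp: extensional_on_def)
  finally show "mmult V (idm V) A v w = A v w" .
qed

lemma mtrans_mmult:
  fixes A B :: "'a::comm_ring_1 mat"
  shows "mtrans (mmult V A B) = mmult V (mtrans B) (mtrans A)"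
  by (auto simp: mtrans_def mmult_def mult.commute intro!: ext sum.cong)

lemma extensional_on_idm [simp]: "extensional_on V (idm V)"
  by (auto simp: extensional_on_def idm_def)

lemma extensional_on_mtrans [simp]: "extensional_on V (mtrans A) \<longleftrightarrow> extensional_on V A"
  by (auto simp: extensional_on_def mtrans_def)

lemma extensional_on_mmult:
  assumes "extensional_on V A" "extensional_on V B"
  shows "extensional_on V (mmult V A B)"
  using assms by (auto simp: extensional_on_def mmult_def intro!: sum.neutral)

lemma extensional_on_eqI:
  assumes "extensional_on V A" "extensional_on V B"
    and "\<And>v w. v \<in> V \<Longrightarrow> w \<in> V \<Longrightarrow> A v w = B v w"
  shows "A = B"
  using assms unfolding extensional_on_def by (intro ext) metis

text \<open>The order comes from a rank function instead of a list, so one \<open>r\<close> serves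
  \<open>G\<close> and all its mixed components. Vanishing outside \<open>V\<close> is part of the
  notion so that \<open>idm V\<close> acts as a unit and inverses are unique.\<close>

definition unitri :: "(nat \<Rightarrow> nat) \<Rightarrow> nat set \<Rightarrow> 'a::comm_ring_1 mat \<Rightarrow> bool" where
  "unitri r V A \<longleftrightarrow> extensional_on V A \<and> (\<forall>v\<in>V. A v v = 1)
     \<and> (\<forall>v w. v \<noteq> w \<longrightarrow> \<not> r v < r w \<longrightarrow> A v w = 0)"

lemma unitriD:
  assumes "unitri r V A"
  shows unitri_ext: "extensional_on V A"
    and unitri_diag: "v \<in> V \<Longrightarrow> A v v = 1"
    and unitri_below: "v \<noteq> w \<Longrightarrow> \<not> r v < r w \<Longrightarrow> A v w = 0"
    and unitri_out1: "v \<notin> V \<Longrightarrow> A v w = 0"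
    and unitri_out2: "w \<notin> V \<Longrightarrow> A v w = 0"
  using assms by (auto simp: unitri_def extensional_on_def)

text \<open>In column \<open>w\<close> of \<open>A\<close> only the diagonal entry and rows of
  smaller rank survive. This is the recursion of back substitution, which builds inverses and later
  tracks where their entries lie.\<close>

lemma unitri_mmult_col:
  assumes "finite V" "unitri r V A" "w \<in> V"
  shows "mmult V X A v w = X v w + (\<Sum>k\<in>{k\<in>V. r k < r w}. X v k * A k w)"
proof -
  have "mmult V X A v w = (\<Sum>k\<in>insert w {k\<in>V. r k < r w}. X v k * A k w)"
    unfolding mmult_def using assms
    by (intro sum.mono_neutral_right) (auto simp: unitri_below)
  also have "\<dots> = X v w + (\<Sum>k\<in>{k\<in>V. r k < r w}. X v k * A k w)"
    using assms by (subst sum.insert) (auto simp: unitri_diag)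
  finally show ?thesis .
qed

lemma unitri_mmult:
  assumes "finite V" "unitri r V A" "unitri r V B"
  shows "unitri r V (mmult V A B)"
  unfolding unitri_def
proof (intro conjI ballI allI impI)
  show "extensional_on V (mmult V A B)"
    using assms by (simp add: extensional_on_mmult unitri_ext)
  show "mmult V A B v v = 1" if "v \<in> V" for v
  proof -
    have "(\<Sum>k\<in>{k\<in>V. r k < r v}. A v k * B k v) = 0"
    proof (rule sum.neutral, rule ballI)
      fix k assume "k \<in> {k\<in>V. r k < r v}"
      then show "A v k * B k v = 0" using unitri_below[OF assms(2), of v k] by (cases "v = k") auto
    qed
    then show ?thesis using assms that by (simp add: unitri_mmult_col unitri_diag)
  qed
  fix v w assume *: "v \<noteq> w" "\<not> r v < r w"
  show "mmult V A B v w = 0"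
    unfolding mmult_def
  proof (rule sum.neutral, rule ballI)
    fix k assume "k \<in> V"
    show "A v k * B k w = 0"
      using * unitri_below[OF assms(2), of v k] unitri_below[OF assms(3), of k w]
      by (cases "v = k"; cases "k = w"; force)
  qed
qed

text \<open>\<open>X A = I\<close> is solved one column of \<open>X\<close> at a time, in increasing
  rank; thanks to the unit diagonal no division occurs.\<close>

lemma unitri_left_inverse:
  fixes A :: "'a::comm_ring_1 mat"
  assumes "finite V" "unitri r V A"
  shows "\<exists>X. unitri r V X \<and> mmult V X A = idm V"
proof -
  \<comment> \<open>The column index \<open>w\<close> comes first because the well-founded recursion
    runs over columns; \<open>X\<close> swaps the arguments back.\<close>
  define F where "F = (\<lambda>f w u. if w \<notin> V \<or> u \<notin> V then 0 else if u = w then 1 else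
      if r u < r w then - (\<Sum>k\<in>{k\<in>V. r k < r w}. f k u * A k w) else (0::'a))"
  define Y where "Y = wfrec (measure r) F"
  have Y: "Y w = F Y w" for w
    unfolding Y_def
    by (subst wfrec[OF wf_measure]) (auto simp: F_def cut_def fun_eq_iff)
  define X where "X = (\<lambda>u w. Y w u)"
  have X: "X u w = (if w \<notin> V \<or> u \<notin> V then 0 else if u = w then 1 else
      if r u < r w then - (\<Sum>k\<in>{k\<in>V. r k < r w}. X u k * A k w) else 0)" for u w
    unfolding X_def by (subst Y) (simp add: F_def)
  have tri: "unitri r V X"
  proof (unfold unitri_def extensional_on_def, intro conjI allI ballI impI)
    show "X v v = 1" if "v \<in> V" for v using that by (subst X) simp
    show "X v w = 0" if "v \<notin> V \<or> w \<notin> V" for v w using that by (subst X) auto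
    show "X v w = 0" if "v \<noteq> w" "\<not> r v < r w" for v w using that by (subst X) auto
  qed
  have "mmult V X A = idm V"
  proof (rule extensional_on_eqI)
    show "extensional_on V (mmult V X A)"
      using tri assms by (simp add: extensional_on_mmult unitri_ext)
    fix u w assume uw: "u \<in> V" "w \<in> V"
    have *: "mmult V X A u w = X u w + (\<Sum>k\<in>{k\<in>V. r k < r w}. X u k * A k w)"
      using assms uw by (simp add: unitri_mmult_col)
    show "mmult V X A u w = idm V u w"
    proof (cases "r u < r w")
      case True
      then have "X u w = - (\<Sum>k\<in>{k\<in>V. r k < r w}. X u k * A k w)"
        using X[of u w] uw by (metis less_irrefl)
      then show ?thesis using * True by (auto simp: idm_def)
    next
      case False
      have "(\<Sum>k\<in>{k\<in>V. r k < r w}. X u k * A k w) = 0"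
      proof (rule sum.neutral, rule ballI)
        fix k assume "k \<in> {k\<in>V. r k < r w}"
        then have "u \<noteq> k" "\<not> r u < r k" using False by auto
        then show "X u k * A k w = 0" by (simp add: unitri_below[OF tri])
      qed
      then show ?thesis using * False uw unitri_diag[OF tri, of u] unitri_below[OF tri, of u w]
        by (auto simp: idm_def)
    qed
  qed simp
  with tri show ?thesis by blast
qed

text \<open>The left inverse \<open>X\<close> has a triangular left inverse \<open>Y\<close> of its
  own, and \<open>Y = Y (X A) = (Y X) A = A\<close>, so \<open>X\<close> inverts \<open>A\<close> on
  both sides.\<close>

lemma unitri_inverse:
  fixes A :: "'a::comm_ring_1 mat"
  assumes "finite V" "unitri r V A"
  obtains X where "unitri r V X" "mmult V X A = idm V" "mmult V A X = idm V"
proof -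
  obtain X where X: "unitri r V X" "mmult V X A = idm V"
    using unitri_left_inverse[OF assms] by blast
  obtain Y where Y: "unitri r V Y" "mmult V Y X = idm V"
    using unitri_left_inverse[OF assms(1) X(1)] by blast
  have "Y = mmult V Y (mmult V X A)"
    using X Y assms by (simp add: mmult_idm_right unitri_ext)
  also have "\<dots> = A"
    unfolding mmult_assoc[symmetric] Y(2) using assms by (simp add: mmult_idm_left unitri_ext)
  finally show ?thesis using that X Y by simp
qed

text \<open>Blocks are level sets of a labelling. Later the label of a node is its bidirected
  component in \<open>G\<close>, also when the matrix lives on the nodes of a mixed
  component.\<close>

definition blockdiag :: "(nat \<Rightarrow> 'c) \<Rightarrow> 'a::zero mat \<Rightarrow> bool" where
  "blockdiag c A \<longleftrightarrow> (\<forall>v w. c v \<noteq> c w \<longrightarrow> A v w = 0)"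

text \<open>Induction on the rank of the column: in a term \<open>X u k * U k w\<close> of the
  recursion either \<open>k\<close> has the label of \<open>w\<close>, and the induction hypothesis
  kills \<open>X u k\<close>, or \<open>U k w\<close> is zero.\<close>

lemma blockdiag_inverse:
  assumes fin: "finite V" and U: "unitri r V U" "blockdiag c U"
    and X: "unitri r V X" "mmult V X U = idm V"
  shows "blockdiag c X"
proof -
  have "\<forall>u. c u \<noteq> c w \<longrightarrow> X u w = 0" for w
  proof (induction "r w" arbitrary: w rule: less_induct)
    case less
    show ?case
    proof (intro allI impI)
      fix u assume *: "c u \<noteq> c w"
      show "X u w = 0"
      proof (cases "w \<in> V")
        case True
        have "(\<Sum>k\<in>{k\<in>V. r k < r w}. X u k * U k w) = 0"
        proof (rule sum.neutral, rule ballI)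
          fix k assume "k \<in> {k\<in>V. r k < r w}"
          then show "X u k * U k w = 0"
            using less[of k] * U(2) by (cases "c k = c w") (auto simp: blockdiag_def)
        qed
        moreover have "mmult V X U u w = 0" using X * by (auto simp: idm_def)
        ultimately show ?thesis
          using unitri_mmult_col[OF fin U(1) True, of X u] by simp
      qed (rule unitri_out2[OF X(1)])
    qed
  qed
  then show ?thesis by (auto simp: blockdiag_def)
qed

section \<open>Block triangular factorizations\<close>

text \<open>The square-root-free Cholesky factorization \<open>Om = U^T diag(d) U\<close>. Nonzero
  pivots make the factors unique and computable from \<open>Om\<close> by division.\<close>

definition ldl :: "(nat \<Rightarrow> nat) \<Rightarrow> nat set \<Rightarrow> (nat \<Rightarrow> 'c) \<Rightarrow> 'a::field mat \<Rightarrow> 'a mat \<Rightarrow> (nat \<Rightarrow> 'a) \<Rightarrow> bool" where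
  "ldl r V c Om U d \<longleftrightarrow> unitri r V U \<and> blockdiag c U \<and> (\<forall>v\<in>V. d v \<noteq> 0)
     \<and> (\<forall>a\<in>V. \<forall>b\<in>V. Om a b = (\<Sum>k\<in>V. U k a * d k * U k b))"

text \<open>The term \<open>k = v\<close> isolates \<open>d v * B v w\<close>, and the others
  involve earlier rows only: one step of the Cholesky algorithm.\<close>

lemma unitri_ldl_entry:
  assumes "finite V" "unitri r V B" "v \<in> V" "r v < r w \<or> v = w"
  shows "(\<Sum>k\<in>V. B k v * d k * B k w) =
    d v * B v w + (\<Sum>k\<in>{k\<in>V. r k < r v}. B k v * d k * B k w)"
proof -
  have "(\<Sum>k\<in>V. B k v * d k * B k w) = (\<Sum>k\<in>insert v {k\<in>V. r k < r v}. B k v * d k * B k w)"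
    using assms by (intro sum.mono_neutral_right) (auto simp: unitri_below)
  also have "\<dots> = d v * B v w + (\<Sum>k\<in>{k\<in>V. r k < r v}. B k v * d k * B k w)"
    using assms by (subst sum.insert) (auto simp: unitri_diag)
  finally show ?thesis .
qed

text \<open>Row by row: for different labels of \<open>v\<close> and \<open>w\<close> every earlier
  row contributes zero by induction, so \<open>d v * B v w = Om v w = 0\<close> and the pivot
  cancels. The block structure of \<open>Om\<close> is thus forced on its factor.\<close>

lemma blockdiag_unitri_factor:
  fixes B :: "'a::field mat"
  assumes fin: "finite V" and B: "unitri r V B" and d: "\<forall>v\<in>V. d v \<noteq> 0"
    and Om: "\<forall>a\<in>V. \<forall>b\<in>V. Om a b = (\<Sum>k\<in>V. B k a * d k * B k b)" and blk: "blockdiag c Om"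
  shows "blockdiag c B"
proof -
  have "\<forall>w. c v \<noteq> c w \<longrightarrow> B v w = 0" for v
  proof (induction "r v" arbitrary: v rule: less_induct)
    case less
    show ?case
    proof (intro allI impI)
      fix w assume *: "c v \<noteq> c w"
      show "B v w = 0"
      proof (cases "v \<in> V \<and> w \<in> V \<and> r v < r w")
        case True
        have "(\<Sum>k\<in>{k\<in>V. r k < r v}. B k v * d k * B k w) = 0"
        proof (rule sum.neutral, rule ballI)
          fix k assume "k \<in> {k\<in>V. r k < r v}"
          then show "B k v * d k * B k w = 0"
            using less[of k] * by (cases "c k = c v") auto
        qed
        then have "Om v w = d v * B v w"
          using unitri_ldl_entry[OF fin B, of v w d] Om True by simp
        moreover have "Om v w = 0" using blk * by (auto simp: blockdiag_def)
        ultimately show ?thesis using d True by simp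
      next
        case False
        moreover have "v \<noteq> w" using * by auto
        ultimately show ?thesis
          using unitri_below[OF B, of v w] unitri_out1[OF B, of v w] unitri_out2[OF B, of w v] by blast
      qed
    qed
  qed
  then show ?thesis by (auto simp: blockdiag_def)
qed

text \<open>Gaussian elimination with every Schur complement scaled by its pivot. The scaling avoids
  division, so the value is polynomial in the entries; over a field it is nonzero exactly when
  elimination in the listed order meets no zero pivot.\<close>

fun pivot_prod :: "nat list \<Rightarrow> 'a::comm_ring_1 mat \<Rightarrow> 'a" where
  "pivot_prod [] A = 1"
| "pivot_prod (v # vs) A = A v v * pivot_prod vs (\<lambda>a b. A v v * A a b - A a v * A v b)"

text \<open>Eliminating \<open>v\<close> leaves a matrix that is again symmetric and block diagonal,
  since \<open>A a v * A v b\<close> can be nonzero only if \<open>a\<close>, \<open>v\<close> and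
  \<open>b\<close> share a label. Its factorization is extended by one row.\<close>

lemma ldl_exists:
  fixes A :: "'a::field mat"
  assumes "sorted_wrt (\<lambda>a b. r a < r b) vs" "pivot_prod vs A \<noteq> 0"
    and "\<forall>a b. A a b = A b a" "blockdiag c A"
  shows "\<exists>U d. ldl r (set vs) c A U d"
  using assms
proof (induction vs arbitrary: A)
  case Nil
  show ?case by (rule exI[of _ "\<lambda>_ _. 0"]) (auto simp: ldl_def unitri_def extensional_on_def blockdiag_def)
next
  case (Cons v vs)
  define A' where "A' = (\<lambda>a b. A v v * A a b - A a v * A v b)"
  have al: "A v v \<noteq> 0" using Cons.prems by auto
  have notin: "v \<notin> set vs" using Cons.prems(1) by auto
  have "\<exists>U d. ldl r (set vs) c A' U d"
  proof (rule Cons.IH)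
    show "pivot_prod vs A' \<noteq> 0" using Cons.prems(2) by (auto simp: A'_def)
    show "\<forall>a b. A' a b = A' b a" using Cons.prems(3) by (auto simp: A'_def)
    show "blockdiag c A'" using Cons.prems(4) unfolding blockdiag_def A'_def
      by (metis diff_zero mult_zero_left mult_zero_right)
  qed (use Cons.prems in auto)
  then obtain U d where U: "unitri r (set vs) U" "blockdiag c U" and d: "\<forall>v\<in>set vs. d v \<noteq> 0"
    and A': "\<And>a b. a \<in> set vs \<Longrightarrow> b \<in> set vs \<Longrightarrow> A' a b = (\<Sum>k\<in>set vs. U k a * d k * U k b)"
    by (auto simp: ldl_def)
  \<comment> \<open>The new row is the pivot row divided by the pivot. \<open>A'\<close> is
    \<open>A v v\<close> times the Schur complement, hence the division of the old pivots by
    \<open>A v v\<close>.\<close>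
  define U' where "U' = (\<lambda>a b. if a = v then if b \<in> set (v # vs) then A v b / A v v else 0 else U a b)"
  define d' where "d' = (\<lambda>k. if k = v then A v v else d k / A v v)"
  have Uv: "U k v = 0" for k using unitri_out2[OF U(1) notin] .
  have "ldl r (set (v # vs)) c A U' d'"
    unfolding ldl_def
  proof (intro conjI ballI)
    show "unitri r (set (v # vs)) U'"
      unfolding unitri_def extensional_on_def
    proof (intro conjI allI impI ballI)
      fix a b assume "a \<noteq> b" "\<not> r a < r b"
      then show "U' a b = 0"
        using Cons.prems(1) unitri_below[OF U(1)] by (auto simp: U'_def)
    next
      fix a assume "a \<in> set (v # vs)"
      then show "U' a a = 1" using al unitri_diag[OF U(1)] by (auto simp: U'_def)
    next
      fix a b assume "a \<notin> set (v # vs) \<or> b \<notin> set (v # vs)"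
      then show "U' a b = 0" using unitri_out1[OF U(1)] unitri_out2[OF U(1)] by (auto simp: U'_def)
    qed
    show "blockdiag c U'"
      using U(2) Cons.prems(4) by (auto simp: U'_def blockdiag_def)
    show "d' k \<noteq> 0" if "k \<in> set (v # vs)" for k using that d al by (auto simp: d'_def)
    fix a b assume ab: "a \<in> set (v # vs)" "b \<in> set (v # vs)"
    have "(\<Sum>k\<in>set (v # vs). U' k a * d' k * U' k b)
        = A v a * A v b / A v v + (\<Sum>k\<in>set vs. U' k a * d' k * U' k b)"
      using notin ab al by (simp add: U'_def d'_def)
    also have "(\<Sum>k\<in>set vs. U' k a * d' k * U' k b) = (\<Sum>k\<in>set vs. U k a * d k * U k b) / A v v"
      unfolding sum_divide_distrib using notin by (intro sum.cong) (auto simp: U'_def d'_def)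
    also have "\<dots> = (A v v * A a b - A a v * A v b) / A v v"
      using ab A'[of a b] Cons.prems(3) by (auto simp: Uv A'_def)
    finally show "A a b = (\<Sum>k\<in>set (v # vs). U' k a * d' k * U' k b)"
      using al Cons.prems(3) by (simp add: field_simps)
  qed
  then show ?case by blast
qed

text \<open>Completing the square: the first diagonal entry is positive, and minimizing the form
  over the first coordinate shows that the Schur complement is again positive definite.\<close>

lemma pivot_prod_pos:
  fixes A :: "real mat"
  assumes "distinct vs" "\<forall>a b. A a b = A b a"
    and "\<And>x. \<exists>v\<in>set vs. x v \<noteq> 0 \<Longrightarrow> (\<Sum>v\<in>set vs. \<Sum>w\<in>set vs. x v * A v w * x w) > 0"
  shows "pivot_prod vs A > 0"
  using assms
proof (induction vs arbitrary: A)
  case (Cons v vs)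
  let ?S = "set vs"
  have notin: "v \<notin> ?S" using Cons.prems by auto
  have expand: "(\<Sum>a\<in>set (v # vs). \<Sum>b\<in>set (v # vs). x a * A a b * x b) =
     A v v * (x v)\<^sup>2 + 2 * x v * (\<Sum>b\<in>?S. A v b * x b) + (\<Sum>a\<in>?S. \<Sum>b\<in>?S. x a * A a b * x b)" for x
  proof -
    have "(\<Sum>a\<in>?S. x a * A a v * x v) = x v * (\<Sum>b\<in>?S. A v b * x b)"
      unfolding sum_distrib_left
      by (intro sum.cong refl) (subst Cons.prems(2)[rule_format], simp add: mult_ac)
    moreover have "(\<Sum>b\<in>?S. x v * A v b * x b) = x v * (\<Sum>b\<in>?S. A v b * x b)"
      by (simp add: sum_distrib_left mult_ac)
    ultimately show ?thesis
      using notin by (simp add: sum.distrib power2_eq_square mult_ac)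
  qed
  have al: "A v v > 0"
  proof -
    have s0: "(\<Sum>b\<in>?S. A v b * (if b = v then 1 else 0)) = 0"
      using notin by (intro sum.neutral) auto
    have s1: "(\<Sum>a\<in>?S. \<Sum>b\<in>?S. (if a = v then 1 else 0) * A a b * (if b = v then 1 else 0)) = 0"
      using notin by (intro sum.neutral) auto
    show ?thesis
      using Cons.prems(3)[of "\<lambda>b. if b = v then 1 else 0"] unfolding expand s0 s1 by simp
  qed
  define A' where "A' = (\<lambda>a b. A v v * A a b - A a v * A v b)"
  have "pivot_prod vs A' > 0"
  proof (rule Cons.IH)
    show "\<forall>a b. A' a b = A' b a" using Cons.prems(2) by (auto simp: A'_def)
    fix x :: "nat \<Rightarrow> real" assume x: "\<exists>v\<in>?S. x v \<noteq> 0"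
    define s where "s = (\<Sum>b\<in>?S. A v b * x b)"
    \<comment> \<open>The coordinate at \<open>v\<close> minimizes the form with the others fixed;
      the minimum is the form of \<open>A'\<close> at \<open>x\<close>, divided by
      \<open>A v v\<close>.\<close>
    define y where "y = x(v := - s / A v v)"
    have y: "y a = x a" if "a \<in> ?S" for a using that notin by (auto simp: y_def)
    have "0 < (\<Sum>a\<in>set (v # vs). \<Sum>b\<in>set (v # vs). y a * A a b * y b)"
      using x y by (intro Cons.prems(3)) auto
    also have "\<dots> = A v v * (s / A v v)\<^sup>2 - 2 * (s / A v v) * s + (\<Sum>a\<in>?S. \<Sum>b\<in>?S. x a * A a b * x b)"
      unfolding expand using y by (simp add: s_def y_def cong: sum.cong)
    also have "\<dots> = (A v v * (\<Sum>a\<in>?S. \<Sum>b\<in>?S. x a * A a b * x b) - s * s) / A v v"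
      using al by (simp add: field_simps power2_eq_square)
    also have "s * s = (\<Sum>a\<in>?S. \<Sum>b\<in>?S. x a * (A a v * A v b) * x b)"
      unfolding s_def sum_product
      by (intro sum.cong refl) (subst (2) Cons.prems(2)[rule_format], simp add: mult_ac)
    also have "A v v * (\<Sum>a\<in>?S. \<Sum>b\<in>?S. x a * A a b * x b) - \<dots> = (\<Sum>a\<in>?S. \<Sum>b\<in>?S. x a * A' a b * x b)"
      unfolding sum_distrib_left sum_subtractf[symmetric]
      by (intro sum.cong refl) (simp add: A'_def algebra_simps)
    finally show "(\<Sum>a\<in>?S. \<Sum>b\<in>?S. x a * A' a b * x b) > 0" using al by (simp add: zero_less_divide_iff)
  qed (use Cons.prems in auto)
  then show ?case using al by (simp add: A'_def)
qed simp

lemma minv_unitri: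
  fixes P :: "'a::comm_ring_1 mat"
  assumes "finite V" "unitri r V P"
  shows "unitri r V (minv V P)" "mmult V P (minv V P) = idm V" "mmult V (minv V P) P = idm V"
proof -
  obtain X where X: "unitri r V X" "mmult V X P = idm V" "mmult V P X = idm V"
    using unitri_inverse[OF assms] .
  have "minv V P = X"
    unfolding minv_def
  proof (rule the_equality)
    show "extensional_on V X \<and> mmult V P X = idm V \<and> mmult V X P = idm V"
      using X by (simp add: unitri_ext)
    fix N assume N: "extensional_on V N \<and> mmult V P N = idm V \<and> mmult V N P = idm V"
    have "N = mmult V (mmult V X P) N" using N assms X by (simp add: mmult_idm_left)
    also have "\<dots> = X" unfolding mmult_assoc using N assms X by (simp add: mmult_idm_right unitri_ext)
    finally show "N = X" .
  qed
  then show "unitri r V (minv V P)" "mmult V P (minv V P) = idm V" "mmult V (minv V P) P = idm V"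
    using X by auto
qed

section \<open>Rings of functions closed under inversion of nowhere vanishing elements\<close>

text \<open>Stated for an arbitrary class \<open>R\<close>, so that one induction covers
  substitution into univariate polynomials, into polynomials of another graph and into function
  rings.\<close>

lemma polyfuns_subst:
  assumes "p \<in> polyfuns X"
    and "\<And>c. (\<lambda>_. c) \<in> R"
    and "\<And>f g. f \<in> R \<Longrightarrow> g \<in> R \<Longrightarrow> (\<lambda>t. f t + g t) \<in> R"
    and "\<And>f g. f \<in> R \<Longrightarrow> g \<in> R \<Longrightarrow> (\<lambda>t. f t * g t) \<in> R"
    and "\<And>f. f \<in> X \<Longrightarrow> (\<lambda>t. f (s t)) \<in> R"
  shows "(\<lambda>t. p (s t)) \<in> R"
  using assms(1) by induction (auto intro: assms)

text \<open>Membership in \<open>K\<close> stands for "determined by the data that \<open>K\<close>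
  encodes". Only functions without zeros on \<open>T\<close> are inverted, and \<open>agree\<close>
  makes membership a matter of the values on \<open>T\<close>.\<close>

locale function_field =
  fixes T :: "'t set" and K :: "('t \<Rightarrow> 'a::field) set"
  assumes const: "(\<lambda>_. a) \<in> K"
    and add: "f \<in> K \<Longrightarrow> g \<in> K \<Longrightarrow> (\<lambda>t. f t + g t) \<in> K"
    and mult: "f \<in> K \<Longrightarrow> g \<in> K \<Longrightarrow> (\<lambda>t. f t * g t) \<in> K"
    and inverse: "f \<in> K \<Longrightarrow> (\<And>t. t \<in> T \<Longrightarrow> f t \<noteq> 0) \<Longrightarrow> (\<lambda>t. inverse (f t)) \<in> K"
    and agree: "f \<in> K \<Longrightarrow> (\<And>t. t \<in> T \<Longrightarrow> f t = g t) \<Longrightarrow> g \<in> K"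
begin

lemma diff: "f \<in> K \<Longrightarrow> g \<in> K \<Longrightarrow> (\<lambda>t. f t - g t) \<in> K"
  using add[of f "\<lambda>t. - 1 * g t"] mult[OF const, of g "- 1"] by simp

lemma divide:
  "f \<in> K \<Longrightarrow> g \<in> K \<Longrightarrow> (\<And>t. t \<in> T \<Longrightarrow> g t \<noteq> 0) \<Longrightarrow> (\<lambda>t. f t / g t) \<in> K"
  using mult[OF _ inverse, of f g] by (simp add: divide_inverse)

lemma sum: "(\<And>i. i \<in> I \<Longrightarrow> f i \<in> K) \<Longrightarrow> (\<lambda>t. \<Sum>i\<in>I. f i t) \<in> K"
  by (induction I rule: infinite_finite_induct) (auto intro: const add)

lemma polyfuns_mem:
  assumes "p \<in> polyfuns X" "\<And>f. f \<in> X \<Longrightarrow> (\<lambda>t. f (s t)) \<in> K"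
  shows "(\<lambda>t. p (s t)) \<in> K"
  by (rule polyfuns_subst[OF assms(1) const add mult assms(2)])

text \<open>The factorization algorithm uses ring operations and division by pivots, which have no
  zeros on \<open>T\<close>, so pivots and rows stay in \<open>K\<close>. For the two-point instance
  this is the uniqueness of the factorization.\<close>

lemma ldl_mem:
  assumes fin: "finite V" and L: "\<And>t. t \<in> T \<Longrightarrow> unitri r V (L t)"
    and d: "\<And>t v. t \<in> T \<Longrightarrow> v \<in> V \<Longrightarrow> d t v \<noteq> 0"
    and S: "\<And>t a b. t \<in> T \<Longrightarrow> a \<in> V \<Longrightarrow> b \<in> V \<Longrightarrow> S t a b = (\<Sum>k\<in>V. L t k a * d t k * L t k b)"
    and K: "\<And>a b. a \<in> V \<Longrightarrow> b \<in> V \<Longrightarrow> (\<lambda>t. S t a b) \<in> K"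
    and v: "v \<in> V"
  shows "(\<lambda>t. d t v) \<in> K \<and> (\<forall>w\<in>V. (\<lambda>t. L t v w) \<in> K)"
  using v
proof (induction "r v" arbitrary: v rule: less_induct)
  case less
  note v = less.prems
  have IH: "(\<lambda>t. d t k) \<in> K" "w \<in> V \<Longrightarrow> (\<lambda>t. L t k w) \<in> K" if "k \<in> {k\<in>V. r k < r v}" for k w
    using less that by auto
  \<comment> \<open>What earlier rows leave of row \<open>v\<close>, namely
    \<open>d t v * L t v w\<close>; at \<open>w = v\<close> it is the pivot itself.\<close>
  define R where "R = (\<lambda>w t. S t v w - (\<Sum>k\<in>{k\<in>V. r k < r v}. L t k v * d t k * L t k w))"
  have R: "R w \<in> K" if "w \<in> V" for w
    unfolding R_def using that v by (intro diff K sum mult IH)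
  have Req: "R w t = d t v * L t v w" if "t \<in> T" "w \<in> V" "r v < r w \<or> v = w" for t w
    using that S[of t v w] unitri_ldl_entry[OF fin L[OF that(1)] v that(3), of "d t"] v
    by (simp add: R_def)
  have dK: "(\<lambda>t. d t v) \<in> K"
    by (rule agree[OF R[OF v]]) (use Req[of _ v] v unitri_diag[OF L v] in simp)
  moreover have "(\<lambda>t. L t v w) \<in> K" if w: "w \<in> V" for w
  proof (cases "v = w")
    case True
    show ?thesis by (rule agree[OF const[of 1]]) (use True unitri_diag[OF L v] in simp)
  next
    case ne: False
    show ?thesis
    proof (cases "r v < r w")
      case True
      show ?thesis
        by (rule agree[OF divide[OF R[OF w] dK]]) (use Req[OF _ w] True d v in auto)
    next
      case False
      show ?thesis by (rule agree[OF const[of 0]]) (use unitri_below[OF L ne False] in simp)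
    qed
  qed
  ultimately show ?case by blast
qed

text \<open>Back substitution in increasing rank of the column; it stays in \<open>K\<close> because
  it only adds and multiplies.\<close>

lemma unitri_inverse_mem:
  assumes fin: "finite V" and A: "\<And>t. t \<in> T \<Longrightarrow> unitri r V (A t)"
    and X: "\<And>t. t \<in> T \<Longrightarrow> mmult V (X t) (A t) = idm V"
    and K: "\<And>a b. a \<in> V \<Longrightarrow> b \<in> V \<Longrightarrow> (\<lambda>t. A t a b) \<in> K"
    and "w \<in> V" "u \<in> V"
  shows "(\<lambda>t. X t u w) \<in> K"
  using \<open>w \<in> V\<close>
proof (induction "r w" arbitrary: w rule: less_induct)
  case less
  have "(\<lambda>t. idm V u w - (\<Sum>k\<in>{k\<in>V. r k < r w}. X t u k * A t k w)) \<in> K"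
    using less by (intro diff const sum mult K) auto
  then show ?case
  proof (rule agree)
    fix t assume t: "t \<in> T"
    have "mmult V (X t) (A t) u w = idm V u w" using X[OF t] by simp
    then show "idm V u w - (\<Sum>k\<in>{k\<in>V. r k < r w}. X t u k * A t k w) = X t u w"
      using unitri_mmult_col[OF fin A[OF t] less.prems, of "X t" u] by (simp add: algebra_simps)
  qed
qed

end

section \<open>Covariance matrices of acyclic mixed graphs\<close>

text \<open>The rank fixes one topological order for \<open>G\<close> and its components.
  Injectivity makes it total, so that the nodes can be listed for elimination.\<close>

locale acyclic_mixed_graph =
  fixes G :: mgraph and r :: "nat \<Rightarrow> nat"
  assumes mixed: "mixed_graph G"
    and rank: "(v, w) \<in> dedges G \<Longrightarrow> r v < r w"
    and inj_rank: "inj_on r (nodes G)"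
begin

abbreviation "V \<equiv> nodes G"

lemma finite_nodes [simp]: "finite V"
  and dedges_nodes: "(v, w) \<in> dedges G \<Longrightarrow> v \<in> V \<and> w \<in> V"
  and bedges_nodes: "(v, w) \<in> bedges G \<Longrightarrow> v \<in> V \<and> w \<in> V"
  and sym_bedges: "sym (bedges G)"
  using mixed by (auto simp: mixed_graph_def)

lemma unitri_I_minus:
  assumes "\<forall>v w. (v, w) \<notin> dedges G \<longrightarrow> L v w = 0"
  shows "unitri r V (I_minus V L)"
  unfolding unitri_def extensional_on_def
proof (intro conjI ballI allI impI)
  show "I_minus V L v w = 0" if "v \<notin> V \<or> w \<notin> V" for v w
  proof -
    have "L v w = 0" using assms that dedges_nodes[of v w] by blast
    then show ?thesis using that by (auto simp: I_minus_def idm_def)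
  qed
  show "I_minus V L v w = 0" if "v \<noteq> w" "\<not> r v < r w" for v w
  proof -
    have "L v w = 0" using assms that rank[of v w] by blast
    then show ?thesis using that by (auto simp: I_minus_def idm_def)
  qed
  show "I_minus V L v v = 1" if "v \<in> V" for v
  proof -
    have "L v v = 0" using assms rank[of v v] by blast
    then show ?thesis using that by (auto simp: I_minus_def idm_def)
  qed
qed

text \<open>Acyclicity makes \<open>I - Lambda\<close> unit triangular, hence invertible for every
  \<open>Lambda\<close> with the right support. The remaining conditions are linear, so the space
  contains the line through any two of its points.\<close>

lemma supp_ok_iff:
  "supp_ok G L Om \<longleftrightarrow> (\<forall>v w. (v, w) \<notin> dedges G \<longrightarrow> L v w = 0) \<and> extensional_on V Om
     \<and> (\<forall>v w. Om v w = Om w v) \<and> (\<forall>v w. v \<noteq> w \<and> (v, w) \<notin> bedges G \<longrightarrow> Om v w = 0)"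
  using minv_unitri(2,3)[OF finite_nodes unitri_I_minus[of L]]
  unfolding supp_ok_def invertible_on_def by blast

text \<open>Over an arbitrary field: the complex parameter space itself, or the real one before
  positive definiteness is imposed.\<close>

definition params :: "('a::field mat \<times> 'a mat) set" where
  "params = {\<theta>. supp_ok G (fst \<theta>) (snd \<theta>)}"

abbreviation "IL \<theta> \<equiv> I_minus V (fst \<theta>)"
abbreviation "IL_inv \<theta> \<equiv> minv V (IL \<theta>)"

lemma params_unitri:
  assumes "\<theta> \<in> params"
  shows "unitri r V (IL \<theta>)" "unitri r V (IL_inv \<theta>)"
    "mmult V (IL \<theta>) (IL_inv \<theta>) = idm V" "mmult V (IL_inv \<theta>) (IL \<theta>) = idm V"
proof -
  show *: "unitri r V (IL \<theta>)"
    by (rule unitri_I_minus) (use assms in \<open>simp add: params_def supp_ok_iff\<close>)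
  show "unitri r V (IL_inv \<theta>)"
    "mmult V (IL \<theta>) (IL_inv \<theta>) = idm V" "mmult V (IL_inv \<theta>) (IL \<theta>) = idm V"
    using minv_unitri[OF finite_nodes *] .
qed

lemma phi_eq: "phi G \<theta> = mmult V (mmult V (mtrans (IL_inv \<theta>)) (snd \<theta>)) (IL_inv \<theta>)"
  by (simp add: phi_def Let_def)

lemma extensional_on_phi: "\<theta> \<in> params \<Longrightarrow> extensional_on V (phi G \<theta>)"
  unfolding phi_eq
  by (intro extensional_on_mmult)
     (auto simp: unitri_ext[OF params_unitri(2)], auto simp: params_def supp_ok_iff)

lemma Omega_from_phi:
  assumes "\<theta> \<in> params"
  shows "snd \<theta> = mmult V (mmult V (mtrans (IL \<theta>)) (phi G \<theta>)) (IL \<theta>)"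
proof -
  note u = params_unitri[OF assms]
  have ext: "extensional_on V (snd \<theta>)" using assms by (simp add: params_def supp_ok_iff)
  have "mmult V (mtrans (IL \<theta>)) (mtrans (IL_inv \<theta>)) = mtrans (mmult V (IL_inv \<theta>) (IL \<theta>))"
    by (simp add: mtrans_mmult)
  also have "\<dots> = idm V" unfolding u by (auto simp: mtrans_def idm_def fun_eq_iff)
  finally have "mmult V (mtrans (IL \<theta>)) (mmult V (mtrans (IL_inv \<theta>)) (snd \<theta>)) = snd \<theta>"
    unfolding mmult_assoc[symmetric] using ext by (simp add: mmult_idm_left)
  then have "mmult V (mtrans (IL \<theta>)) (phi G \<theta>) = mmult V (snd \<theta>) (IL_inv \<theta>)"
    unfolding phi_eq mmult_assoc[symmetric] by simp
  then show ?thesis using u ext by (simp add: mmult_assoc mmult_idm_right)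
qed

text \<open>A congruence by \<open>N\<close> multiplies the triangular factor by \<open>N\<close>
  and keeps the pivots. Factorizations pass in this way from Omega to Sigma and back.\<close>

lemma diag_quadratic:
  assumes "\<And>a b. a \<in> V \<Longrightarrow> b \<in> V \<Longrightarrow> Om a b = (\<Sum>k\<in>V. U k a * d k * U k b)"
    and "a \<in> V" "b \<in> V"
  shows "mmult V (mmult V (mtrans N) Om) N a b = (\<Sum>k\<in>V. mmult V U N k a * d k * mmult V U N k b)"
proof -
  have "mmult V (mmult V (mtrans N) Om) N a b = (\<Sum>j\<in>V. (\<Sum>i\<in>V. N i a * Om i j) * N j b)"
    by (simp add: mmult_def mtrans_def)
  also have "\<dots> = (\<Sum>j\<in>V. (\<Sum>i\<in>V. \<Sum>k\<in>V. U k i * N i a * d k * U k j * N j b))"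
    unfolding sum_distrib_right
    by (intro sum.cong refl) (simp add: assms sum_distrib_left sum_distrib_right mult_ac)
  also have "\<dots> = (\<Sum>j\<in>V. (\<Sum>k\<in>V. \<Sum>i\<in>V. U k i * N i a * d k * U k j * N j b))"
    by (rule sum.cong[OF refl], rule sum.swap)
  also have "\<dots> = (\<Sum>k\<in>V. (\<Sum>j\<in>V. \<Sum>i\<in>V. U k i * N i a * d k * U k j * N j b))"
    by (rule sum.swap)
  also have "\<dots> = (\<Sum>k\<in>V. mmult V U N k a * d k * mmult V U N k b)"
    by (rule sum.cong[OF refl], subst sum.swap)
      (simp add: mmult_def sum_distrib_left sum_distrib_right mult_ac)
  finally show ?thesis .
qed

lemma phi_ldl:
  assumes "ldl r V c (snd \<theta>) U d" "a \<in> V" "b \<in> V"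
  shows "phi G \<theta> a b = (\<Sum>k\<in>V. mmult V U (IL_inv \<theta>) k a * d k * mmult V U (IL_inv \<theta>) k b)"
  unfolding phi_eq by (rule diag_quadratic) (use assms in \<open>auto simp: ldl_def\<close>)

section \<open>Sigma and the triangular data of a family of parameters, inside
  \<open>K\<close>\<close>

context
  fixes T :: "'t set" and K :: "('t \<Rightarrow> 'a::field) set" and \<theta> :: "'t \<Rightarrow> 'a mat \<times> 'a mat"
    and U W :: "'t \<Rightarrow> 'a mat" and d :: "'t \<Rightarrow> nat \<Rightarrow> 'a" and c :: "nat \<Rightarrow> 'c"
  assumes K: "function_field T K"
    and par: "\<And>t. t \<in> T \<Longrightarrow> \<theta> t \<in> params"
    and fac: "\<And>t. t \<in> T \<Longrightarrow> ldl r V c (snd (\<theta> t)) (U t) (d t)"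
    and W: "\<And>t. t \<in> T \<Longrightarrow> unitri r V (W t)"
      "\<And>t. t \<in> T \<Longrightarrow> mmult V (W t) (U t) = idm V" "\<And>t. t \<in> T \<Longrightarrow> mmult V (U t) (W t) = idm V"
begin

private lemma factor_unitri:
  assumes t: "t \<in> T"
  shows "unitri r V (mmult V (U t) (IL_inv (\<theta> t)))" "unitri r V (mmult V (IL (\<theta> t)) (W t))"
    "mmult V (mmult V (IL (\<theta> t)) (W t)) (mmult V (U t) (IL_inv (\<theta> t))) = idm V"
    "mmult V (mmult V (U t) (IL_inv (\<theta> t))) (mmult V (IL (\<theta> t)) (W t)) = idm V"
proof -
  note u = params_unitri[OF par[OF t]]
  have Ut: "unitri r V (U t)" using fac[OF t] by (simp add: ldl_def)
  show "unitri r V (mmult V (U t) (IL_inv (\<theta> t)))" "unitri r V (mmult V (IL (\<theta> t)) (W t))"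
    using u Ut W(1)[OF t] by (simp_all add: unitri_mmult)
  have "mmult V (W t) (mmult V (U t) (IL_inv (\<theta> t))) = IL_inv (\<theta> t)"
    unfolding mmult_assoc[symmetric] W(2)[OF t] using u by (simp add: mmult_idm_left unitri_ext)
  then show "mmult V (mmult V (IL (\<theta> t)) (W t)) (mmult V (U t) (IL_inv (\<theta> t))) = idm V"
    using u by (simp add: mmult_assoc)
  have "mmult V (IL_inv (\<theta> t)) (mmult V (IL (\<theta> t)) (W t)) = W t"
    unfolding mmult_assoc[symmetric] u using W(1)[OF t] by (simp add: mmult_idm_left unitri_ext)
  then show "mmult V (mmult V (U t) (IL_inv (\<theta> t))) (mmult V (IL (\<theta> t)) (W t)) = idm V"
    using W(3)[OF t] by (simp add: mmult_assoc)
qed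

text \<open>\<open>U (I - Lambda)^-1\<close> is the Cholesky factor of Sigma, so the algorithm finds
  it in \<open>K\<close>; its inverse is the matrix whose columns are local to the
  components.\<close>

lemma factor_mem_if_phi_mem:
  assumes "\<And>a b. a \<in> V \<Longrightarrow> b \<in> V \<Longrightarrow> (\<lambda>t. phi G (\<theta> t) a b) \<in> K"
  shows "a \<in> V \<Longrightarrow> (\<lambda>t. d t a) \<in> K"
    and "a \<in> V \<Longrightarrow> b \<in> V \<Longrightarrow> (\<lambda>t. mmult V (IL (\<theta> t)) (W t) a b) \<in> K"
proof -
  interpret K: function_field T K by (rule K)
  define L where "L = (\<lambda>t. mmult V (U t) (IL_inv (\<theta> t)))"
  have mem: "(\<lambda>t. d t a) \<in> K \<and> (\<forall>w\<in>V. (\<lambda>t. L t a w) \<in> K)" if "a \<in> V" for a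
  proof (rule K.ldl_mem[where S = "\<lambda>t. phi G (\<theta> t)"])
    show "unitri r V (L t)" if "t \<in> T" for t unfolding L_def by (rule factor_unitri[OF that])
    show "d t v \<noteq> 0" if "t \<in> T" "v \<in> V" for t v using fac[OF that(1)] that(2) by (simp add: ldl_def)
    show "phi G (\<theta> t) a b = (\<Sum>k\<in>V. L t k a * d t k * L t k b)"
      if "t \<in> T" "a \<in> V" "b \<in> V" for t a b
      unfolding L_def by (rule phi_ldl[OF fac[OF that(1)] that(2,3)])
  qed (use assms that in auto)
  then show "a \<in> V \<Longrightarrow> (\<lambda>t. d t a) \<in> K" by blast
  show "(\<lambda>t. mmult V (IL (\<theta> t)) (W t) a b) \<in> K" if "a \<in> V" "b \<in> V"
    by (rule K.unitri_inverse_mem[where A = L and V = V and r = r])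
       (use that mem factor_unitri in \<open>auto simp: L_def\<close>)
qed

lemma phi_mem_if_factor_mem:
  assumes d: "\<And>a. a \<in> V \<Longrightarrow> (\<lambda>t. d t a) \<in> K"
    and M: "\<And>a b. a \<in> V \<Longrightarrow> b \<in> V \<Longrightarrow> (\<lambda>t. mmult V (IL (\<theta> t)) (W t) a b) \<in> K"
    and ab: "a \<in> V" "b \<in> V"
  shows "(\<lambda>t. phi G (\<theta> t) a b) \<in> K"
proof -
  interpret K: function_field T K by (rule K)
  have L: "(\<lambda>t. mmult V (U t) (IL_inv (\<theta> t)) a b) \<in> K" if "a \<in> V" "b \<in> V" for a b
    by (rule K.unitri_inverse_mem[where A = "\<lambda>t. mmult V (IL (\<theta> t)) (W t)" and V = V and r = r])
       (use that M factor_unitri in auto)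
  have "(\<lambda>t. \<Sum>k\<in>V. mmult V (U t) (IL_inv (\<theta> t)) k a * d t k * mmult V (U t) (IL_inv (\<theta> t)) k b) \<in> K"
    by (intro K.sum K.mult L d ab)
  then show ?thesis by (rule K.agree) (simp add: phi_ldl[OF fac] ab)
qed

end

end

section \<open>Restriction to and replacement of mixed components\<close>

text \<open>\<open>E\<close> supplies the variances of the sources of \<open>G_C\<close> outside
  \<open>C\<close>. The variances that \<open>G\<close> gives to these nodes belong to other
  components, and the restriction must depend on the parameters of \<open>C\<close> alone.\<close>

definition restrict_param ::
  "mgraph \<Rightarrow> nat set \<Rightarrow> (nat \<Rightarrow> 'a::zero) \<Rightarrow> 'a mat \<times> 'a mat \<Rightarrow> 'a mat \<times> 'a mat" where
  "restrict_param G C E \<theta> =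
     ((\<lambda>a b. if a \<in> nodes (mixed_component G C) \<and> b \<in> C then fst \<theta> a b else 0),
      (\<lambda>a b. if a \<in> C \<and> b \<in> C then snd \<theta> a b
             else if a = b \<and> a \<in> nodes (mixed_component G C) then E a else 0))"

text \<open>The source variances of \<open>\<eta>\<close> have no counterpart in \<open>G\<close>
  and are dropped. The test for component nodes lets the result depend on \<open>\<eta>\<close> only
  through coordinates of \<open>G_C\<close>, as polynomial substitution requires.\<close>

definition replace_param ::
  "mgraph \<Rightarrow> nat set \<Rightarrow> 'a mat \<times> 'a mat \<Rightarrow> 'a mat \<times> 'a mat \<Rightarrow> 'a::zero mat \<times> 'a mat" where
  "replace_param G C \<eta> \<theta> =
     ((\<lambda>a b. if b \<in> C then (if a \<in> nodes (mixed_component G C) then fst \<eta> a b else 0) else fst \<theta> a b),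
      (\<lambda>a b. if a \<in> C \<and> b \<in> C then snd \<eta> a b else snd \<theta> a b))"

text \<open>Only the block of \<open>C\<close> carries information: sources have neither parents nor
  bidirected edges in \<open>G_C\<close>, so their part of the triangular factor is the
  identity.\<close>

definition embed :: "nat set \<Rightarrow> nat set \<Rightarrow> 'a mat \<Rightarrow> 'a::comm_ring_1 mat" where
  "embed W C A = (\<lambda>a b. if a \<in> C \<and> b \<in> C then A a b else idm W a b)"

lemma sum_embed:
  assumes "finite W" "C \<subseteq> W" "b \<in> W"
  shows "(\<Sum>k\<in>W. x k * embed W C A k b) = (if b \<in> C then (\<Sum>k\<in>C. x k * A k b) else x b)"
proof (cases "b \<in> C")
  case True
  then show ?thesis using assms
    by (simp, intro sum.mono_neutral_cong_right) (auto simp: embed_def idm_def)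
next
  case False
  then have "(\<Sum>k\<in>W. x k * embed W C A k b) = (\<Sum>k\<in>W. if k = b then x k else 0)"
    by (intro sum.cong) (auto simp: embed_def idm_def)
  with False show ?thesis using assms by simp
qed

section \<open>Bidirected components and the mixed components they span\<close>

context acyclic_mixed_graph
begin

abbreviation "bicomp v \<equiv> (bedges G)\<^sup>* `` {v}"
abbreviation "comp_nodes C \<equiv> nodes (mixed_component G C)"

lemma bidirected_path_nodes: "(v, w) \<in> (bedges G)\<^sup>* \<Longrightarrow> v \<in> V \<Longrightarrow> w \<in> V"
  by (induction rule: rtrancl_induct) (auto dest: bedges_nodes)

lemma comp_eq_iff: "bicomp v = bicomp w \<longleftrightarrow> (v, w) \<in> (bedges G)\<^sup>*"
proof
  assume "bicomp v = bicomp w"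
  then have "w \<in> bicomp v" by auto
  then show "(v, w) \<in> (bedges G)\<^sup>*" by auto
next
  have "sym ((bedges G)\<^sup>*)" by (simp add: sym_rtrancl sym_bedges)
  moreover assume "(v, w) \<in> (bedges G)\<^sup>*"
  ultimately show "bicomp v = bicomp w" by (auto dest: symD intro: rtrancl_trans)
qed

lemma bicomponents_eq: "bicomponents G = bicomp ` V"
  by (auto simp: bicomponents_def quotient_def)

lemma finite_bicomponents: "finite (bicomponents G)"
  by (simp add: bicomponents_eq)

lemma comp_bicomponents: "v \<in> V \<Longrightarrow> bicomp v \<in> bicomponents G" "v \<in> bicomp v"
  by (auto simp: bicomponents_eq)

lemma bicomponents_subset: "C \<in> bicomponents G \<Longrightarrow> C \<subseteq> V"
  by (auto simp: bicomponents_eq intro: bidirected_path_nodes)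

text \<open>Turns membership in a component into equality of labels, the form in which block
  diagonality is stated.\<close>

lemma mem_bicomponent_iff: "C \<in> bicomponents G \<Longrightarrow> v \<in> C \<longleftrightarrow> bicomp v = C"
proof -
  assume "C \<in> bicomponents G"
  then obtain u where "C = bicomp u" by (auto simp: bicomponents_eq)
  then show ?thesis using comp_eq_iff[of u v] by auto
qed

lemma comp_nodes_eq: "comp_nodes C = C \<union> (\<Union>v\<in>C. pa G v)"
  by (simp add: mixed_component_def Let_def)

lemma comp_dedges: "(v, w) \<in> dedges (mixed_component G C) \<longleftrightarrow> (v, w) \<in> dedges G \<and> w \<in> C"
  by (auto simp: mixed_component_def Let_def pa_def)

lemma comp_bedges: "bedges (mixed_component G C) = bedges G \<inter> C \<times> C"
  by (simp add: mixed_component_def Let_def)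

lemma bicomponent_subset_comp_nodes: "C \<subseteq> comp_nodes C"
  by (auto simp: comp_nodes_eq)

lemma comp_nodes_subset: "C \<in> bicomponents G \<Longrightarrow> comp_nodes C \<subseteq> V"
  using bicomponents_subset dedges_nodes by (fastforce simp: comp_nodes_eq pa_def)

lemma dedges_comp_nodes: "(v, w) \<in> dedges G \<Longrightarrow> w \<in> C \<Longrightarrow> v \<in> comp_nodes C"
  by (auto simp: comp_nodes_eq pa_def)

lemma acyclic_mixed_graph_component:
  assumes "C \<in> bicomponents G"
  shows "acyclic_mixed_graph (mixed_component G C) r"
proof
  show "mixed_graph (mixed_component G C)"
    unfolding mixed_graph_def
  proof (intro conjI)
    show "finite (comp_nodes C)"
      using finite_subset[OF comp_nodes_subset[OF assms]] by simp
    show "dedges (mixed_component G C) \<subseteq> comp_nodes C \<times> comp_nodes C"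
      by (auto simp: comp_dedges dedges_comp_nodes subsetD[OF bicomponent_subset_comp_nodes])
    show "bedges (mixed_component G C) \<subseteq> comp_nodes C \<times> comp_nodes C"
      using bicomponent_subset_comp_nodes[of C] by (auto simp: comp_bedges)
    show "sym (bedges (mixed_component G C))"
      using sym_bedges by (auto simp: comp_bedges sym_def)
  qed (use mixed in \<open>auto simp: comp_dedges comp_bedges mixed_graph_def\<close>)
  show "inj_on r (comp_nodes C)"
    using inj_rank comp_nodes_subset[OF assms] by (rule inj_on_subset)
qed (simp add: comp_dedges rank)

lemma params_iff:
  "\<theta> \<in> params \<longleftrightarrow> (\<forall>v w. (v, w) \<notin> dedges G \<longrightarrow> fst \<theta> v w = 0) \<and> extensional_on V (snd \<theta>)
     \<and> (\<forall>v w. snd \<theta> v w = snd \<theta> w v) \<and> (\<forall>v w. v \<noteq> w \<and> (v, w) \<notin> bedges G \<longrightarrow> snd \<theta> v w = 0)"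
  by (simp add: params_def supp_ok_iff)

lemma blockdiag_Omega:
  assumes "\<theta> \<in> params"
  shows "blockdiag bicomp (snd \<theta>)"
  unfolding blockdiag_def
proof (intro allI impI)
  fix v w assume "bicomp v \<noteq> bicomp w"
  then have "(v, w) \<notin> (bedges G)\<^sup>*" by (simp add: comp_eq_iff)
  then have "v \<noteq> w" "(v, w) \<notin> bedges G" by auto
  then show "snd \<theta> v w = 0" using assms by (auto simp: params_iff)
qed

text \<open>Undoing \<open>phi\<close> with \<open>Lambda'\<close> gives
  \<open>Omega' = B^T D B\<close> for the unit triangular
  \<open>B = U (I - Lambda)^-1 (I - Lambda')\<close>, and the block structure of
  \<open>Omega'\<close> forces that of \<open>B\<close>. Hence all points of a fiber can be
  factorized as soon as one can.\<close>

lemma ldl_transfer: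
  assumes "\<theta> \<in> params" "\<theta>' \<in> params" and fac: "ldl r V c (snd \<theta>) U d"
    and blk: "blockdiag c (snd \<theta>')" and eq: "phi G \<theta> = phi G \<theta>'"
  shows "ldl r V c (snd \<theta>') (mmult V (mmult V U (IL_inv \<theta>)) (IL \<theta>')) d"
proof -
  let ?B = "mmult V (mmult V U (IL_inv \<theta>)) (IL \<theta>')"
  have tri: "unitri r V ?B"
    using fac by (intro unitri_mmult params_unitri assms) (auto simp: ldl_def)
  have d: "\<forall>v\<in>V. d v \<noteq> 0" using fac by (simp add: ldl_def)
  have entry: "snd \<theta>' a b = (\<Sum>k\<in>V. ?B k a * d k * ?B k b)" if "a \<in> V" "b \<in> V" for a b
    by (subst Omega_from_phi[OF assms(2)]) (intro diag_quadratic that, simp add: eq[symmetric] phi_ldl[OF fac])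
  have "blockdiag c ?B"
    by (rule blockdiag_unitri_factor[OF finite_nodes tri d _ blk]) (use entry in blast)
  with tri d entry show ?thesis by (simp add: ldl_def)
qed

end

section \<open>Triangular data of a single mixed component\<close>

locale bidirected_component = acyclic_mixed_graph +
  fixes C :: "nat set"
  assumes C: "C \<in> bicomponents G"

sublocale bidirected_component \<subseteq> component: acyclic_mixed_graph "mixed_component G C" r
  by (rule acyclic_mixed_graph_component[OF C])

context bidirected_component
begin

lemma C_subset: "C \<subseteq> comp_nodes C" "comp_nodes C \<subseteq> V" "C \<subseteq> V"
  using C bicomponent_subset_comp_nodes comp_nodes_subset bicomponents_subset by auto

lemma blockdiag_C:
  assumes "blockdiag bicomp A" "a \<in> C \<longleftrightarrow> b \<notin> C"
  shows "A a b = 0"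
  using assms mem_bicomponent_iff[OF C] unfolding blockdiag_def by metis

lemma sum_blockdiag:
  fixes A :: "'a::comm_ring_1 mat"
  assumes "blockdiag bicomp A" "b \<in> C"
  shows "(\<Sum>k\<in>V. x k * A k b) = (\<Sum>k\<in>C. x k * A k b)"
proof (rule sum.mono_neutral_right)
  show "\<forall>k\<in>V - C. x k * A k b = 0" using blockdiag_C[OF assms(1)] assms(2) by auto
qed (use C_subset in auto)

lemma unitri_embed:
  assumes "unitri r V A"
  shows "unitri r (comp_nodes C) (embed (comp_nodes C) C A)"
  unfolding unitri_def extensional_on_def
proof (intro conjI allI ballI impI)
  fix a b assume "a \<noteq> b" "\<not> r a < r b"
  then show "embed (comp_nodes C) C A a b = 0"
    using unitri_below[OF assms] by (auto simp: embed_def idm_def)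
next
  fix a assume "a \<in> comp_nodes C"
  then show "embed (comp_nodes C) C A a a = 1"
    using unitri_diag[OF assms] C_subset by (auto simp: embed_def idm_def)
next
  fix a b assume "a \<notin> comp_nodes C \<or> b \<notin> comp_nodes C"
  then show "embed (comp_nodes C) C A a b = 0"
    using C_subset by (auto simp: embed_def idm_def)
qed

text \<open>Block diagonality cuts the sum over \<open>V\<close> down to \<open>C\<close>, so
  inverse matrices have inverse blocks.\<close>

lemma mmult_embed:
  assumes "unitri r V A" "unitri r V B" "blockdiag bicomp B" "mmult V A B = idm V"
  shows "mmult (comp_nodes C) (embed (comp_nodes C) C A) (embed (comp_nodes C) C B) = idm (comp_nodes C)"
proof (rule extensional_on_eqI)
  show "extensional_on (comp_nodes C)
      (mmult (comp_nodes C) (embed (comp_nodes C) C A) (embed (comp_nodes C) C B))"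
    using unitri_embed assms by (blast intro: extensional_on_mmult unitri_ext)
  fix a b assume ab: "a \<in> comp_nodes C" "b \<in> comp_nodes C"
  have *: "mmult (comp_nodes C) (embed (comp_nodes C) C A) (embed (comp_nodes C) C B) a b
     = (if b \<in> C then (\<Sum>k\<in>C. embed (comp_nodes C) C A a k * B k b) else embed (comp_nodes C) C A a b)"
    unfolding mmult_def using C_subset ab by (simp add: sum_embed)
  consider "a \<in> C" "b \<in> C" | "a \<notin> C" "b \<in> C" | "b \<notin> C" by blast
  then show "mmult (comp_nodes C) (embed (comp_nodes C) C A) (embed (comp_nodes C) C B) a b
      = idm (comp_nodes C) a b"
  proof cases
    case 1
    have "(\<Sum>k\<in>C. embed (comp_nodes C) C A a k * B k b) = (\<Sum>k\<in>C. A a k * B k b)"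
      using 1 by (intro sum.cong) (auto simp: embed_def)
    also have "\<dots> = mmult V A B a b"
      unfolding mmult_def using sum_blockdiag[OF assms(3) 1(2)] by simp
    finally show ?thesis using * 1 ab C_subset assms(4) by (auto simp: idm_def)
  next
    case 2
    have "(\<Sum>k\<in>C. embed (comp_nodes C) C A a k * B k b) = 0"
      using 2 by (intro sum.neutral) (auto simp: embed_def idm_def)
    then show ?thesis using * 2 by (auto simp: idm_def)
  next
    case 3
    then show ?thesis using * by (simp add: embed_def)
  qed
qed simp

lemma restrict_params:
  assumes "\<theta> \<in> params"
  shows "restrict_param G C E \<theta> \<in> component.params"
  unfolding component.params_iff
proof (intro conjI allI impI)
  fix v w
  show "fst (restrict_param G C E \<theta>) v w = 0" if "(v, w) \<notin> dedges (mixed_component G C)"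
    using that assms by (auto simp: restrict_param_def comp_dedges params_iff)
  show "snd (restrict_param G C E \<theta>) v w = snd (restrict_param G C E \<theta>) w v"
    using assms by (auto simp: restrict_param_def params_iff)
  show "snd (restrict_param G C E \<theta>) v w = 0"
    if "v \<noteq> w \<and> (v, w) \<notin> bedges (mixed_component G C)"
    using that assms by (auto simp: restrict_param_def comp_bedges params_iff)
  show "extensional_on (comp_nodes C) (snd (restrict_param G C E \<theta>))"
    using C_subset(1) by (auto simp: extensional_on_def restrict_param_def)
qed

lemma replace_params:
  assumes "\<eta> \<in> component.params" "\<theta> \<in> params"
  shows "replace_param G C \<eta> \<theta> \<in> params"
  unfolding params_iff
proof (intro conjI allI impI)
  have sym: "(w, v) \<in> bedges G" if "(v, w) \<in> bedges G" for v w
    using that sym_bedges by (auto dest: symD)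
  fix v w
  show "fst (replace_param G C \<eta> \<theta>) v w = 0" if "(v, w) \<notin> dedges G"
    using that assms by (auto simp: replace_param_def component.params_iff comp_dedges params_iff)
  show "snd (replace_param G C \<eta> \<theta>) v w = snd (replace_param G C \<eta> \<theta>) w v"
    using assms by (auto simp: replace_param_def component.params_iff params_iff)
  show "snd (replace_param G C \<eta> \<theta>) v w = 0" if "v \<noteq> w \<and> (v, w) \<notin> bedges G"
    using that assms by (auto simp: replace_param_def comp_bedges component.params_iff params_iff)
  show "extensional_on V (snd (replace_param G C \<eta> \<theta>))"
    using assms C_subset by (auto simp: extensional_on_def replace_param_def params_iff)
qed

text \<open>\<open>replace_param\<close> forgets the source variances of \<open>\<eta>\<close>, so
  the filler has to bring them back.\<close>

lemma restrict_replace: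
  assumes "\<eta> \<in> component.params"
    and "\<And>v. v \<in> comp_nodes C - C \<Longrightarrow> E v = snd \<eta> v v"
  shows "restrict_param G C E (replace_param G C \<eta> \<theta>) = \<eta>"
proof (rule prod_eqI)
  have "fst \<eta> a b = 0" if "\<not> (a \<in> comp_nodes C \<and> b \<in> C)" for a b
  proof -
    have "(a, b) \<notin> dedges (mixed_component G C)"
      using that component.dedges_nodes[of a b] by (auto simp: comp_dedges)
    then show ?thesis using assms(1) unfolding component.params_iff by blast
  qed
  then show "fst (restrict_param G C E (replace_param G C \<eta> \<theta>)) = fst \<eta>"
    by (auto simp: restrict_param_def replace_param_def fun_eq_iff)
  have "snd \<eta> a b = 0" if "\<not> (a \<in> C \<and> b \<in> C)" "a \<noteq> b \<or> a \<notin> comp_nodes C" for a b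
    using that assms(1) by (auto simp: component.params_iff comp_bedges extensional_on_def)
  then show "snd (restrict_param G C E (replace_param G C \<eta> \<theta>)) = snd \<eta>"
    using assms(2) by (auto simp: restrict_param_def replace_param_def fun_eq_iff)
qed

text \<open>Different bidirected components are disjoint, and a restriction reads only columns of
  Lambda and a block of Omega indexed by its own component.\<close>

lemma restrict_replace_other:
  assumes "\<eta> \<in> component.params" "C' \<in> bicomponents G" "C' \<noteq> C"
  shows "restrict_param G C' E (replace_param G C \<eta> \<theta>) = restrict_param G C' E \<theta>"
proof -
  have "v \<notin> C" if "v \<in> C'" for v
    using that assms mem_bicomponent_iff[OF C] mem_bicomponent_iff[OF assms(2)] by auto
  then show ?thesis by (auto simp: restrict_param_def replace_param_def fun_eq_iff)
qed

text \<open>The block of the factorization on \<open>C\<close> is completed by the identity, with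
  the fillers as pivots at the sources; this is where they must be nonzero.\<close>

lemma ldl_restrict:
  assumes "ldl r V bicomp (snd \<theta>) U d" "\<theta> \<in> params"
    and "\<And>v. v \<in> comp_nodes C - C \<Longrightarrow> E v \<noteq> 0"
  shows "ldl r (comp_nodes C) bicomp (snd (restrict_param G C E \<theta>)) (embed (comp_nodes C) C U)
    (\<lambda>v. if v \<in> C then d v else E v)"
  unfolding ldl_def
proof (intro conjI ballI)
  have U: "unitri r V U" "blockdiag bicomp U" using assms by (auto simp: ldl_def)
  show "unitri r (comp_nodes C) (embed (comp_nodes C) C U)" by (rule unitri_embed[OF U(1)])
  show "blockdiag bicomp (embed (comp_nodes C) C U)"
    using mem_bicomponent_iff[OF C] by (auto simp: blockdiag_def embed_def idm_def)
  show "(if v \<in> C then d v else E v) \<noteq> 0" if "v \<in> comp_nodes C" for v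
    using that assms C_subset by (auto simp: ldl_def)
  fix a b assume ab: "a \<in> comp_nodes C" "b \<in> comp_nodes C"
  let ?U = "embed (comp_nodes C) C U"
  have *: "(\<Sum>k\<in>comp_nodes C. ?U k a * (if k \<in> C then d k else E k) * ?U k b)
     = (if b \<in> C then (\<Sum>k\<in>C. ?U k a * (if k \<in> C then d k else E k) * U k b)
        else ?U b a * (if b \<in> C then d b else E b))"
    by (rule sum_embed) (use C_subset ab in auto)
  consider "a \<in> C" "b \<in> C" | "a \<notin> C" "b \<in> C" | "b \<notin> C" by blast
  then show "snd (restrict_param G C E \<theta>) a b
     = (\<Sum>k\<in>comp_nodes C. ?U k a * (if k \<in> C then d k else E k) * ?U k b)"
  proof cases
    case 1
    have "(\<Sum>k\<in>C. ?U k a * (if k \<in> C then d k else E k) * U k b) = (\<Sum>k\<in>C. U k a * d k * U k b)"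
      using 1 by (intro sum.cong) (auto simp: embed_def)
    also have "\<dots> = (\<Sum>k\<in>V. U k a * d k * U k b)"
      by (rule sum_blockdiag[symmetric]) (use U 1 in auto)
    also have "\<dots> = snd \<theta> a b"
      using assms(1) subsetD[OF C_subset(3)] 1 unfolding ldl_def by metis
    finally show ?thesis using * 1 by (simp add: restrict_param_def)
  next
    case 2
    have "(\<Sum>k\<in>C. ?U k a * (if k \<in> C then d k else E k) * U k b) = 0"
      using 2 by (intro sum.neutral) (auto simp: embed_def idm_def)
    then show ?thesis using * 2 by (auto simp: restrict_param_def)
  next
    case 3
    then show ?thesis using * ab by (auto simp: restrict_param_def embed_def idm_def)
  qed
qed

text \<open>For \<open>b\<close> in \<open>C\<close>, column \<open>b\<close> of \<open>W\<close> is
  supported on \<open>C\<close>, so the product only uses columns of \<open>I - Lambda\<close>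
  indexed by \<open>C\<close>, and these belong to \<open>G_C\<close>.\<close>

lemma I_minus_restrict:
  assumes "\<theta> \<in> params" "unitri r V W" "blockdiag bicomp W" "b \<in> comp_nodes C" "a \<in> comp_nodes C"
  shows "mmult (comp_nodes C) (component.IL (restrict_param G C E \<theta>)) (embed (comp_nodes C) C W) a b
    = (if b \<in> C then mmult V (IL \<theta>) W a b else idm (comp_nodes C) a b)"
proof -
  have "mmult (comp_nodes C) (component.IL (restrict_param G C E \<theta>)) (embed (comp_nodes C) C W) a b
    = (if b \<in> C then (\<Sum>k\<in>C. component.IL (restrict_param G C E \<theta>) a k * W k b)
       else component.IL (restrict_param G C E \<theta>) a b)"
    unfolding mmult_def by (rule sum_embed) (use C_subset assms in auto)
  moreover have "(\<Sum>k\<in>C. component.IL (restrict_param G C E \<theta>) a k * W k b) = (\<Sum>k\<in>C. IL \<theta> a k * W k b)"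
    using assms(5) C_subset by (intro sum.cong) (auto simp: I_minus_def restrict_param_def idm_def)
  ultimately show ?thesis
    using sum_blockdiag[OF assms(3), of b "IL \<theta> a"]
    by (auto simp: mmult_def I_minus_def restrict_param_def)
qed

text \<open>Complements the restriction: a column indexed by \<open>C\<close> has no entries outside
  \<open>C\<close> and its parents, so \<open>G_C\<close> sees all of it.\<close>

lemma I_minus_outside:
  assumes "\<theta> \<in> params" "blockdiag bicomp W" "b \<in> C" "a \<notin> comp_nodes C"
  shows "mmult V (IL \<theta>) W a b = 0"
proof -
  have "IL \<theta> a k = 0" if "k \<in> C" for k
  proof -
    have "(a, k) \<notin> dedges G" "a \<noteq> k" using that assms(4) C_subset dedges_comp_nodes[of a k C] by auto
    moreover from this have "fst \<theta> a k = 0" using assms(1) unfolding params_iff by blast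
    ultimately show ?thesis by (simp add: I_minus_def idm_def)
  qed
  then show ?thesis
    unfolding mmult_def sum_blockdiag[OF assms(2,3)] by (intro sum.neutral) auto
qed

text \<open>A source has no incoming edge, so its column in \<open>(I - Lambda)^-1\<close> is a unit
  vector. The covariance matrix of \<open>G_C\<close> therefore displays the filler
  variances.\<close>

lemma source_variance:
  assumes "\<eta> \<in> component.params" "v \<in> comp_nodes C - C"
  shows "phi (mixed_component G C) \<eta> v v = snd \<eta> v v"
proof -
  let ?N = "component.IL_inv \<eta>"
  note u = component.params_unitri[OF assms(1)]
  have P: "component.IL \<eta> k v = (if k = v then 1 else 0)" for k
    using assms by (auto simp: I_minus_def idm_def component.params_iff comp_dedges)
  have N: "?N a v = (if a = v then 1 else 0)" for a
  proof -
    have "mmult (comp_nodes C) ?N (component.IL \<eta>) a v = (\<Sum>k\<in>comp_nodes C. if k = v then ?N a k else 0)"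
      unfolding mmult_def P by (intro sum.cong) auto
    also have "\<dots> = ?N a v" using assms(2) by simp
    finally show ?thesis using u(4) assms(2) by (auto simp: idm_def)
  qed
  show ?thesis
    using assms(2)
    by (simp add: component.phi_eq mmult_def mtrans_def N if_distrib[of "\<lambda>x. x * _"]
        if_distrib[of "\<lambda>x. _ * x"] cong: if_cong)
qed

end

section \<open>Sigma against the family of component covariances\<close>

context acyclic_mixed_graph
begin

text \<open>The columns of \<open>(I - \<Lambda>) U\<^sup>-\<^sup>1\<close> indexed by a component are determined by that component's
  parameters, so both sides say that all these columns and all pivots lie in \<open>K\<close>.\<close>
lemma phi_mem_iff_components:
  fixes \<theta> :: "'t \<Rightarrow> 'a::field mat \<times> 'a mat"
  assumes K: "function_field T K"
    and par: "\<And>t. t \<in> T \<Longrightarrow> \<theta> t \<in> params"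
    and fac: "\<And>t. t \<in> T \<Longrightarrow> \<exists>U d. ldl r V bicomp (snd (\<theta> t)) U d"
    and E: "\<And>t C v. t \<in> T \<Longrightarrow> C \<in> bicomponents G \<Longrightarrow> v \<in> comp_nodes C - C \<Longrightarrow> E t C v \<noteq> 0"
      "\<And>C v. C \<in> bicomponents G \<Longrightarrow> v \<in> comp_nodes C - C \<Longrightarrow> (\<lambda>t. E t C v) \<in> K"
  shows "(\<forall>a\<in>V. \<forall>b\<in>V. (\<lambda>t. phi G (\<theta> t) a b) \<in> K) \<longleftrightarrow>
    (\<forall>C\<in>bicomponents G. \<forall>a\<in>comp_nodes C. \<forall>b\<in>comp_nodes C.
       (\<lambda>t. phi (mixed_component G C) (restrict_param G C (E t C) (\<theta> t)) a b) \<in> K)"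
proof -
  interpret K: function_field T K by (rule K)
  \<comment> \<open>Factorizations exist pointwise only, so one is chosen for each \<open>t\<close>,
    together with its blockwise inverse.\<close>
  have "\<exists>U d W. ldl r V bicomp (snd (\<theta> t)) U d \<and> unitri r V W \<and> blockdiag bicomp W
      \<and> mmult V W U = idm V \<and> mmult V U W = idm V" if t: "t \<in> T" for t
  proof -
    obtain U d where f: "ldl r V bicomp (snd (\<theta> t)) U d" using fac[OF t] by blast
    then have U: "unitri r V U" "blockdiag bicomp U" by (auto simp: ldl_def)
    obtain W where "unitri r V W" "mmult V W U = idm V" "mmult V U W = idm V"
      using unitri_inverse[OF finite_nodes U(1)] .
    with f blockdiag_inverse[OF finite_nodes U] show ?thesis by blast
  qed
  then obtain U d W where f: "\<And>t. t \<in> T \<Longrightarrow> ldl r V bicomp (snd (\<theta> t)) (U t) (d t)"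
    and W: "\<And>t. t \<in> T \<Longrightarrow> unitri r V (W t)" "\<And>t. t \<in> T \<Longrightarrow> blockdiag bicomp (W t)"
      "\<And>t. t \<in> T \<Longrightarrow> mmult V (W t) (U t) = idm V" "\<And>t. t \<in> T \<Longrightarrow> mmult V (U t) (W t) = idm V"
    by metis
  have U: "unitri r V (U t)" "blockdiag bicomp (U t)" if "t \<in> T" for t
    using f[OF that] by (auto simp: ldl_def)
  note G_rules = K par f W(1,3,4)
  show ?thesis
  proof (intro iffI ballI)
    fix C a b
    assume *: "\<forall>a\<in>V. \<forall>b\<in>V. (\<lambda>t. phi G (\<theta> t) a b) \<in> K"
      and C: "C \<in> bicomponents G" and ab: "a \<in> comp_nodes C" "b \<in> comp_nodes C"
    interpret bidirected_component G r C by unfold_locales (rule C)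
    have dK: "(\<lambda>t. d t a) \<in> K" if "a \<in> V" for a
      by (rule factor_mem_if_phi_mem(1)[OF G_rules]) (use * that in auto)
    have MK: "(\<lambda>t. mmult V (IL (\<theta> t)) (W t) a b) \<in> K" if "a \<in> V" "b \<in> V" for a b
      by (rule factor_mem_if_phi_mem(2)[OF G_rules]) (use * that in auto)
    show "(\<lambda>t. phi (mixed_component G C) (restrict_param G C (E t C) (\<theta> t)) a b) \<in> K"
    proof (rule component.phi_mem_if_factor_mem[OF K, where c = bicomp
          and U = "\<lambda>t. embed (comp_nodes C) C (U t)" and W = "\<lambda>t. embed (comp_nodes C) C (W t)"
          and d = "\<lambda>t v. if v \<in> C then d t v else E t C v"])
      fix a b assume ab: "a \<in> comp_nodes C" "b \<in> comp_nodes C"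
      show "(\<lambda>t. if a \<in> C then d t a else E t C a) \<in> K"
        using dK[of a] ab C_subset E(2)[OF C, of a] by (cases "a \<in> C") auto
      have "(\<lambda>t. if b \<in> C then mmult V (IL (\<theta> t)) (W t) a b else idm (comp_nodes C) a b) \<in> K"
        using MK[of a b] ab C_subset K.const by (cases "b \<in> C") auto
      then show "(\<lambda>t. mmult (comp_nodes C) (component.IL (restrict_param G C (E t C) (\<theta> t)))
          (embed (comp_nodes C) C (W t)) a b) \<in> K"
        by (rule K.agree) (simp add: I_minus_restrict[OF par W(1,2)] ab)
    qed (use ab W U f par E(1)[OF _ C] in \<open>auto simp: restrict_params unitri_embed mmult_embed intro!: ldl_restrict\<close>)
  next
    fix a b
    assume *: "\<forall>C\<in>bicomponents G. \<forall>a\<in>comp_nodes C. \<forall>b\<in>comp_nodes C.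
       (\<lambda>t. phi (mixed_component G C) (restrict_param G C (E t C) (\<theta> t)) a b) \<in> K"
      and ab: "a \<in> V" "b \<in> V"
    \<comment> \<open>Column \<open>b\<close> and its pivot are read off in the component that
      contains \<open>b\<close>; rows outside the nodes of that component vanish.\<close>
    have mem: "(\<lambda>t. d t b) \<in> K \<and> (\<forall>a\<in>V. (\<lambda>t. mmult V (IL (\<theta> t)) (W t) a b) \<in> K)" if b: "b \<in> V" for b
    proof -
      interpret bidirected_component G r "bicomp b"
        by unfold_locales (rule comp_bicomponents(1)[OF b])
      have b': "b \<in> bicomp b" "b \<in> comp_nodes (bicomp b)"
        using comp_bicomponents(2) C_subset(1) by auto
      let ?C = "bicomp b"
      have fK: "function_field T K" by (rule K)
      have pk: "(\<lambda>t. phi (mixed_component G ?C) (restrict_param G ?C (E t ?C) (\<theta> t)) a b) \<in> K"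
        if "a \<in> comp_nodes ?C" "b \<in> comp_nodes ?C" for a b using * C that by blast
      have rules: "\<And>t. t \<in> T \<Longrightarrow> restrict_param G ?C (E t ?C) (\<theta> t) \<in> component.params"
        "\<And>t. t \<in> T \<Longrightarrow> ldl r (comp_nodes ?C) bicomp (snd (restrict_param G ?C (E t ?C) (\<theta> t)))
           (embed (comp_nodes ?C) ?C (U t)) (\<lambda>v. if v \<in> ?C then d t v else E t ?C v)"
        "\<And>t. t \<in> T \<Longrightarrow> unitri r (comp_nodes ?C) (embed (comp_nodes ?C) ?C (W t))"
        "\<And>t. t \<in> T \<Longrightarrow> mmult (comp_nodes ?C) (embed (comp_nodes ?C) ?C (W t))
           (embed (comp_nodes ?C) ?C (U t)) = idm (comp_nodes ?C)"
        "\<And>t. t \<in> T \<Longrightarrow> mmult (comp_nodes ?C) (embed (comp_nodes ?C) ?C (U t))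
           (embed (comp_nodes ?C) ?C (W t)) = idm (comp_nodes ?C)"
        using W U f par E(1)[OF _ C]
        by (blast intro: restrict_params ldl_restrict unitri_embed mmult_embed)+
      have "(\<lambda>t. if b \<in> ?C then d t b else E t ?C b) \<in> K"
        by (rule component.factor_mem_if_phi_mem(1)[OF fK rules pk b'(2)])
      then have "(\<lambda>t. d t b) \<in> K" by (rule K.agree) (use b' in simp)
      moreover have "(\<lambda>t. mmult V (IL (\<theta> t)) (W t) a b) \<in> K" for a
      proof (cases "a \<in> comp_nodes ?C")
        case True
        have eq: "mmult (comp_nodes ?C) (component.IL (restrict_param G ?C (E t ?C) (\<theta> t)))
            (embed (comp_nodes ?C) ?C (W t)) a b = mmult V (IL (\<theta> t)) (W t) a b" if "t \<in> T" for t
          using I_minus_restrict[OF par[OF that] W(1)[OF that] W(2)[OF that] b'(2) True] b'(1) by (simp only: if_True)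
        show ?thesis
          by (rule K.agree[OF component.factor_mem_if_phi_mem(2)[OF fK rules pk True b'(2)]]) 
             ((assumption | erule eq)+)
      next
        case False
        show ?thesis
          by (rule K.agree[OF K.const[of 0]]) (simp add: I_minus_outside[OF par W(2) b'(1) False])
      qed
      ultimately show ?thesis by blast
    qed
    show "(\<lambda>t. phi G (\<theta> t) a b) \<in> K"
      by (rule phi_mem_if_factor_mem[OF G_rules]) (use mem ab in auto)
  qed
qed

text \<open>Every node uses row and pivot of its own component. Rows of the sources do not reach the
  block of \<open>C\<close>, since their labels differ.\<close>

lemma ldl_glue:
  assumes par: "\<theta> \<in> params"
    and f: "\<And>C. C \<in> bicomponents G \<Longrightarrow>
      \<exists>U d. ldl r (comp_nodes C) bicomp (snd (restrict_param G C (E C) \<theta>)) U d"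
  shows "\<exists>U d. ldl r V bicomp (snd \<theta>) U d"
proof -
  from f obtain U d where f: "\<And>C. C \<in> bicomponents G \<Longrightarrow>
      ldl r (comp_nodes C) bicomp (snd (restrict_param G C (E C) \<theta>)) (U C) (d C)"
    by metis
  define U' where "U' = (\<lambda>a b. if a \<in> V \<and> bicomp a = bicomp b then U (bicomp a) a b else 0)"
  define d' where "d' = (\<lambda>a. d (bicomp a) a)"
  have tri: "unitri r (comp_nodes C) (U C)" and blk: "blockdiag bicomp (U C)" if "C \<in> bicomponents G" for C
    using f[OF that] by (auto simp: ldl_def)
  have in_V: "b \<in> V" if "a \<in> V" "bicomp a = bicomp b" for a b
    using that bidirected_path_nodes comp_eq_iff by blast
  have in_nodes: "a \<in> comp_nodes (bicomp a)" for a
    using bicomponent_subset_comp_nodes comp_bicomponents(2) by blast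
  have "ldl r V bicomp (snd \<theta>) U' d'"
    unfolding ldl_def
  proof (intro conjI ballI)
    show "unitri r V U'"
      unfolding unitri_def extensional_on_def
    proof (intro conjI allI ballI impI)
      show "U' a b = 0" if "a \<noteq> b" "\<not> r a < r b" for a b
        using that unitri_below[OF tri[OF comp_bicomponents(1)[of a]], of a b] unfolding U'_def by metis
      show "U' a a = 1" if "a \<in> V" for a
        using that unitri_diag[OF tri[OF comp_bicomponents(1)[OF that]] in_nodes] by (simp add: U'_def)
      show "U' a b = 0" if "a \<notin> V \<or> b \<notin> V" for a b
        using that in_V by (auto simp: U'_def)
    qed
    show "blockdiag bicomp U'" by (auto simp: blockdiag_def U'_def)
    show "d' a \<noteq> 0" if "a \<in> V" for a
      using f[OF comp_bicomponents(1)[OF that]] in_nodes[of a] unfolding ldl_def d'_def by blast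
    fix a b assume ab: "a \<in> V" "b \<in> V"
    show "snd \<theta> a b = (\<Sum>k\<in>V. U' k a * d' k * U' k b)"
    proof (cases "bicomp a = bicomp b")
      case False
      then have "(\<Sum>k\<in>V. U' k a * d' k * U' k b) = 0"
        by (intro sum.neutral) (auto simp: U'_def)
      then show ?thesis using False blockdiag_Omega[OF par] by (simp add: blockdiag_def)
    next
      case True
      define C where "C = bicomp a"
      have Cb: "C \<in> bicomponents G" unfolding C_def by (rule comp_bicomponents(1)[OF ab(1)])
      have mem: "k \<in> C \<longleftrightarrow> bicomp k = C" for k by (rule mem_bicomponent_iff[OF Cb])
      have abC: "a \<in> C" "b \<in> C" using mem True by (auto simp: C_def)
      have CV: "C \<subseteq> V" "C \<subseteq> comp_nodes C" "finite (comp_nodes C)"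
        using bicomponents_subset[OF Cb] bicomponent_subset_comp_nodes
          finite_subset[OF comp_nodes_subset[OF Cb]] by auto
      have "snd \<theta> a b = snd (restrict_param G C (E C) \<theta>) a b"
        using abC by (simp add: restrict_param_def)
      also have "\<dots> = (\<Sum>k\<in>comp_nodes C. U C k a * d C k * U C k b)"
        using f[OF Cb] abC CV unfolding ldl_def by blast
      also have "\<dots> = (\<Sum>k\<in>C. U C k a * d C k * U C k b)"
      proof (rule sum.mono_neutral_right)
        show "\<forall>k\<in>comp_nodes C - C. U C k a * d C k * U C k b = 0"
          using blk[OF Cb] mem abC unfolding blockdiag_def by (metis DiffD2 mult_zero_left)
      qed (use CV in auto)
      also have "\<dots> = (\<Sum>k\<in>C. U' k a * d' k * U' k b)"
        using abC CV mem by (intro sum.cong) (auto simp: U'_def d'_def)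
      also have "\<dots> = (\<Sum>k\<in>V. U' k a * d' k * U' k b)"
        by (rule sum.mono_neutral_left) (use abC CV mem in \<open>auto simp: U'_def\<close>)
      finally show ?thesis .
    qed
  qed
  then show ?thesis by blast
qed

text \<open>Only \<open>\<theta>\<close> is assumed to have a factorization. Either side provides
  one for \<open>\<theta>'\<close>: equality of Sigma by transfer in \<open>G\<close>, equality in
  all components by transfer in each of them and gluing.\<close>

lemma phi_eq_iff_components:
  fixes \<theta> \<theta>' :: "'a::field mat \<times> 'a mat"
  assumes par: "\<theta> \<in> params" "\<theta>' \<in> params"
    and fac: "ldl r V bicomp (snd \<theta>) U d"
    and E: "\<And>C v. C \<in> bicomponents G \<Longrightarrow> v \<in> comp_nodes C - C \<Longrightarrow> E C v \<noteq> 0"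
  shows "phi G \<theta>' = phi G \<theta> \<longleftrightarrow>
    (\<forall>C\<in>bicomponents G. phi (mixed_component G C) (restrict_param G C (E C) \<theta>')
       = phi (mixed_component G C) (restrict_param G C (E C) \<theta>))" (is "?L \<longleftrightarrow> ?R")
proof -
  \<comment> \<open>On a two-point index set, lying in \<open>K\<close> means taking equal values,
    so membership of all entries becomes equality of two covariance matrices.\<close>
  define K :: "(bool \<Rightarrow> 'a) set" where "K = {f. f True = f False}"
  define s where "s = (\<lambda>t. if t then \<theta> else \<theta>')"
  have K: "function_field UNIV K"
  proof
    fix f g :: "bool \<Rightarrow> 'a"
    assume "f \<in> K" "\<And>t. t \<in> UNIV \<Longrightarrow> f t = g t"
    then show "g \<in> K" by (simp add: K_def)
  qed (simp_all add: K_def)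
  have "?L \<longleftrightarrow> ?R" if fac': "\<exists>U d. ldl r V bicomp (snd \<theta>') U d"
  proof -
    have "(\<forall>a\<in>V. \<forall>b\<in>V. (\<lambda>t. phi G (s t) a b) \<in> K) \<longleftrightarrow>
      (\<forall>C\<in>bicomponents G. \<forall>a\<in>comp_nodes C. \<forall>b\<in>comp_nodes C.
         (\<lambda>t. phi (mixed_component G C) (restrict_param G C (E C) (s t)) a b) \<in> K)"
      by (rule phi_mem_iff_components[OF K, where E = "\<lambda>_. E"])
        (use par fac fac' E in \<open>auto simp: s_def K_def\<close>)
    moreover have "(\<forall>a\<in>V. \<forall>b\<in>V. (\<lambda>t. phi G (s t) a b) \<in> K) \<longleftrightarrow> ?L"
      using extensional_on_eqI[OF extensional_on_phi[OF par(2)] extensional_on_phi[OF par(1)]]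
      by (auto simp: K_def s_def)
    moreover have "(\<forall>a\<in>comp_nodes C. \<forall>b\<in>comp_nodes C.
         (\<lambda>t. phi (mixed_component G C) (restrict_param G C (E C) (s t)) a b) \<in> K) \<longleftrightarrow>
        phi (mixed_component G C) (restrict_param G C (E C) \<theta>')
       = phi (mixed_component G C) (restrict_param G C (E C) \<theta>)" if C: "C \<in> bicomponents G" for C
    proof -
      interpret bidirected_component G r C by unfold_locales (rule C)
      show ?thesis
        using extensional_on_eqI[OF component.extensional_on_phi[OF restrict_params[OF par(2)]]
            component.extensional_on_phi[OF restrict_params[OF par(1)]], of "E C" "E C"]
        by (auto simp: K_def s_def)
    qed
    ultimately show ?thesis by (simp cong: ball_cong)
  qed
  moreover have "\<exists>U d. ldl r V bicomp (snd \<theta>') U d" if ?L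
    using ldl_transfer[OF par fac blockdiag_Omega[OF par(2)] that[symmetric]] by blast
  moreover have "\<exists>U d. ldl r V bicomp (snd \<theta>') U d" if eq: ?R
  proof (rule ldl_glue[OF par(2)])
    fix C assume C: "C \<in> bicomponents G"
    interpret bidirected_component G r C by unfold_locales (rule C)
    have "blockdiag bicomp (snd (restrict_param G C (E C) \<theta>'))"
      using blockdiag_Omega[OF par(2)] unfolding blockdiag_def by (auto simp: restrict_param_def)
    moreover have "phi (mixed_component G C) (restrict_param G C (E C) \<theta>)
        = phi (mixed_component G C) (restrict_param G C (E C) \<theta>')"
      using eq C by simp
    ultimately show "\<exists>U d. ldl r (comp_nodes C) bicomp (snd (restrict_param G C (E C) \<theta>')) U d"
      using component.ldl_transfer[OF restrict_params[OF par(1)] restrict_params[OF par(2)]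
          ldl_restrict[OF fac par(1), of "E C"]] E[OF C] by blast
  qed
  ultimately show ?thesis by blast
qed

end

section \<open>Polynomial genericity\<close>

lemma polyfuns_prod:
  "(\<And>i. i \<in> I \<Longrightarrow> f i \<in> polyfuns X) \<Longrightarrow> (\<lambda>x. \<Prod>i\<in>I. f i x) \<in> polyfuns X"
  by (induction I rule: infinite_finite_induct) (auto intro: polyfuns.intros)

lemma polyfuns_diff:
  assumes "f \<in> polyfuns X" "g \<in> polyfuns X"
  shows "(\<lambda>x. f x - g x) \<in> polyfuns X"
  using polyfuns.add[OF assms(1) polyfuns.mult[OF polyfuns.const[of "- 1"] assms(2)]] by simp

text \<open>One defining polynomial that is nonzero somewhere on \<open>T\<close> is kept. Its zero
  set contains \<open>W\<close>, and enlarging the exceptional set is harmless.\<close>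

lemma proper_alg_subsetD:
  assumes "proper_alg_subset G T W"
  obtains p \<theta> where "p \<in> polyfuns (param_coords G)" "\<theta> \<in> T" "p \<theta> \<noteq> 0"
    "\<And>\<theta>. \<theta> \<in> T \<Longrightarrow> p \<theta> \<noteq> 0 \<Longrightarrow> \<theta> \<in> T - W"
proof -
  from assms obtain P where P: "P \<subseteq> polyfuns (param_coords G)"
    "W = {\<theta> \<in> T. \<forall>p\<in>P. p \<theta> = 0}" "W \<noteq> T"
    by (auto simp: proper_alg_subset_def)
  then obtain \<theta> p where "\<theta> \<in> T" "p \<in> P" "p \<theta> \<noteq> 0" by auto
  with P show ?thesis by (intro that[of p \<theta>]) auto
qed

lemma proper_alg_subsetI:
  assumes "p \<in> polyfuns (param_coords G)" "\<theta> \<in> T" "p \<theta> \<noteq> 0"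
  shows "proper_alg_subset G T {\<theta> \<in> T. p \<theta> = 0}"
  unfolding proper_alg_subset_def
  by (rule exI[of _ "{p}"]) (use assms in auto)

lemma param_coords_polyfuns:
  assumes "v \<in> nodes G" "w \<in> nodes G"
  shows "(\<lambda>\<theta>. fst \<theta> v w) \<in> polyfuns (param_coords G)" "(\<lambda>\<theta>. snd \<theta> v w) \<in> polyfuns (param_coords G)"
  by (rule polyfuns.coord, use assms in \<open>auto simp: param_coords_def\<close>)+

lemma pivot_prod_polyfuns:
  assumes "\<And>a b. a \<in> set vs \<Longrightarrow> b \<in> set vs \<Longrightarrow> (\<lambda>x. f x a b) \<in> polyfuns X"
  shows "(\<lambda>x. pivot_prod vs (f x)) \<in> polyfuns X"
  using assms
proof (induction vs arbitrary: f)
  case (Cons v vs)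
  have "(\<lambda>x. pivot_prod vs (\<lambda>a b. f x v v * f x a b - f x a v * f x v b)) \<in> polyfuns X"
    by (rule Cons.IH) (use Cons.prems in \<open>auto intro!: polyfuns_diff polyfuns.mult\<close>)
  then show ?case using Cons.prems by (auto intro: polyfuns.mult)
qed (auto intro: polyfuns.const)

lemma pivot_prod_identity:
  assumes "distinct vs" "\<And>a b. a \<in> set vs \<Longrightarrow> b \<in> set vs \<Longrightarrow> A a b = (if a = b then 1 else 0)"
  shows "pivot_prod vs A = 1"
  using assms
proof (induction vs arbitrary: A)
  case (Cons v vs)
  have "pivot_prod vs (\<lambda>a b. A v v * A a b - A a v * A v b) = 1"
    by (rule Cons.IH) (use Cons.prems in auto)
  then show ?case using Cons.prems by simp
qed simp

text \<open>Rational functions of Sigma, pulled back to the parameters and regular on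
  \<open>T\<close>. Rational identifiability becomes membership of the coordinates.\<close>

definition cov_ring :: "mgraph \<Rightarrow> ('a::field mat \<times> 'a mat) set \<Rightarrow> ('a mat \<times> 'a mat \<Rightarrow> 'a) set" where
  "cov_ring G T = {f. \<exists>p\<in>polyfuns (cov_coords G). \<exists>q\<in>polyfuns (cov_coords G).
     \<forall>\<theta>\<in>T. q (phi G \<theta>) \<noteq> 0 \<and> f \<theta> = p (phi G \<theta>) / q (phi G \<theta>)}"

lemma cov_ringI:
  assumes "p \<in> polyfuns (cov_coords G)" "q \<in> polyfuns (cov_coords G)"
    "\<And>\<theta>. \<theta> \<in> T \<Longrightarrow> q (phi G \<theta>) \<noteq> 0 \<and> f \<theta> = p (phi G \<theta>) / q (phi G \<theta>)"
  shows "f \<in> cov_ring G T"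
  using assms unfolding cov_ring_def by blast

lemma cov_ringE:
  assumes "f \<in> cov_ring G T"
  obtains p q where "p \<in> polyfuns (cov_coords G)" "q \<in> polyfuns (cov_coords G)"
    "\<And>\<theta>. \<theta> \<in> T \<Longrightarrow> q (phi G \<theta>) \<noteq> 0" "\<And>\<theta>. \<theta> \<in> T \<Longrightarrow> f \<theta> = p (phi G \<theta>) / q (phi G \<theta>)"
  using assms unfolding cov_ring_def by blast

lemma function_field_cov_ring: "function_field T (cov_ring G T)"
proof
  show "(\<lambda>_. a) \<in> cov_ring G T" for a
    by (rule cov_ringI[OF polyfuns.const[of a] polyfuns.const[of 1]]) simp
next
  fix f g assume "f \<in> cov_ring G T" "g \<in> cov_ring G T"
  then obtain p q p' q' where *: "p \<in> polyfuns (cov_coords G)" "q \<in> polyfuns (cov_coords G)"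
    "p' \<in> polyfuns (cov_coords G)" "q' \<in> polyfuns (cov_coords G)"
    "\<And>\<theta>. \<theta> \<in> T \<Longrightarrow> q (phi G \<theta>) \<noteq> 0" "\<And>\<theta>. \<theta> \<in> T \<Longrightarrow> f \<theta> = p (phi G \<theta>) / q (phi G \<theta>)"
    "\<And>\<theta>. \<theta> \<in> T \<Longrightarrow> q' (phi G \<theta>) \<noteq> 0" "\<And>\<theta>. \<theta> \<in> T \<Longrightarrow> g \<theta> = p' (phi G \<theta>) / q' (phi G \<theta>)"
    by (elim cov_ringE) blast
  show "(\<lambda>\<theta>. f \<theta> + g \<theta>) \<in> cov_ring G T"
    by (rule cov_ringI[of "\<lambda>S. p S * q' S + p' S * q S" _ "\<lambda>S. q S * q' S"])
       (use * in \<open>auto intro!: polyfuns.add polyfuns.mult simp: field_simps\<close>)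
  show "(\<lambda>\<theta>. f \<theta> * g \<theta>) \<in> cov_ring G T"
    by (rule cov_ringI[of "\<lambda>S. p S * p' S" _ "\<lambda>S. q S * q' S"])
       (use * in \<open>auto intro!: polyfuns.mult\<close>)
next
  fix f assume f: "f \<in> cov_ring G T" "\<And>\<theta>. \<theta> \<in> T \<Longrightarrow> f \<theta> \<noteq> 0"
  obtain p q where *: "p \<in> polyfuns (cov_coords G)" "q \<in> polyfuns (cov_coords G)"
    "\<And>\<theta>. \<theta> \<in> T \<Longrightarrow> q (phi G \<theta>) \<noteq> 0" "\<And>\<theta>. \<theta> \<in> T \<Longrightarrow> f \<theta> = p (phi G \<theta>) / q (phi G \<theta>)"
    using f(1) by (elim cov_ringE) blast
  show "(\<lambda>\<theta>. inverse (f \<theta>)) \<in> cov_ring G T"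
    by (rule cov_ringI[of q _ p]) (use * f(2) in auto)
next
  fix f g assume f: "f \<in> cov_ring G T" "\<And>\<theta>. \<theta> \<in> T \<Longrightarrow> f \<theta> = g \<theta>"
  obtain p q where *: "p \<in> polyfuns (cov_coords G)" "q \<in> polyfuns (cov_coords G)"
    "\<And>\<theta>. \<theta> \<in> T \<Longrightarrow> q (phi G \<theta>) \<noteq> 0" "\<And>\<theta>. \<theta> \<in> T \<Longrightarrow> f \<theta> = p (phi G \<theta>) / q (phi G \<theta>)"
    using f(1) by (elim cov_ringE) blast
  show "g \<in> cov_ring G T"
    by (rule cov_ringI[of p _ q]) (use * f(2) in auto)
qed

lemma phi_cov_ring:
  assumes "a \<in> nodes G" "b \<in> nodes G"
  shows "(\<lambda>\<theta>. phi G \<theta> a b) \<in> cov_ring G T"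
  by (rule cov_ringI[of "\<lambda>S. S a b" _ "\<lambda>_. 1"])
     (use assms in \<open>auto intro!: polyfuns.coord polyfuns.const simp: cov_coords_def\<close>)

text \<open>Composes rational maps: if the covariance matrix at \<open>s t\<close> is known inside
  \<open>K\<close>, so is every rational function of it.\<close>

lemma cov_ring_subst:
  assumes K: "function_field T K" and f: "f \<in> cov_ring H S"
    and s: "\<And>t. t \<in> T \<Longrightarrow> s t \<in> S"
    and phi: "\<And>a b. a \<in> nodes H \<Longrightarrow> b \<in> nodes H \<Longrightarrow> (\<lambda>t. phi H (s t) a b) \<in> K"
  shows "(\<lambda>t. f (s t)) \<in> K"
proof -
  interpret K: function_field T K by (rule K)
  obtain p q where *: "p \<in> polyfuns (cov_coords H)" "q \<in> polyfuns (cov_coords H)"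
    "\<And>\<theta>. \<theta> \<in> S \<Longrightarrow> q (phi H \<theta>) \<noteq> 0" "\<And>\<theta>. \<theta> \<in> S \<Longrightarrow> f \<theta> = p (phi H \<theta>) / q (phi H \<theta>)"
    using f by (elim cov_ringE) blast
  have "(\<lambda>t. p (phi H (s t))) \<in> K" if "p \<in> polyfuns (cov_coords H)" for p
    by (rule K.polyfuns_mem[OF that]) (use phi in \<open>auto simp: cov_coords_def\<close>)
  then have "(\<lambda>t. p (phi H (s t)) / q (phi H (s t))) \<in> K"
    using * s by (intro K.divide) auto
  then show ?thesis by (rule K.agree) (use * s in auto)
qed

lemma rationally_identifiable_iff:
  "rationally_identifiable G \<longleftrightarrow>
    (\<exists>p\<in>polyfuns (param_coords G). (\<exists>\<theta>\<in>Theta G. p \<theta> \<noteq> 0) \<and>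
      (\<forall>v\<in>nodes G. \<forall>w\<in>nodes G.
        (\<lambda>\<theta>. fst \<theta> v w) \<in> cov_ring G {\<theta> \<in> Theta G. p \<theta> \<noteq> 0} \<and>
        (\<lambda>\<theta>. snd \<theta> v w) \<in> cov_ring G {\<theta> \<in> Theta G. p \<theta> \<noteq> 0}))" (is "_ \<longleftrightarrow> ?R")
proof
  assume "rationally_identifiable G"
  then obtain W pL qL pO qO where W: "proper_alg_subset G (Theta G) W"
    and poly: "\<And>v w. pL v w \<in> polyfuns (cov_coords G) \<and> qL v w \<in> polyfuns (cov_coords G)
                \<and> pO v w \<in> polyfuns (cov_coords G) \<and> qO v w \<in> polyfuns (cov_coords G)"
    and inv: "\<And>\<theta> v w. \<theta> \<in> Theta G - W \<Longrightarrow> v\<in>nodes G \<Longrightarrow> w\<in>nodes G \<Longrightarrow>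
              qL v w (phi G \<theta>) \<noteq> 0 \<and> fst \<theta> v w = pL v w (phi G \<theta>) / qL v w (phi G \<theta>)
            \<and> qO v w (phi G \<theta>) \<noteq> 0 \<and> snd \<theta> v w = pO v w (phi G \<theta>) / qO v w (phi G \<theta>)"
    unfolding rationally_identifiable_def by blast
  obtain p \<theta> where p: "p \<in> polyfuns (param_coords G)" "\<theta> \<in> Theta G" "p \<theta> \<noteq> 0"
    "\<And>\<theta>. \<theta> \<in> Theta G \<Longrightarrow> p \<theta> \<noteq> 0 \<Longrightarrow> \<theta> \<in> Theta G - W"
    using proper_alg_subsetD[OF W] by blast
  have "(\<lambda>\<theta>. fst \<theta> v w) \<in> cov_ring G {\<theta> \<in> Theta G. p \<theta> \<noteq> 0} \<and>
    (\<lambda>\<theta>. snd \<theta> v w) \<in> cov_ring G {\<theta> \<in> Theta G. p \<theta> \<noteq> 0}" if "v \<in> nodes G" "w \<in> nodes G" for v w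
  proof
    show "(\<lambda>\<theta>. fst \<theta> v w) \<in> cov_ring G {\<theta> \<in> Theta G. p \<theta> \<noteq> 0}"
      by (rule cov_ringI[of "pL v w" _ "qL v w"]) (use poly[of v w] inv[OF p(4) that] in blast)+
    show "(\<lambda>\<theta>. snd \<theta> v w) \<in> cov_ring G {\<theta> \<in> Theta G. p \<theta> \<noteq> 0}"
      by (rule cov_ringI[of "pO v w" _ "qO v w"]) (use poly[of v w] inv[OF p(4) that] in blast)+
  qed
  with p show ?R by blast
next
  assume ?R
  then obtain p \<theta> where p: "p \<in> polyfuns (param_coords G)" "\<theta> \<in> Theta G" "p \<theta> \<noteq> 0"
    and mem: "\<And>v w. v \<in> nodes G \<Longrightarrow> w \<in> nodes G \<Longrightarrow>
        (\<lambda>\<theta>. fst \<theta> v w) \<in> cov_ring G {\<theta> \<in> Theta G. p \<theta> \<noteq> 0} \<and>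
        (\<lambda>\<theta>. snd \<theta> v w) \<in> cov_ring G {\<theta> \<in> Theta G. p \<theta> \<noteq> 0}" by blast
  \<comment> \<open>The four polynomials are bundled so that they can be chosen for all
    \<open>v\<close> and \<open>w\<close> at once; for pairs outside the node set constants
    serve.\<close>
  define inv_at where "inv_at = (\<lambda>v w pL qL pO qO. (pL \<in> polyfuns (cov_coords G)
      \<and> qL \<in> polyfuns (cov_coords G)
      \<and> pO \<in> polyfuns (cov_coords G) \<and> qO \<in> polyfuns (cov_coords G)) \<and>
      (v \<in> nodes G \<longrightarrow> w \<in> nodes G \<longrightarrow> (\<forall>\<theta>\<in>{\<theta> \<in> Theta G. p \<theta> \<noteq> 0}.
        qL (phi G \<theta>) \<noteq> 0 \<and> fst \<theta> v w = pL (phi G \<theta>) / qL (phi G \<theta>)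
      \<and> qO (phi G \<theta>) \<noteq> 0 \<and> snd \<theta> v w = pO (phi G \<theta>) / qO (phi G \<theta>))))"
  have "\<exists>pL qL pO qO. inv_at v w pL qL pO qO" for v w
  proof (cases "v \<in> nodes G \<and> w \<in> nodes G")
    case True
    then obtain pL qL where L: "pL \<in> polyfuns (cov_coords G)" "qL \<in> polyfuns (cov_coords G)"
      "\<forall>\<theta>\<in>{\<theta> \<in> Theta G. p \<theta> \<noteq> 0}. qL (phi G \<theta>) \<noteq> 0 \<and> fst \<theta> v w = pL (phi G \<theta>) / qL (phi G \<theta>)"
      using mem[of v w] unfolding cov_ring_def by blast
    from True obtain pO qO where "pO \<in> polyfuns (cov_coords G)" "qO \<in> polyfuns (cov_coords G)"
      "\<forall>\<theta>\<in>{\<theta> \<in> Theta G. p \<theta> \<noteq> 0}. qO (phi G \<theta>) \<noteq> 0 \<and> snd \<theta> v w = pO (phi G \<theta>) / qO (phi G \<theta>)"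
      using mem[of v w] unfolding cov_ring_def by blast
    with L show ?thesis unfolding inv_at_def by blast
  next
    case False
    then show ?thesis unfolding inv_at_def using polyfuns.const by blast
  qed
  then obtain pL qL pO qO where "\<And>v w. inv_at v w (pL v w) (qL v w) (pO v w) (qO v w)"
    by metis
  with proper_alg_subsetI[OF p] show "rationally_identifiable G"
    unfolding rationally_identifiable_def
    by (intro exI[of _ "{\<theta> \<in> Theta G. p \<theta> = 0}"] exI[of _ pL] exI[of _ qL] exI[of _ pO] exI[of _ qO])
       (auto simp: inv_at_def)
qed

lemma generically_identifiable_iff:
  "generically_identifiable G \<longleftrightarrow>
    (\<exists>p\<in>polyfuns (param_coords G). (\<exists>\<theta>\<in>Theta G. p \<theta> \<noteq> 0) \<and>
      inj_on (phi G) {\<theta> \<in> Theta G. p \<theta> \<noteq> 0})" (is "_ \<longleftrightarrow> ?R")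
proof
  assume "generically_identifiable G"
  then obtain W where W: "proper_alg_subset G (Theta G) W" "inj_on (phi G) (Theta G - W)"
    unfolding generically_identifiable_def by blast
  obtain p \<theta> where p: "p \<in> polyfuns (param_coords G)" "\<theta> \<in> Theta G" "p \<theta> \<noteq> 0"
    "\<And>\<theta>. \<theta> \<in> Theta G \<Longrightarrow> p \<theta> \<noteq> 0 \<Longrightarrow> \<theta> \<in> Theta G - W"
    using proper_alg_subsetD[OF W(1)] by blast
  then have "inj_on (phi G) {\<theta> \<in> Theta G. p \<theta> \<noteq> 0}"
    by (intro inj_on_subset[OF W(2)]) auto
  with p show ?R by blast
next
  assume ?R
  then obtain p \<theta> where p: "p \<in> polyfuns (param_coords G)" "\<theta> \<in> Theta G" "p \<theta> \<noteq> 0"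
    and inj: "inj_on (phi G) {\<theta> \<in> Theta G. p \<theta> \<noteq> 0}" by blast
  have "Theta G - {\<theta> \<in> Theta G. p \<theta> = 0} = {\<theta> \<in> Theta G. p \<theta> \<noteq> 0}" by auto
  with inj have "inj_on (phi G) (Theta G - {\<theta> \<in> Theta G. p \<theta> = 0})" by simp
  with proper_alg_subsetI[OF p] show "generically_identifiable G"
    unfolding generically_identifiable_def by blast
qed

lemma generically_infinite_to_one_iff:
  "generically_infinite_to_one G \<longleftrightarrow>
    (\<exists>p\<in>polyfuns (param_coords G). (\<exists>\<theta>\<in>Theta G. p \<theta> \<noteq> 0) \<and>
      (\<forall>\<theta>\<in>Theta G. p \<theta> \<noteq> 0 \<longrightarrow> infinite (fiber G (Theta G) \<theta>)))" (is "_ \<longleftrightarrow> ?R")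
proof
  assume "generically_infinite_to_one G"
  then show ?R
    unfolding generically_infinite_to_one_def by (metis proper_alg_subsetD)
next
  assume ?R
  then obtain p \<theta> where p: "p \<in> polyfuns (param_coords G)" "\<theta> \<in> Theta G" "p \<theta> \<noteq> 0"
    and inf: "\<And>\<theta>. \<theta> \<in> Theta G \<Longrightarrow> p \<theta> \<noteq> 0 \<Longrightarrow> infinite (fiber G (Theta G) \<theta>)" by blast
  with proper_alg_subsetI[OF p] show "generically_infinite_to_one G"
    unfolding generically_infinite_to_one_def
    by (intro exI[of _ "{\<theta> \<in> Theta G. p \<theta> = 0}"]) auto
qed

lemma generically_h_to_one_iff:
  "generically_h_to_one G h \<longleftrightarrow>
    (\<exists>p\<in>polyfuns (param_coords G). (\<exists>\<theta>\<in>ThetaC G. p \<theta> \<noteq> 0) \<and>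
      (\<forall>\<theta>\<in>ThetaC G. p \<theta> \<noteq> 0 \<longrightarrow> ecard (fiber G (ThetaC G) \<theta>) = h))" (is "_ \<longleftrightarrow> ?R")
proof
  assume "generically_h_to_one G h"
  then show ?R
    unfolding generically_h_to_one_def by (metis proper_alg_subsetD)
next
  assume ?R
  then obtain p \<theta> where p: "p \<in> polyfuns (param_coords G)" "\<theta> \<in> ThetaC G" "p \<theta> \<noteq> 0"
    and inf: "\<And>\<theta>. \<theta> \<in> ThetaC G \<Longrightarrow> p \<theta> \<noteq> 0 \<Longrightarrow> ecard (fiber G (ThetaC G) \<theta>) = h" by blast
  with proper_alg_subsetI[OF p] show "generically_h_to_one G h"
    unfolding generically_h_to_one_def
    by (intro exI[of _ "{\<theta> \<in> ThetaC G. p \<theta> = 0}"]) auto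
qed

section \<open>Positive definite matrices\<close>

lemma posdef_on_iff:
  "posdef_on V Om \<longleftrightarrow> (\<forall>x. (\<exists>v\<in>V. x v \<noteq> 0) \<longrightarrow> (\<Sum>v\<in>V. \<Sum>w\<in>V. x v * Om v w * x w) > 0)"
proof
  assume pd: "posdef_on V Om"
  show "\<forall>x. (\<exists>v\<in>V. x v \<noteq> 0) \<longrightarrow> (\<Sum>v\<in>V. \<Sum>w\<in>V. x v * Om v w * x w) > 0"
  proof (intro allI impI)
    fix x :: "nat \<Rightarrow> real" assume x: "\<exists>v\<in>V. x v \<noteq> 0"
    define y where "y = (\<lambda>v. if v \<in> V then x v else 0)"
    have "(\<forall>v. v \<notin> V \<longrightarrow> y v = 0) \<and> (\<exists>v\<in>V. y v \<noteq> 0)" using x by (simp add: y_def)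
    then have "(\<Sum>v\<in>V. \<Sum>w\<in>V. y v * Om v w * y w) > 0"
      using pd unfolding posdef_on_def by blast
    then show "(\<Sum>v\<in>V. \<Sum>w\<in>V. x v * Om v w * x w) > 0" by (simp add: y_def cong: sum.cong)
  qed
qed (unfold posdef_on_def, blast)

lemma posdef_on_cong:
  "(\<And>v w. v \<in> V \<Longrightarrow> w \<in> V \<Longrightarrow> A v w = B v w) \<Longrightarrow> posdef_on V A \<Longrightarrow> posdef_on V B"
  unfolding posdef_on_iff by (simp cong: sum.cong)

lemma posdef_on_subset:
  assumes "finite V" "C \<subseteq> V" "posdef_on V Om"
  shows "posdef_on C Om"
  unfolding posdef_on_def
proof (intro allI impI)
  fix x :: "nat \<Rightarrow> real" assume x: "(\<forall>v. v \<notin> C \<longrightarrow> x v = 0) \<and> (\<exists>v\<in>C. x v \<noteq> 0)"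
  have "(\<Sum>v\<in>V. \<Sum>w\<in>V. x v * Om v w * x w) = (\<Sum>v\<in>C. \<Sum>w\<in>V. x v * Om v w * x w)"
    by (rule sum.mono_neutral_right) (use assms x in auto)
  also have "\<dots> = (\<Sum>v\<in>C. \<Sum>w\<in>C. x v * Om v w * x w)"
    by (rule sum.cong[OF refl], rule sum.mono_neutral_right) (use assms x in auto)
  moreover have "(\<Sum>v\<in>V. \<Sum>w\<in>V. x v * Om v w * x w) > 0"
    using assms(2,3) x unfolding posdef_on_iff by blast
  ultimately show "(\<Sum>v\<in>C. \<Sum>w\<in>C. x v * Om v w * x w) > 0" by simp
qed

lemma posdef_on_nonneg:
  assumes "posdef_on V Om"
  shows "(\<Sum>v\<in>V. \<Sum>w\<in>V. x v * Om v w * x w) \<ge> 0"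
  using assms unfolding posdef_on_iff by (cases "\<exists>v\<in>V. x v \<noteq> 0") (auto intro: less_imp_le)

text \<open>Without cross terms the quadratic form splits, and a nonzero vector is nonzero on one of
  the two parts.\<close>

lemma posdef_on_union:
  assumes fin: "finite A" "finite B" and AB: "A \<inter> B = {}" "posdef_on A Om" "posdef_on B Om"
    and zero: "\<And>a b. a \<in> A \<Longrightarrow> b \<in> B \<Longrightarrow> Om a b = 0 \<and> Om b a = 0"
  shows "posdef_on (A \<union> B) Om"
  unfolding posdef_on_iff
proof (intro allI impI)
  fix x :: "nat \<Rightarrow> real" assume x: "\<exists>v\<in>A \<union> B. x v \<noteq> 0"
  let ?Q = "\<lambda>S. \<Sum>v\<in>S. \<Sum>w\<in>S. x v * Om v w * x w"
  have "?Q (A \<union> B) = ?Q A + ?Q B"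
    using fin AB(1) zero by (simp add: sum.union_disjoint)
  moreover have "?Q A \<ge> 0" "?Q B \<ge> 0" using AB by (auto intro: posdef_on_nonneg)
  moreover have "?Q A > 0 \<or> ?Q B > 0" using x AB(2,3) unfolding posdef_on_iff by blast
  ultimately show "?Q (A \<union> B) > 0" by linarith
qed

lemma posdef_on_diag:
  assumes "finite V" "\<And>v. v \<in> V \<Longrightarrow> E v > 0"
  shows "posdef_on V (\<lambda>v w. if v = w then E v else 0)"
  unfolding posdef_on_iff
proof (intro allI impI)
  fix x :: "nat \<Rightarrow> real" assume x: "\<exists>v\<in>V. x v \<noteq> 0"
  have "(\<Sum>v\<in>V. \<Sum>w\<in>V. x v * (if v = w then E v else 0) * x w) = (\<Sum>v\<in>V. E v * (x v)\<^sup>2)"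
  proof (rule sum.cong[OF refl])
    fix v assume "v \<in> V"
    have "(\<Sum>w\<in>V. x v * (if v = w then E v else 0) * x w) = (\<Sum>w\<in>V. if v = w then E v * (x v)\<^sup>2 else 0)"
      by (rule sum.cong) (auto simp: power2_eq_square)
    then show "(\<Sum>w\<in>V. x v * (if v = w then E v else 0) * x w) = E v * (x v)\<^sup>2"
      using assms(1) \<open>v \<in> V\<close> by simp
  qed
  also obtain v where v: "v \<in> V" "x v \<noteq> 0" using x by blast
  have "(\<Sum>v\<in>V. E v * (x v)\<^sup>2) > 0"
    by (rule sum_pos2[OF assms(1) v(1)]) (use assms v in \<open>auto simp: less_imp_le\<close>)
  finally show "(\<Sum>v\<in>V. \<Sum>w\<in>V. x v * (if v = w then E v else 0) * x w) > 0" .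
qed

lemma posdef_on_diag_pos:
  assumes "finite V" "posdef_on V Om" "v \<in> V"
  shows "Om v v > 0"
proof -
  have "posdef_on {v} Om" using posdef_on_subset[OF assms(1) _ assms(2)] assms(3) by blast
  then show ?thesis unfolding posdef_on_iff by (auto dest: spec[of _ "\<lambda>_. 1"])
qed

context acyclic_mixed_graph
begin

lemma Theta_iff: "\<theta> \<in> Theta G \<longleftrightarrow> \<theta> \<in> params \<and> posdef_on V (snd \<theta>)"
  by (cases \<theta>) (simp add: Theta_def params_def)

lemma ThetaC_eq: "ThetaC G = params"
  by (auto simp: ThetaC_def params_def)

lemma identity_params: "((\<lambda>_ _. 0), idm V) \<in> params"
  by (auto simp: params_iff idm_def extensional_on_def)

lemma identity_Theta: "((\<lambda>_ _. 0), idm V) \<in> Theta G"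
proof -
  have "posdef_on V (idm V)"
    by (rule posdef_on_cong[OF _ posdef_on_diag[of V "\<lambda>_. 1"]]) (auto simp: idm_def)
  then show ?thesis by (simp add: Theta_iff identity_params)
qed

lemma sorted_nodes: "\<exists>vs. set vs = V \<and> sorted_wrt (\<lambda>a b. r a < r b) vs \<and> distinct vs"
proof -
  define vs where "vs = map (inv_into V r) (sorted_list_of_set (r ` V))"
  have "set vs = V" by (simp add: vs_def inj_rank inv_into_image_cancel)
  moreover have "sorted_wrt (\<lambda>a b. r a < r b) vs"
  proof -
    have "sorted_wrt (\<lambda>x y. r (inv_into V r x) < r (inv_into V r y)) (sorted_list_of_set (r ` V))"
      by (rule sorted_wrt_mono_rel[OF _ strict_sorted_list_of_set]) (auto simp: f_inv_into_f)
    then show ?thesis by (simp add: vs_def sorted_wrt_map)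
  qed
  moreover have "distinct vs" unfolding vs_def
    by (auto simp: distinct_map inj_on_inv_into)
  ultimately show ?thesis by blast
qed

lemma Theta_ldl:
  assumes "\<theta> \<in> Theta G"
  shows "\<exists>U d. ldl r V bicomp (snd \<theta>) U d"
proof -
  obtain vs where vs: "set vs = V" "sorted_wrt (\<lambda>a b. r a < r b) vs" "distinct vs"
    using sorted_nodes by blast
  have par: "\<theta> \<in> params" and pd: "posdef_on V (snd \<theta>)" using assms by (auto simp: Theta_iff)
  have sym: "\<forall>a b. snd \<theta> a b = snd \<theta> b a" using par by (simp add: params_iff)
  have "pivot_prod vs (snd \<theta>) > 0"
    by (rule pivot_prod_pos[OF vs(3) sym]) (use pd vs(1) in \<open>auto simp: posdef_on_iff\<close>)
  then show ?thesis
    using ldl_exists[OF vs(2) _ sym blockdiag_Omega[OF par]] vs(1) by simp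
qed

text \<open>The polynomial is \<open>pivot_prod\<close> along a topological order; at the identity
  matrix it equals 1.\<close>

lemma generic_ldl:
  obtains p :: "'a::field mat \<times> 'a mat \<Rightarrow> 'a" where "p \<in> polyfuns (param_coords G)"
    "p ((\<lambda>_ _. 0), idm V) \<noteq> 0"
    "\<And>\<theta>. \<theta> \<in> params \<Longrightarrow> p \<theta> \<noteq> 0 \<Longrightarrow> \<exists>U d. ldl r V bicomp (snd \<theta>) U d"
proof -
  obtain vs where vs: "set vs = V" "sorted_wrt (\<lambda>a b. r a < r b) vs" "distinct vs"
    using sorted_nodes by blast
  show ?thesis
  proof (rule that[of "\<lambda>\<theta>. pivot_prod vs (snd \<theta>)"])
    show "(\<lambda>\<theta>. pivot_prod vs (snd \<theta>)) \<in> polyfuns (param_coords G)"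
      by (rule pivot_prod_polyfuns) (use vs in \<open>auto intro: param_coords_polyfuns\<close>)
    show "pivot_prod vs (snd ((\<lambda>_ _. 0) :: 'a mat, idm V :: 'a mat)) \<noteq> 0"
      using pivot_prod_identity[OF vs(3), of "idm V :: 'a mat"] vs(1) by (auto simp: idm_def)
    fix \<theta> :: "'a mat \<times> 'a mat" assume *: "\<theta> \<in> params" "pivot_prod vs (snd \<theta>) \<noteq> 0"
    then have "\<forall>a b. snd \<theta> a b = snd \<theta> b a" by (simp add: params_iff)
    then show "\<exists>U d. ldl r V bicomp (snd \<theta>) U d"
      using ldl_exists[OF vs(2) *(2) _ blockdiag_Omega[OF *(1)]] vs(1) by simp
  qed
qed

text \<open>The parameter space without positivity is an affine space, so two polynomials can be
  separated from zero simultaneously on a line.\<close>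
lemma params_nonzero_both:
  fixes p q :: "'a::field_char_0 mat \<times> 'a mat \<Rightarrow> 'a"
  assumes "p \<in> polyfuns (param_coords G)" "q \<in> polyfuns (param_coords G)"
    and a: "a \<in> params" "p a \<noteq> 0" and b: "b \<in> params" "q b \<noteq> 0"
  shows "\<exists>\<theta>\<in>params. p \<theta> \<noteq> 0 \<and> q \<theta> \<noteq> 0"
proof -
  define l where "l = (\<lambda>z :: 'a. ((\<lambda>v w. fst a v w + z * (fst b v w - fst a v w)),
      (\<lambda>v w. snd a v w + z * (snd b v w - snd a v w))))"
  have l01: "l 0 = a" "l 1 = b" by (auto simp: l_def)
  have l_params: "l z \<in> params" for z
    using a(1) b(1) by (auto simp: l_def params_iff extensional_on_def)
  have "(\<lambda>z. f (l z)) \<in> range poly" if "f \<in> polyfuns (param_coords G)" for f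
  proof (rule polyfuns_subst[OF that])
    show "(\<lambda>_. c) \<in> range poly" for c :: 'a
      by (rule range_eqI[of _ _ "[:c:]"]) auto
    show "(\<lambda>z. f (l z)) \<in> range poly" if "f \<in> param_coords G" for f
    proof -
      have "(\<lambda>z. x + z * (y - x)) \<in> range poly" for x y :: 'a
        by (rule range_eqI[of _ _ "[:x, y - x:]"]) auto
      with that show ?thesis by (auto simp: param_coords_def l_def)
    qed
  next
    fix f g :: "'a \<Rightarrow> 'a" assume "f \<in> range poly" "g \<in> range poly"
    then obtain s t where st: "f = poly s" "g = poly t" by auto
    show "(\<lambda>z. f z + g z) \<in> range poly" by (rule range_eqI[of _ _ "s + t"]) (auto simp: st)
    show "(\<lambda>z. f z * g z) \<in> range poly" by (rule range_eqI[of _ _ "s * t"]) (auto simp: st)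
  qed
  then obtain s t where st: "\<And>z. p (l z) = poly s z" "\<And>z. q (l z) = poly t z"
    using assms(1,2) by (metis (no_types, lifting) imageE)
  have "s \<noteq> 0" using st(1)[of 0] l01 a by auto
  moreover have "t \<noteq> 0" using st(2)[of 1] l01 b by auto
  ultimately have "s * t \<noteq> 0" by simp
  \<comment> \<open>A field of characteristic zero is infinite, so the nonzero polynomial
    \<open>s * t\<close> has a non-root.\<close>
  then obtain z where "poly (s * t) z \<noteq> 0" using poly_all_0_iff_0 by blast
  then have "p (l z) \<noteq> 0" "q (l z) \<noteq> 0" by (auto simp: st)
  with l_params show ?thesis by blast
qed

end

section \<open>Fibers as products over the mixed components\<close>

context bidirected_component
begin

lemma replace_restrict:
  assumes "\<theta> \<in> params"
  shows "replace_param G C (restrict_param G C E \<theta>) \<theta> = \<theta>"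
proof (rule prod_eqI)
  have "fst \<theta> a b = 0" if "b \<in> C" "a \<notin> comp_nodes C" for a b
    using that assms dedges_comp_nodes[of a b C] unfolding params_iff by blast
  then show "fst (replace_param G C (restrict_param G C E \<theta>) \<theta>) = fst \<theta>"
    by (auto simp: replace_param_def restrict_param_def fun_eq_iff)
  show "snd (replace_param G C (restrict_param G C E \<theta>) \<theta>) = snd \<theta>"
    by (auto simp: replace_param_def restrict_param_def fun_eq_iff)
qed

lemma restrict_polyfuns:
  assumes "p \<in> polyfuns (param_coords (mixed_component G C))"
  shows "(\<lambda>\<theta>. p (restrict_param G C E \<theta>)) \<in> polyfuns (param_coords G)"
proof (rule polyfuns_subst[OF assms])
  fix f :: "'a::comm_ring_1 mat \<times> 'a mat \<Rightarrow> 'a"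
  assume "f \<in> param_coords (mixed_component G C)"
  then consider v w where "f = (\<lambda>\<theta>. fst \<theta> v w)" "v \<in> comp_nodes C" "w \<in> comp_nodes C"
    | v w where "f = (\<lambda>\<theta>. snd \<theta> v w)" "v \<in> comp_nodes C" "w \<in> comp_nodes C"
    unfolding param_coords_def by blast
  then show "(\<lambda>\<theta>. f (restrict_param G C E \<theta>)) \<in> polyfuns (param_coords G)"
  proof cases
    case 1
    then show ?thesis using param_coords_polyfuns(1)[of v G w] C_subset(2) polyfuns.const
      by (cases "w \<in> C") (auto simp: restrict_param_def)
  next
    case 2
    then show ?thesis using param_coords_polyfuns(2)[of v G w] C_subset(2) polyfuns.const
      by (cases "v \<in> C \<and> w \<in> C") (auto simp: restrict_param_def)
  qed
qed (auto intro: polyfuns.intros)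

lemma replace_polyfuns:
  assumes "p \<in> polyfuns (param_coords G)"
  shows "(\<lambda>\<eta>. p (replace_param G C \<eta> \<theta>)) \<in> polyfuns (param_coords (mixed_component G C))"
proof (rule polyfuns_subst[OF assms])
  fix f :: "'a::comm_ring_1 mat \<times> 'a mat \<Rightarrow> 'a"
  assume "f \<in> param_coords G"
  then consider v w where "f = (\<lambda>\<theta>. fst \<theta> v w)" | v w where "f = (\<lambda>\<theta>. snd \<theta> v w)"
    unfolding param_coords_def by blast
  then show "(\<lambda>\<eta>. f (replace_param G C \<eta> \<theta>)) \<in> polyfuns (param_coords (mixed_component G C))"
  proof cases
    case 1
    then show ?thesis
      using param_coords_polyfuns(1)[of v "mixed_component G C" w] subsetD[OF C_subset(1), of w] polyfuns.const
      by (cases "w \<in> C"; cases "v \<in> comp_nodes C") (auto simp: replace_param_def)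
  next
    case 2
    then show ?thesis
      using param_coords_polyfuns(2)[of v "mixed_component G C" w] subsetD[OF C_subset(1)] polyfuns.const
      by (cases "v \<in> C \<and> w \<in> C") (auto simp: replace_param_def)
  qed
qed (auto intro: polyfuns.intros)

lemma restrict_Theta:
  assumes "\<theta> \<in> Theta G" "\<And>v. v \<in> comp_nodes C - C \<Longrightarrow> E v > 0"
  shows "restrict_param G C E \<theta> \<in> Theta (mixed_component G C)"
proof -
  have fin: "finite (comp_nodes C)" by simp
  let ?Om = "snd (restrict_param G C E \<theta>)"
  have "posdef_on (C \<union> (comp_nodes C - C)) ?Om"
  proof (rule posdef_on_union)
    show "posdef_on C ?Om"
      by (rule posdef_on_cong[OF _ posdef_on_subset[OF finite_nodes C_subset(3)]])
         (use assms in \<open>auto simp: restrict_param_def Theta_iff\<close>)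
    show "posdef_on (comp_nodes C - C) ?Om"
      by (rule posdef_on_cong[OF _ posdef_on_diag[of _ E]])
         (use assms fin in \<open>auto simp: restrict_param_def\<close>)
  qed (use fin finite_subset[OF C_subset(1)] in \<open>auto simp: restrict_param_def\<close>)
  moreover have "C \<union> (comp_nodes C - C) = comp_nodes C" using C_subset by auto
  ultimately show ?thesis
    using assms restrict_params[of \<theta> E] by (simp add: component.Theta_iff Theta_iff)
qed

text \<open>New block and old rest belong to different bidirected components, so Omega has no
  entries between them and positivity is checked on each part.\<close>

lemma replace_Theta:
  assumes "\<eta> \<in> Theta (mixed_component G C)" "\<theta> \<in> Theta G"
  shows "replace_param G C \<eta> \<theta> \<in> Theta G"
proof -
  let ?Om = "snd (replace_param G C \<eta> \<theta>)"
  have par: "\<eta> \<in> component.params" "\<theta> \<in> params" using assms by (auto simp: component.Theta_iff Theta_iff)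
  note par' = replace_params[OF par]
  have "posdef_on (C \<union> (V - C)) ?Om"
  proof (rule posdef_on_union)
    show "posdef_on C ?Om"
      by (rule posdef_on_cong[OF _ posdef_on_subset[OF component.finite_nodes C_subset(1)]])
         (use assms in \<open>auto simp: replace_param_def component.Theta_iff\<close>)
    show "posdef_on (V - C) ?Om"
      by (rule posdef_on_cong[OF _ posdef_on_subset[of V _ "snd \<theta>"]])
         (use assms in \<open>auto simp: replace_param_def Theta_iff\<close>)
    show "?Om a b = 0 \<and> ?Om b a = 0" if "a \<in> C" "b \<in> V - C" for a b
      using that blockdiag_C[OF blockdiag_Omega[OF par']] by auto
  qed (use finite_subset[OF C_subset(3)] in auto)
  moreover have "C \<union> (V - C) = V" using C_subset by auto
  ultimately show ?thesis using par' by (simp add: Theta_iff)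
qed

lemma Theta_diag_pos:
  assumes "\<eta> \<in> Theta (mixed_component G C)" "v \<in> comp_nodes C - C"
  shows "snd \<eta> v v > 0"
  using assms posdef_on_diag_pos[OF component.finite_nodes] by (auto simp: component.Theta_iff)

end

context acyclic_mixed_graph
begin

text \<open>Each directed edge lies in the mixed component of its head, and each nonzero entry of
  Omega in the block of its two nodes.\<close>

lemma restrict_inj:
  fixes \<theta> \<theta>' :: "'a::field mat \<times> 'a mat"
  assumes "\<theta> \<in> params" "\<theta>' \<in> params"
    and "\<And>C. C \<in> bicomponents G \<Longrightarrow> restrict_param G C (E C) \<theta> = restrict_param G C (E C) \<theta>'"
  shows "\<theta> = \<theta>'"
proof (rule prod_eqI; rule ext; rule ext)
  fix a b
  show "fst \<theta> a b = fst \<theta>' a b"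
  proof (cases "(a, b) \<in> dedges G")
    case True
    then have "bicomp b \<in> bicomponents G" "b \<in> bicomp b" "a \<in> comp_nodes (bicomp b)"
      using dedges_nodes comp_bicomponents dedges_comp_nodes by blast+
    then show ?thesis
      using arg_cong[OF assms(3)[of "bicomp b"], of "\<lambda>\<theta>. fst \<theta> a b"] by (simp add: restrict_param_def)
  next
    case False
    then show ?thesis using assms(1,2) by (simp add: params_iff)
  qed
  show "snd \<theta> a b = snd \<theta>' a b"
  proof (cases "a \<in> V \<and> bicomp a = bicomp b")
    case True
    then have "bicomp a \<in> bicomponents G" "a \<in> bicomp a" "b \<in> bicomp a"
      using comp_bicomponents by blast+
    then show ?thesis
      using arg_cong[OF assms(3)[of "bicomp a"], of "\<lambda>\<theta>. snd \<theta> a b"] by (simp add: restrict_param_def)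
  next
    case False
    have "snd \<theta>'' a b = 0" if "\<theta>'' \<in> params" for \<theta>'' :: "'a mat \<times> 'a mat"
      using False that blockdiag_Omega[OF that] unfolding blockdiag_def params_iff extensional_on_def by blast
    then show ?thesis using assms(1,2) by simp
  qed
qed

end

text \<open>The real and the complex parameter spaces at once; \<open>pos\<close> is the condition on the variances
  of the nodes of a mixed component outside its bidirected component.\<close>
locale parameter_family = acyclic_mixed_graph +
  fixes T :: "('a::field mat \<times> 'a mat) set" and TC :: "nat set \<Rightarrow> ('a mat \<times> 'a mat) set"
    and pos :: "'a \<Rightarrow> bool"
  assumes T_params: "T \<subseteq> params"
    and TC_params: "C \<in> bicomponents G \<Longrightarrow> TC C \<subseteq> acyclic_mixed_graph.params (mixed_component G C)"
    and T_replace: "C \<in> bicomponents G \<Longrightarrow> \<eta> \<in> TC C \<Longrightarrow> \<theta> \<in> T \<Longrightarrow> replace_param G C \<eta> \<theta> \<in> T"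
    and T_restrict: "C \<in> bicomponents G \<Longrightarrow> \<theta> \<in> T \<Longrightarrow> (\<And>v. v \<in> comp_nodes C - C \<Longrightarrow> pos (E v))
      \<Longrightarrow> restrict_param G C E \<theta> \<in> TC C"
    and TC_pos: "C \<in> bicomponents G \<Longrightarrow> \<eta> \<in> TC C \<Longrightarrow> v \<in> comp_nodes C - C \<Longrightarrow> pos (snd \<eta> v v)"
begin

text \<open>The components are replaced one at a time: a replacement leaves the restrictions to
  other components alone, and \<open>step\<close> keeps \<open>p\<close> nonzero. Constant
  \<open>p\<close> and singletons \<open>F C\<close> prescribe all restrictions at once.\<close>

lemma exists_components:
  assumes "\<theta>0 \<in> T" "p \<theta>0 \<noteq> (0::'a)"
    and F: "\<And>C. C \<in> bicomponents G \<Longrightarrow> F C \<subseteq> TC C"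
    and step: "\<And>C \<theta>. C \<in> bicomponents G \<Longrightarrow> \<theta> \<in> T \<Longrightarrow> p \<theta> \<noteq> 0 \<Longrightarrow>
      \<exists>\<eta>\<in>F C. p (replace_param G C \<eta> \<theta>) \<noteq> 0"
  obtains \<theta> E where "\<theta> \<in> T" "p \<theta> \<noteq> 0" "\<And>C. C \<in> bicomponents G \<Longrightarrow> restrict_param G C (E C) \<theta> \<in> F C"
proof -
  have "\<exists>\<theta> E. \<theta> \<in> T \<and> p \<theta> \<noteq> 0 \<and> (\<forall>C\<in>S. restrict_param G C (E C) \<theta> \<in> F C)"
    if "finite S" "S \<subseteq> bicomponents G" for S
    using that
  proof (induction S rule: finite_induct)
    case empty
    then show ?case using assms(1,2) by blast
  next
    case (insert C S)
    then obtain \<theta> E where IH: "\<theta> \<in> T" "p \<theta> \<noteq> 0" "\<forall>C\<in>S. restrict_param G C (E C) \<theta> \<in> F C" by auto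
    have C: "C \<in> bicomponents G" using insert.prems by auto
    interpret bidirected_component G r C by unfold_locales (rule C)
    obtain \<eta> where \<eta>: "\<eta> \<in> F C" "p (replace_param G C \<eta> \<theta>) \<noteq> 0"
      using step[OF C IH(1,2)] by blast
    then have \<eta>': "\<eta> \<in> TC C" "\<eta> \<in> component.params" using F[OF C] TC_params[OF C] by auto
    \<comment> \<open>Recording the source variances of \<open>\<eta>\<close> makes restriction
      return \<open>\<eta>\<close> itself.\<close>
    let ?E = "E(C := (\<lambda>v. snd \<eta> v v))"
    have "restrict_param G C' (?E C') (replace_param G C \<eta> \<theta>) \<in> F C'" if "C' \<in> insert C S" for C'
    proof (cases "C' = C")
      case True
      then show ?thesis using \<eta> by (simp add: restrict_replace[OF \<eta>'(2)])
    next
      case False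
      then have "C' \<in> S" "C' \<in> bicomponents G" using that insert.prems by auto
      then show ?thesis using IH(3) False by (simp add: restrict_replace_other[OF \<eta>'(2)])
    qed
    then show ?case using T_replace[OF C \<eta>'(1) IH(1)] \<eta>(2) by blast
  qed
  from this[OF finite_bicomponents] that show ?thesis by blast
qed

text \<open>Injective because restrictions jointly determine a parameter. For surjectivity, a tuple
  of points of the component fibers is assembled into one parameter, which lies in the fiber because
  its component covariances are the right ones.\<close>

lemma fiber_bij_betw:
  assumes \<theta>: "\<theta> \<in> T" and fac: "ldl r V bicomp (snd \<theta>) U d"
    and E: "\<And>C v. C \<in> bicomponents G \<Longrightarrow> v \<in> comp_nodes C - C \<Longrightarrow> pos (E C v) \<and> E C v \<noteq> 0"
  shows "bij_betw (\<lambda>\<theta>'. \<lambda>C\<in>bicomponents G. restrict_param G C (E C) \<theta>') (fiber G T \<theta>)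
    (PiE (bicomponents G) (\<lambda>C. fiber (mixed_component G C) (TC C) (restrict_param G C (E C) \<theta>)))"
  unfolding bij_betw_def
proof
  have par: "\<theta>' \<in> params" if "\<theta>' \<in> T" for \<theta>' using that T_params by blast
  have eq: "phi G \<theta>' = phi G \<theta> \<longleftrightarrow>
    (\<forall>C\<in>bicomponents G. phi (mixed_component G C) (restrict_param G C (E C) \<theta>')
       = phi (mixed_component G C) (restrict_param G C (E C) \<theta>))" if "\<theta>' \<in> T" for \<theta>'
    by (rule phi_eq_iff_components[OF par[OF \<theta>] par[OF that] fac]) (use E in blast)
  have res: "restrict_param G C (E C) \<theta>' \<in> TC C" if "\<theta>' \<in> T" "C \<in> bicomponents G" for \<theta>' C
    using T_restrict[OF that(2,1)] E[OF that(2)] by blast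
  let ?f = "\<lambda>\<theta>'. \<lambda>C\<in>bicomponents G. restrict_param G C (E C) \<theta>'"
  let ?P = "PiE (bicomponents G) (\<lambda>C. fiber (mixed_component G C) (TC C) (restrict_param G C (E C) \<theta>))"
  show "inj_on ?f (fiber G T \<theta>)"
  proof (rule inj_onI)
    fix \<theta>1 \<theta>2 assume *: "\<theta>1 \<in> fiber G T \<theta>" "\<theta>2 \<in> fiber G T \<theta>" "?f \<theta>1 = ?f \<theta>2"
    show "\<theta>1 = \<theta>2"
    proof (rule restrict_inj[where E = E])
      show "restrict_param G C (E C) \<theta>1 = restrict_param G C (E C) \<theta>2" if "C \<in> bicomponents G" for C
        using fun_cong[OF *(3), of C] that by simp
    qed (use * par in \<open>auto simp: fiber_def\<close>)
  qed
  show "?f ` fiber G T \<theta> = ?P"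
  proof (intro equalityI subsetI)
    fix g assume "g \<in> ?f ` fiber G T \<theta>"
    then show "g \<in> ?P" using eq res by (auto simp: fiber_def)
  next
    fix g assume g: "g \<in> ?P"
    have gC: "g C \<in> TC C"
      "phi (mixed_component G C) (g C) = phi (mixed_component G C) (restrict_param G C (E C) \<theta>)"
      if "C \<in> bicomponents G" for C
      using PiE_mem[OF g that] by (auto simp: fiber_def)
    obtain \<theta>' E' where \<theta>': "\<theta>' \<in> T"
      and E': "\<And>C. C \<in> bicomponents G \<Longrightarrow> restrict_param G C (E' C) \<theta>' \<in> {g C}"
      by (rule exists_components[OF \<theta>, of "\<lambda>_. 1" "\<lambda>C. {g C}"]) (use gC in auto)
    have g_eq: "restrict_param G C (E C) \<theta>' = g C" if C: "C \<in> bicomponents G" for C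
    proof -
      interpret bidirected_component G r C by unfold_locales (rule C)
      \<comment> \<open>Assembling yields its own fillers \<open>E'\<close>. They equal
        \<open>E\<close>, since source variances are read off from covariance matrices that
        agree.\<close>
      have "E C v = E' C v" if v: "v \<in> comp_nodes C - C" for v
      proof -
        have "snd (g C) v v = snd (restrict_param G C (E C) \<theta>) v v"
          using source_variance[OF _ v, of "g C"] source_variance[OF restrict_params[OF par[OF \<theta>]] v, of "E C"]
            gC[OF C] TC_params[OF C] by auto
        moreover have "snd (restrict_param G C (E' C) \<theta>') v v = snd (g C) v v" using E'[OF C] by simp
        ultimately show ?thesis using v by (simp add: restrict_param_def)
      qed
      then have "restrict_param G C (E C) \<theta>' = restrict_param G C (E' C) \<theta>'"
        by (auto simp: restrict_param_def fun_eq_iff)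
      then show ?thesis using E'[OF C] by simp
    qed
    have "\<theta>' \<in> fiber G T \<theta>" using \<theta>' eq[OF \<theta>'] g_eq gC by (simp add: fiber_def)
    moreover have "g = ?f \<theta>'"
      using g g_eq by (auto simp: fun_eq_iff PiE_def extensional_def)
    ultimately show "g \<in> ?f ` fiber G T \<theta>" by blast
  qed
qed

end

context acyclic_mixed_graph
begin

lemma parameter_family_Theta:
  "parameter_family G r (Theta G) (\<lambda>C. Theta (mixed_component G C)) (\<lambda>x. x > 0)"
proof
  show "Theta G \<subseteq> params" by (auto simp: Theta_iff)
next
  fix C assume C: "C \<in> bicomponents G"
  interpret bidirected_component G r C by unfold_locales (rule C)
  show "Theta (mixed_component G C) \<subseteq> component.params" by (auto simp: component.Theta_iff)
  show "replace_param G C \<eta> \<theta> \<in> Theta G" if "\<eta> \<in> Theta (mixed_component G C)" "\<theta> \<in> Theta G" for \<eta> \<theta>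
    using that by (rule replace_Theta)
  show "restrict_param G C E \<theta> \<in> Theta (mixed_component G C)"
    if "\<theta> \<in> Theta G" "\<And>v. v \<in> comp_nodes C - C \<Longrightarrow> 0 < E v" for \<theta> E
    using that by (rule restrict_Theta)
  show "0 < snd \<eta> v v" if "\<eta> \<in> Theta (mixed_component G C)" "v \<in> comp_nodes C - C" for \<eta> v
    using that by (rule Theta_diag_pos)
qed

lemma parameter_family_ThetaC:
  "parameter_family G r (ThetaC G) (\<lambda>C. ThetaC (mixed_component G C)) (\<lambda>_. True)"
proof
  show "ThetaC G \<subseteq> params" by (simp add: ThetaC_eq)
next
  fix C assume C: "C \<in> bicomponents G"
  interpret bidirected_component G r C by unfold_locales (rule C)
  show "ThetaC (mixed_component G C) \<subseteq> component.params" by (simp add: component.ThetaC_eq)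
  show "replace_param G C \<eta> \<theta> \<in> ThetaC G"
    if "\<eta> \<in> ThetaC (mixed_component G C)" "\<theta> \<in> ThetaC G" for \<eta> \<theta>
    using that unfolding ThetaC_eq component.ThetaC_eq by (rule replace_params)
  show "restrict_param G C E \<theta> \<in> ThetaC (mixed_component G C)" if "\<theta> \<in> ThetaC G" for \<theta> E
    using that unfolding ThetaC_eq component.ThetaC_eq by (rule restrict_params)
qed simp

end

section \<open>Decomposition\<close>

context bidirected_component
begin

text \<open>All other components are frozen at a generic \<open>\<theta>0\<close>. Then Sigma at
  \<open>s \<eta>\<close> is rational in the covariance matrix of \<open>G_C\<close>, and the
  rational inverse for \<open>G\<close> can be composed with it.\<close>

lemma rationally_identifiable_component:
  assumes "rationally_identifiable G"
  shows "rationally_identifiable (mixed_component G C)"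
proof -
  obtain p \<theta>0 where p: "p \<in> polyfuns (param_coords G)" and \<theta>0: "\<theta>0 \<in> Theta G" "p \<theta>0 \<noteq> 0"
    and mem: "\<And>v w. v \<in> V \<Longrightarrow> w \<in> V \<Longrightarrow>
        (\<lambda>\<theta>. fst \<theta> v w) \<in> cov_ring G {\<theta> \<in> Theta G. p \<theta> \<noteq> 0}"
    using assms unfolding rationally_identifiable_iff by blast
  let ?GC = "mixed_component G C"
  define s where "s = (\<lambda>\<eta>. replace_param G C \<eta> \<theta>0)"
  define T where "T = {\<eta> \<in> Theta ?GC. p (s \<eta>) \<noteq> 0}"
  define K where "K = cov_ring ?GC T"
  have K: "function_field T K" unfolding K_def by (rule function_field_cov_ring)
  interpret K: function_field T K by (rule K)
  have par0: "\<theta>0 \<in> params" using \<theta>0 by (simp add: Theta_iff)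
  have T: "\<eta> \<in> Theta ?GC" "\<eta> \<in> component.params" "s \<eta> \<in> {\<theta> \<in> Theta G. p \<theta> \<noteq> 0}" "s \<eta> \<in> params"
    if "\<eta> \<in> T" for \<eta>
    using that replace_Theta[OF _ \<theta>0(1)] by (auto simp: T_def s_def component.Theta_iff Theta_iff)
  \<comment> \<open>At \<open>C\<close> the filler follows \<open>\<eta>\<close>, so that
    restricting \<open>s \<eta>\<close> gives back \<open>\<eta>\<close>; elsewhere any positive
    constant works.\<close>
  define E where "E = (\<lambda>(\<eta> :: real mat \<times> real mat) C'. if C' = C then (\<lambda>v. snd \<eta> v v) else (\<lambda>_. 1 :: real))"
  have phiK: "(\<lambda>\<eta>. phi ?GC \<eta> a b) \<in> K" if "a \<in> comp_nodes C" "b \<in> comp_nodes C" for a b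
    unfolding K_def using that by (rule phi_cov_ring)
  have "\<forall>a\<in>V. \<forall>b\<in>V. (\<lambda>\<eta>. phi G (s \<eta>) a b) \<in> K"
  proof (subst phi_mem_iff_components[OF K, where E = E])
    show "\<exists>U d. ldl r V bicomp (snd (s \<eta>)) U d" if "\<eta> \<in> T" for \<eta>
      using Theta_ldl T(3)[OF that] by blast
    show "E \<eta> C' v \<noteq> 0" if "\<eta> \<in> T" "C' \<in> bicomponents G" "v \<in> comp_nodes C' - C'" for \<eta> C' v
      using Theta_diag_pos[OF T(1)[OF that(1)], of v] that(3) by (auto simp: E_def)
    show "(\<lambda>\<eta>. E \<eta> C' v) \<in> K" if "C' \<in> bicomponents G" "v \<in> comp_nodes C' - C'" for C' v
    proof (cases "C' = C")
      case True
      then have v: "v \<in> comp_nodes C - C" using that by simp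
      have "(\<lambda>\<eta>. phi ?GC \<eta> v v) \<in> K" using v by (intro phiK) auto
      then show ?thesis by (rule K.agree) (simp add: E_def True source_variance[OF T(2) v])
    qed (simp add: E_def K.const)
    show "\<forall>C'\<in>bicomponents G. \<forall>a\<in>comp_nodes C'. \<forall>b\<in>comp_nodes C'.
       (\<lambda>\<eta>. phi (mixed_component G C') (restrict_param G C' (E \<eta> C') (s \<eta>)) a b) \<in> K"
    proof (intro ballI)
      fix C' a b assume *: "C' \<in> bicomponents G" "a \<in> comp_nodes C'" "b \<in> comp_nodes C'"
      show "(\<lambda>\<eta>. phi (mixed_component G C') (restrict_param G C' (E \<eta> C') (s \<eta>)) a b) \<in> K"
      proof (cases "C' = C")
        case True
        have "(\<lambda>\<eta>. phi ?GC \<eta> a b) \<in> K" using * True by (intro phiK) auto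
        then show ?thesis
          by (rule K.agree) (simp add: True s_def E_def restrict_replace[OF T(2)])
      next
        case False
        show ?thesis
          by (rule K.agree[OF K.const])
             (simp add: s_def E_def False restrict_replace_other[OF T(2) *(1) False])
      qed
    qed
  qed (use T in auto)
  then have subst: "(\<lambda>\<eta>. f (s \<eta>)) \<in> K" if "f \<in> cov_ring G {\<theta> \<in> Theta G. p \<theta> \<noteq> 0}" for f
    by (intro cov_ring_subst[OF K that]) (use T in auto)
  have L: "(\<lambda>\<eta>. fst \<eta> v w) \<in> K" if "v \<in> comp_nodes C" "w \<in> comp_nodes C" for v w
  proof (cases "w \<in> C")
    case True
    have "(\<lambda>\<eta>. fst (s \<eta>) v w) \<in> K" by (rule subst[OF mem]) (use that C_subset in auto)
    then show ?thesis by (rule K.agree) (use True that in \<open>simp add: s_def replace_param_def\<close>)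
  next
    case False
    show ?thesis
      by (rule K.agree[OF K.const[of 0]]) (use T(2) False in \<open>simp add: component.params_iff comp_dedges\<close>)
  qed
  have P: "(\<lambda>\<eta>. component.IL \<eta> v w) \<in> K" if "v \<in> comp_nodes C" "w \<in> comp_nodes C" for v w
    unfolding I_minus_def by (intro K.diff K.const L that)
  \<comment> \<open>The source variances of \<open>\<eta>\<close> are lost in
    \<open>s \<eta>\<close>, so Omega is recomputed from Lambda and the covariance matrix as
    \<open>(I - Lambda)^T Sigma (I - Lambda)\<close>.\<close>
  have O: "(\<lambda>\<eta>. snd \<eta> v w) \<in> K" if "v \<in> comp_nodes C" "w \<in> comp_nodes C" for v w
  proof -
    have "(\<lambda>\<eta>. \<Sum>j\<in>comp_nodes C. (\<Sum>i\<in>comp_nodes C. component.IL \<eta> i v * phi ?GC \<eta> i j) * component.IL \<eta> j w) \<in> K"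
      using that by (intro K.sum K.mult P phiK)
    then show ?thesis
    proof (rule K.agree)
      fix \<eta> assume "\<eta> \<in> T"
      from fun_cong[OF fun_cong[OF component.Omega_from_phi[OF T(2)[OF this]]], of v w]
      show "(\<Sum>j\<in>comp_nodes C. (\<Sum>i\<in>comp_nodes C. component.IL \<eta> i v * phi ?GC \<eta> i j) * component.IL \<eta> j w)
        = snd \<eta> v w"
        by (simp add: mmult_def mtrans_def)
    qed
  qed
  \<comment> \<open>Inserting \<open>\<eta>0\<close> gives back \<open>\<theta>0\<close> for
    whichever filler, so \<open>p\<close> is nonzero there.\<close>
  define \<eta>0 where "\<eta>0 = restrict_param G C (\<lambda>_. 1) \<theta>0"
  have "\<eta>0 \<in> Theta ?GC" "p (s \<eta>0) \<noteq> 0"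
    using restrict_Theta[OF \<theta>0(1)] \<theta>0(2) by (auto simp: \<eta>0_def s_def replace_restrict[OF par0])
  moreover have "(\<lambda>\<eta>. p (s \<eta>)) \<in> polyfuns (param_coords ?GC)"
    unfolding s_def by (rule replace_polyfuns[OF p])
  ultimately show ?thesis
    unfolding rationally_identifiable_iff using L O unfolding K_def T_def
    by (intro bexI[of _ "\<lambda>\<eta>. p (s \<eta>)"]) auto
qed

lemma generically_identifiable_component:
  assumes "generically_identifiable G"
  shows "generically_identifiable (mixed_component G C)"
proof -
  obtain p \<theta>0 where p: "p \<in> polyfuns (param_coords G)" and \<theta>0: "\<theta>0 \<in> Theta G" "p \<theta>0 \<noteq> 0"
    and inj: "inj_on (phi G) {\<theta> \<in> Theta G. p \<theta> \<noteq> 0}"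
    using assms unfolding generically_identifiable_iff by blast
  let ?GC = "mixed_component G C"
  have par0: "\<theta>0 \<in> params" using \<theta>0 by (simp add: Theta_iff)
  have "inj_on (phi ?GC) {\<eta> \<in> Theta ?GC. p (replace_param G C \<eta> \<theta>0) \<noteq> 0}"
  proof (rule inj_onI)
    fix \<eta> \<eta>' assume "\<eta> \<in> {\<eta> \<in> Theta ?GC. p (replace_param G C \<eta> \<theta>0) \<noteq> 0}"
      "\<eta>' \<in> {\<eta> \<in> Theta ?GC. p (replace_param G C \<eta> \<theta>0) \<noteq> 0}"
      and eq: "phi ?GC \<eta> = phi ?GC \<eta>'"
    then have \<eta>: "\<eta> \<in> Theta ?GC" "p (replace_param G C \<eta> \<theta>0) \<noteq> 0"
      and \<eta>': "\<eta>' \<in> Theta ?GC" "p (replace_param G C \<eta>' \<theta>0) \<noteq> 0" by auto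
    then have par: "\<eta> \<in> component.params" "\<eta>' \<in> component.params"
      by (auto simp: component.Theta_iff)
    note \<theta> = replace_Theta[OF \<eta>(1) \<theta>0(1)] and \<theta>' = replace_Theta[OF \<eta>'(1) \<theta>0(1)]
    obtain U d where fac: "ldl r V bicomp (snd (replace_param G C \<eta>' \<theta>0)) U d"
      using Theta_ldl[OF \<theta>'] by blast
    \<comment> \<open>The filler is taken from \<open>\<eta>\<close> but fits \<open>\<eta>'\<close>
      too, because equal covariance matrices have equal source variances
      (\<open>var\<close>).\<close>
    define E where "E = (\<lambda>C'. if C' = C then (\<lambda>v. snd \<eta> v v) else (\<lambda>_. 1 :: real))"
    have var: "snd \<eta> v v = snd \<eta>' v v" if "v \<in> comp_nodes C - C" for v
      using source_variance[OF par(1) that] source_variance[OF par(2) that] eq by simp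
    have "phi G (replace_param G C \<eta> \<theta>0) = phi G (replace_param G C \<eta>' \<theta>0)"
    proof (subst phi_eq_iff_components[OF _ _ fac, where E = E])
      show "E C' v \<noteq> 0" if "v \<in> comp_nodes C' - C'" for C' v
        using Theta_diag_pos[OF \<eta>(1), of v] that by (auto simp: E_def)
      show "\<forall>C'\<in>bicomponents G. phi (mixed_component G C') (restrict_param G C' (E C') (replace_param G C \<eta> \<theta>0))
        = phi (mixed_component G C') (restrict_param G C' (E C') (replace_param G C \<eta>' \<theta>0))"
      proof
        fix C' assume C': "C' \<in> bicomponents G"
        show "phi (mixed_component G C') (restrict_param G C' (E C') (replace_param G C \<eta> \<theta>0))
          = phi (mixed_component G C') (restrict_param G C' (E C') (replace_param G C \<eta>' \<theta>0))"
        proof (cases "C' = C")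
          case True
          then show ?thesis
            using restrict_replace[OF par(1), of "E C"] restrict_replace[OF par(2), of "E C"] var eq
            by (simp add: E_def)
        next
          case False
          then show ?thesis
            by (simp add: restrict_replace_other[OF par(1) C'] restrict_replace_other[OF par(2) C'])
        qed
      qed
    qed (use \<theta> \<theta>' in \<open>auto simp: Theta_iff\<close>)
    then have eq': "replace_param G C \<eta> \<theta>0 = replace_param G C \<eta>' \<theta>0"
      using inj \<theta> \<theta>' \<eta>(2) \<eta>'(2) by (auto dest: inj_onD)
    have "\<eta> = restrict_param G C (E C) (replace_param G C \<eta> \<theta>0)"
      by (rule restrict_replace[OF par(1), symmetric]) (simp add: E_def)
    also have "\<dots> = \<eta>'"
      unfolding eq' by (rule restrict_replace[OF par(2)]) (simp add: E_def var)
    finally show "\<eta> = \<eta>'" .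
  qed
  moreover have "restrict_param G C (\<lambda>_. 1) \<theta>0 \<in> Theta ?GC"
    "p (replace_param G C (restrict_param G C (\<lambda>_. 1) \<theta>0) \<theta>0) \<noteq> 0"
    using restrict_Theta[OF \<theta>0(1)] \<theta>0(2) by (auto simp: replace_restrict[OF par0])
  ultimately show ?thesis
    unfolding generically_identifiable_iff
    by (intro bexI[of _ "\<lambda>\<eta>. p (replace_param G C \<eta> \<theta>0)"] replace_polyfuns[OF p]) auto
qed

end

section \<open>From the components to the graph, and sizes of fibers\<close>

context acyclic_mixed_graph
begin

lemma restrict_prod_polyfuns:
  assumes "\<And>C. C \<in> bicomponents G \<Longrightarrow> p C \<in> polyfuns (param_coords (mixed_component G C))"
  shows "(\<lambda>\<theta>. \<Prod>C\<in>bicomponents G. p C (restrict_param G C (E C) \<theta>)) \<in> polyfuns (param_coords G)"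
proof (rule polyfuns_prod)
  fix C assume C: "C \<in> bicomponents G"
  interpret bidirected_component G r C by unfold_locales (rule C)
  show "(\<lambda>\<theta>. p C (restrict_param G C (E C) \<theta>)) \<in> polyfuns (param_coords G)"
    by (rule restrict_polyfuns[OF assms[OF C]])
qed

text \<open>The product of the restricted polynomials must not vanish identically for the chosen
  fillers. They are therefore taken from a parameter assembled from nonvanishing points of the
  components.\<close>

lemma Theta_generic_components:
  assumes p: "\<And>C. C \<in> bicomponents G \<Longrightarrow> p C \<in> polyfuns (param_coords (mixed_component G C))"
    and ne: "\<And>C. C \<in> bicomponents G \<Longrightarrow> \<exists>\<eta>\<in>Theta (mixed_component G C). p C \<eta> \<noteq> 0"
  obtains q E where "q \<in> polyfuns (param_coords G)" "\<exists>\<theta>\<in>Theta G. q \<theta> \<noteq> 0"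
    "\<And>C v. C \<in> bicomponents G \<Longrightarrow> v \<in> comp_nodes C - C \<Longrightarrow> E C v > 0"
    "\<And>C \<theta>. C \<in> bicomponents G \<Longrightarrow> \<theta> \<in> Theta G \<Longrightarrow> q \<theta> \<noteq> 0 \<Longrightarrow>
      restrict_param G C (E C) \<theta> \<in> {\<eta> \<in> Theta (mixed_component G C). p C \<eta> \<noteq> 0}"
proof -
  interpret R: parameter_family G r "Theta G" "\<lambda>C. Theta (mixed_component G C)" "\<lambda>x. x > 0"
    by (rule parameter_family_Theta)
  let ?F = "\<lambda>C. {\<eta> \<in> Theta (mixed_component G C). p C \<eta> \<noteq> 0}"
  obtain \<theta>0 E where \<theta>0: "\<theta>0 \<in> Theta G"
    and E: "\<And>C. C \<in> bicomponents G \<Longrightarrow> restrict_param G C (E C) \<theta>0 \<in> ?F C"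
  proof (rule R.exists_components[OF identity_Theta, of "\<lambda>_. 1" ?F])
    show "\<exists>\<eta>\<in>?F C. (1::real) \<noteq> 0" if "C \<in> bicomponents G" for C
      using ne[OF that] one_neq_zero by blast
  qed auto
  \<comment> \<open>The fillers are variances in a positive definite matrix of the
    component.\<close>
  have Epos: "E C v > 0" if "C \<in> bicomponents G" "v \<in> comp_nodes C - C" for C v
    using R.TC_pos[OF that(1) _ that(2)] E[OF that(1)] that(2) by (fastforce simp: restrict_param_def)
  show ?thesis
  proof (rule that[OF restrict_prod_polyfuns[OF p, of E]])
    show "\<exists>\<theta>\<in>Theta G. (\<Prod>C\<in>bicomponents G. p C (restrict_param G C (E C) \<theta>)) \<noteq> 0"
      using \<theta>0 E by (auto simp: finite_bicomponents)
    show "restrict_param G C (E C) \<theta> \<in> ?F C"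
      if "C \<in> bicomponents G" "\<theta> \<in> Theta G" "(\<Prod>C\<in>bicomponents G. p C (restrict_param G C (E C) \<theta>)) \<noteq> 0" for C \<theta>
      using that R.T_restrict[OF that(1,2)] Epos[OF that(1)] by (auto simp: finite_bicomponents)
  qed (use Epos in auto)
qed

text \<open>With constant fillers the component covariances are rational in Sigma. Composing with
  the rational inverse for the component of \<open>w\<close> yields the entries in column
  \<open>w\<close> of Lambda and Omega.\<close>

lemma rationally_identifiable_if_components:
  assumes "\<And>C. C \<in> bicomponents G \<Longrightarrow> rationally_identifiable (mixed_component G C)"
  shows "rationally_identifiable G"
proof -
  let ?S = "\<lambda>p C. {\<theta> \<in> Theta (mixed_component G C). p \<theta> \<noteq> (0::real)}"
  have "\<forall>C\<in>bicomponents G. \<exists>p. p \<in> polyfuns (param_coords (mixed_component G C)) \<and>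
      (\<exists>\<eta>\<in>Theta (mixed_component G C). p \<eta> \<noteq> 0) \<and>
      (\<forall>v\<in>comp_nodes C. \<forall>w\<in>comp_nodes C.
        (\<lambda>\<theta>. fst \<theta> v w) \<in> cov_ring (mixed_component G C) (?S p C) \<and>
        (\<lambda>\<theta>. snd \<theta> v w) \<in> cov_ring (mixed_component G C) (?S p C))"
    using assms unfolding rationally_identifiable_iff by blast
  then obtain p where p: "\<And>C. C \<in> bicomponents G \<Longrightarrow> p C \<in> polyfuns (param_coords (mixed_component G C))"
    "\<And>C. C \<in> bicomponents G \<Longrightarrow> \<exists>\<eta>\<in>Theta (mixed_component G C). p C \<eta> \<noteq> 0"
    and mem: "\<And>C v w. C \<in> bicomponents G \<Longrightarrow> v \<in> comp_nodes C \<Longrightarrow> w \<in> comp_nodes C \<Longrightarrow>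
        (\<lambda>\<theta>. fst \<theta> v w) \<in> cov_ring (mixed_component G C) (?S (p C) C) \<and>
        (\<lambda>\<theta>. snd \<theta> v w) \<in> cov_ring (mixed_component G C) (?S (p C) C)"
    unfolding bchoice_iff by blast
  obtain q E where q: "q \<in> polyfuns (param_coords G)" "\<exists>\<theta>\<in>Theta G. q \<theta> \<noteq> 0"
    and E: "\<And>C v. C \<in> bicomponents G \<Longrightarrow> v \<in> comp_nodes C - C \<Longrightarrow> E C v > 0"
    and res: "\<And>C \<theta>. C \<in> bicomponents G \<Longrightarrow> \<theta> \<in> Theta G \<Longrightarrow> q \<theta> \<noteq> 0 \<Longrightarrow>
      restrict_param G C (E C) \<theta> \<in> ?S (p C) C"
    using Theta_generic_components[OF p] by blast
  define T where "T = {\<theta> \<in> Theta G. q \<theta> \<noteq> 0}"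
  define K where "K = cov_ring G T"
  have K: "function_field T K" unfolding K_def by (rule function_field_cov_ring)
  interpret K: function_field T K by (rule K)
  have T: "\<theta> \<in> Theta G" "\<theta> \<in> params" if "\<theta> \<in> T" for \<theta>
    using that by (auto simp: T_def Theta_iff)
  have phiK: "\<forall>C\<in>bicomponents G. \<forall>a\<in>comp_nodes C. \<forall>b\<in>comp_nodes C.
       (\<lambda>\<theta>. phi (mixed_component G C) (restrict_param G C (E C) \<theta>) a b) \<in> K"
  proof (subst phi_mem_iff_components[OF K, where E = "\<lambda>_. E", symmetric])
    show "\<exists>U d. ldl r V bicomp (snd \<theta>) U d" if "\<theta> \<in> T" for \<theta> by (rule Theta_ldl[OF T(1)[OF that]])
    show "E C v \<noteq> 0" if "C \<in> bicomponents G" "v \<in> comp_nodes C - C" for C v using E[OF that] by simp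
    show "\<forall>a\<in>V. \<forall>b\<in>V. (\<lambda>\<theta>. phi G \<theta> a b) \<in> K"
      unfolding K_def by (intro ballI phi_cov_ring)
  qed (use T(2) K.const in auto)
  have subst: "(\<lambda>\<theta>. f (restrict_param G C (E C) \<theta>)) \<in> K"
    if "f \<in> cov_ring (mixed_component G C) (?S (p C) C)" "C \<in> bicomponents G" for f C
    by (rule cov_ring_subst[OF K that(1)]) (use res that(2) phiK in \<open>auto simp: T_def\<close>)
  have "(\<lambda>\<theta>. fst \<theta> v w) \<in> K \<and> (\<lambda>\<theta>. snd \<theta> v w) \<in> K" if vw: "v \<in> V" "w \<in> V" for v w
  proof
    have C: "bicomp w \<in> bicomponents G" using vw comp_bicomponents by blast
    interpret bidirected_component G r "bicomp w" by unfold_locales (rule C)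
    have w: "w \<in> bicomp w" "w \<in> comp_nodes (bicomp w)" using C_subset by auto
    let ?\<eta> = "\<lambda>\<theta>. restrict_param G (bicomp w) (E (bicomp w)) \<theta>"
    show "(\<lambda>\<theta>. fst \<theta> v w) \<in> K"
    proof (cases "v \<in> comp_nodes (bicomp w)")
      case True
      have "(\<lambda>\<theta>. fst (?\<eta> \<theta>) v w) \<in> K" using mem[OF C True w(2)] by (intro subst[OF _ C]) blast
      then show ?thesis by (rule K.agree) (use True w in \<open>simp add: restrict_param_def\<close>)
    next
      case False
      then have "(v, w) \<notin> dedges G" using dedges_comp_nodes w by blast
      then have "fst \<theta> v w = 0" if "\<theta> \<in> T" for \<theta> using T(2)[OF that] by (simp add: params_iff)
      then show ?thesis by (intro K.agree[OF K.const[of 0]]) simp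
    qed
    show "(\<lambda>\<theta>. snd \<theta> v w) \<in> K"
    proof (cases "v \<in> bicomp w")
      case True
      then have v: "v \<in> comp_nodes (bicomp w)" using C_subset by blast
      have "(\<lambda>\<theta>. snd (?\<eta> \<theta>) v w) \<in> K" using mem[OF C v w(2)] by (intro subst[OF _ C]) blast
      then show ?thesis by (rule K.agree) (use True w in \<open>simp add: restrict_param_def\<close>)
    next
      case False
      have "snd \<theta> v w = 0" if "\<theta> \<in> T" for \<theta>
        using blockdiag_C[OF blockdiag_Omega[OF T(2)[OF that]]] False w(1) by blast
      then show ?thesis by (intro K.agree[OF K.const[of 0]]) simp
    qed
  qed
  then show ?thesis using q unfolding rationally_identifiable_iff K_def T_def by blast
qed

text \<open>Equal Sigma gives equal component covariances for common fillers, hence equal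
  restrictions, and these determine the parameter.\<close>

lemma generically_identifiable_if_components:
  assumes "\<And>C. C \<in> bicomponents G \<Longrightarrow> generically_identifiable (mixed_component G C)"
  shows "generically_identifiable G"
proof -
  let ?S = "\<lambda>p C. {\<theta> \<in> Theta (mixed_component G C). p \<theta> \<noteq> (0::real)}"
  have "\<forall>C\<in>bicomponents G. \<exists>p. p \<in> polyfuns (param_coords (mixed_component G C)) \<and>
      (\<exists>\<eta>\<in>Theta (mixed_component G C). p \<eta> \<noteq> 0) \<and> inj_on (phi (mixed_component G C)) (?S p C)"
    using assms unfolding generically_identifiable_iff by blast
  then obtain p where p: "\<And>C. C \<in> bicomponents G \<Longrightarrow> p C \<in> polyfuns (param_coords (mixed_component G C))"
    "\<And>C. C \<in> bicomponents G \<Longrightarrow> \<exists>\<eta>\<in>Theta (mixed_component G C). p C \<eta> \<noteq> 0"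
    and inj: "\<And>C. C \<in> bicomponents G \<Longrightarrow> inj_on (phi (mixed_component G C)) (?S (p C) C)"
    unfolding bchoice_iff by blast
  obtain q E where q: "q \<in> polyfuns (param_coords G)" "\<exists>\<theta>\<in>Theta G. q \<theta> \<noteq> 0"
    and E: "\<And>C v. C \<in> bicomponents G \<Longrightarrow> v \<in> comp_nodes C - C \<Longrightarrow> E C v > 0"
    and res: "\<And>C \<theta>. C \<in> bicomponents G \<Longrightarrow> \<theta> \<in> Theta G \<Longrightarrow> q \<theta> \<noteq> 0 \<Longrightarrow>
      restrict_param G C (E C) \<theta> \<in> ?S (p C) C"
    using Theta_generic_components[OF p] by blast
  have "inj_on (phi G) {\<theta> \<in> Theta G. q \<theta> \<noteq> 0}"
  proof (rule inj_onI)
    fix \<theta> \<theta>' assume "\<theta> \<in> {\<theta> \<in> Theta G. q \<theta> \<noteq> 0}" "\<theta>' \<in> {\<theta> \<in> Theta G. q \<theta> \<noteq> 0}"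
      and eq: "phi G \<theta> = phi G \<theta>'"
    then have \<theta>: "\<theta> \<in> Theta G" "q \<theta> \<noteq> 0" and \<theta>': "\<theta>' \<in> Theta G" "q \<theta>' \<noteq> 0" by auto
    then have par: "\<theta> \<in> params" "\<theta>' \<in> params" by (auto simp: Theta_iff)
    obtain U d where fac: "ldl r V bicomp (snd \<theta>') U d" using Theta_ldl[OF \<theta>'(1)] by blast
    have E0: "E C v \<noteq> 0" if "C \<in> bicomponents G" "v \<in> comp_nodes C - C" for C v
      using E[OF that] by simp
    show "\<theta> = \<theta>'"
    proof (rule restrict_inj[OF par, where E = E])
      fix C assume C: "C \<in> bicomponents G"
      have "phi (mixed_component G C) (restrict_param G C (E C) \<theta>)
          = phi (mixed_component G C) (restrict_param G C (E C) \<theta>')"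
        using eq phi_eq_iff_components[OF par(2,1) fac, of E] E0 C by blast
      then show "restrict_param G C (E C) \<theta> = restrict_param G C (E C) \<theta>'"
        by (rule inj_onD[OF inj[OF C] _ res[OF C \<theta>] res[OF C \<theta>']])
    qed
  qed
  with q show ?thesis unfolding generically_identifiable_iff by blast
qed

text \<open>The fiber is a product of nonempty component fibers, one of which is infinite.\<close>

lemma infinite_to_one_if_component:
  assumes C: "C \<in> bicomponents G" and "generically_infinite_to_one (mixed_component G C)"
  shows "generically_infinite_to_one G"
proof -
  interpret bidirected_component G r C by unfold_locales (rule C)
  interpret R: parameter_family G r "Theta G" "\<lambda>C. Theta (mixed_component G C)" "\<lambda>x. x > 0"
    by (rule parameter_family_Theta)
  let ?GC = "mixed_component G C"
  obtain p \<eta> where p: "p \<in> polyfuns (param_coords ?GC)" and \<eta>: "\<eta> \<in> Theta ?GC" "p \<eta> \<noteq> 0"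
    and inf: "\<And>\<eta>. \<eta> \<in> Theta ?GC \<Longrightarrow> p \<eta> \<noteq> 0 \<Longrightarrow> infinite (fiber ?GC (Theta ?GC) \<eta>)"
    using assms(2) unfolding generically_infinite_to_one_iff by blast
  have par: "\<eta> \<in> component.params" using \<eta> by (simp add: component.Theta_iff)
  \<comment> \<open>With the filler of the witness \<open>\<eta>\<close> at \<open>C\<close>,
    inserting \<open>\<eta>\<close> into the identity parameter and restricting returns
    \<open>\<eta>\<close>, so the pulled-back polynomial is not identically zero.\<close>
  define E where "E = (\<lambda>C'. if C' = C then (\<lambda>v. snd \<eta> v v) else (\<lambda>_. 1 :: real))"
  have E: "E C' v > 0" if "v \<in> comp_nodes C' - C'" for C' v
    using that Theta_diag_pos[OF \<eta>(1)] by (auto simp: E_def)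
  have "infinite (fiber G (Theta G) \<theta>)" if \<theta>: "\<theta> \<in> Theta G" "p (restrict_param G C (E C) \<theta>) \<noteq> 0" for \<theta>
  proof
    assume fin: "finite (fiber G (Theta G) \<theta>)"
    obtain U d where fac: "ldl r V bicomp (snd \<theta>) U d" using Theta_ldl[OF \<theta>(1)] by blast
    let ?P = "PiE (bicomponents G)
      (\<lambda>C. fiber (mixed_component G C) (Theta (mixed_component G C)) (restrict_param G C (E C) \<theta>))"
    have "bij_betw (\<lambda>\<theta>'. \<lambda>C\<in>bicomponents G. restrict_param G C (E C) \<theta>') (fiber G (Theta G) \<theta>) ?P"
      by (rule R.fiber_bij_betw[OF \<theta>(1) fac]) (use E in force)
    then have finP: "finite ?P" using fin bij_betw_finite by blast
    have res: "restrict_param G C' (E C') \<theta> \<in> Theta (mixed_component G C')" if "C' \<in> bicomponents G" for C'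
      by (rule R.T_restrict[OF that \<theta>(1) E])
    then have "restrict_param G C' (E C') \<theta> \<in> fiber (mixed_component G C') (Theta (mixed_component G C'))
        (restrict_param G C' (E C') \<theta>)" if "C' \<in> bicomponents G" for C'
      using that by (simp add: fiber_def)
    \<comment> \<open>The restrictions of \<open>\<theta>\<close> itself lie in the factors; a
      nonempty product projects onto each factor.\<close>
    then have "?P \<noteq> {}" unfolding PiE_eq_empty_iff by blast
    then have "(\<lambda>f. f C) ` ?P = fiber ?GC (Theta ?GC) (restrict_param G C (E C) \<theta>)"
      using C by (simp add: image_projection_PiE)
    with finite_imageI[OF finP, of "\<lambda>f. f C"] inf[OF res[OF C] \<theta>(2)] show False by simp
  qed
  moreover have "replace_param G C \<eta> ((\<lambda>_ _. 0), idm V) \<in> Theta G"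
    by (rule replace_Theta[OF \<eta>(1) identity_Theta])
  moreover have "restrict_param G C (E C) (replace_param G C \<eta> ((\<lambda>_ _. 0), idm V)) = \<eta>"
    by (rule restrict_replace[OF par]) (simp add: E_def)
  ultimately show ?thesis
    unfolding generically_infinite_to_one_iff using \<eta>(2)
    by (intro bexI[of _ "\<lambda>\<theta>. p (restrict_param G C (E C) \<theta>)"] restrict_polyfuns[OF p]) (auto, metis)
qed

text \<open>If no component is generically infinite-to-one, the parameters with finite fiber are Zariski
  dense in each component; replacing the components one at a time then produces, outside any given
  proper algebraic subset, a parameter all of whose component fibers are finite.\<close>
lemma infinite_to_one_component:
  assumes "generically_infinite_to_one G"
  shows "\<exists>C\<in>bicomponents G. generically_infinite_to_one (mixed_component G C)"
proof (rule ccontr)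
  assume none: "\<not> ?thesis"
  interpret R: parameter_family G r "Theta G" "\<lambda>C. Theta (mixed_component G C)" "\<lambda>x. x > 0"
    by (rule parameter_family_Theta)
  obtain p \<theta>0 where p: "p \<in> polyfuns (param_coords G)" and \<theta>0: "\<theta>0 \<in> Theta G" "p \<theta>0 \<noteq> 0"
    and inf: "\<And>\<theta>. \<theta> \<in> Theta G \<Longrightarrow> p \<theta> \<noteq> 0 \<Longrightarrow> infinite (fiber G (Theta G) \<theta>)"
    using assms unfolding generically_infinite_to_one_iff by blast
  let ?F = "\<lambda>C. {\<eta> \<in> Theta (mixed_component G C).
    finite (fiber (mixed_component G C) (Theta (mixed_component G C)) \<eta>)}"
  obtain \<theta> E where \<theta>: "\<theta> \<in> Theta G" "p \<theta> \<noteq> 0"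
    and res: "\<And>C. C \<in> bicomponents G \<Longrightarrow> restrict_param G C (E C) \<theta> \<in> ?F C"
  proof (rule R.exists_components[where p = p and F = ?F, OF \<theta>0])
    fix C \<theta> assume C: "C \<in> bicomponents G" and \<theta>: "\<theta> \<in> Theta G" "p \<theta> \<noteq> 0"
    interpret bidirected_component G r C by unfold_locales (rule C)
    let ?GC = "mixed_component G C"
    have par: "\<theta> \<in> params" using \<theta> by (simp add: Theta_iff)
    have ne: "\<exists>\<eta>\<in>Theta ?GC. p (replace_param G C \<eta> \<theta>) \<noteq> 0"
      by (rule bexI[of _ "restrict_param G C (\<lambda>_. 1) \<theta>"])
         (use restrict_Theta[OF \<theta>(1)] \<theta>(2) in \<open>auto simp: replace_restrict[OF par]\<close>)
    show "\<exists>\<eta>\<in>?F C. p (replace_param G C \<eta> \<theta>) \<noteq> 0"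
    proof (rule ccontr)
      assume "\<not> ?thesis"
      then have "\<forall>\<eta>\<in>Theta ?GC. p (replace_param G C \<eta> \<theta>) \<noteq> 0 \<longrightarrow> infinite (fiber ?GC (Theta ?GC) \<eta>)"
        by blast
      with ne have "generically_infinite_to_one ?GC"
        unfolding generically_infinite_to_one_iff
        by (intro bexI[of _ "\<lambda>\<eta>. p (replace_param G C \<eta> \<theta>)"] replace_polyfuns[OF p] conjI)
      with none C show False by blast
    qed
  qed auto
  have E: "0 < E C v \<and> E C v \<noteq> 0" if "C \<in> bicomponents G" "v \<in> comp_nodes C - C" for C v
    using R.TC_pos[OF that(1) _ that(2)] res[OF that(1)] that(2) by (fastforce simp: restrict_param_def)
  obtain U d where fac: "ldl r V bicomp (snd \<theta>) U d" using Theta_ldl[OF \<theta>(1)] by blast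
  have "finite (PiE (bicomponents G)
      (\<lambda>C. fiber (mixed_component G C) (Theta (mixed_component G C)) (restrict_param G C (E C) \<theta>)))"
    by (rule finite_PiE[OF finite_bicomponents]) (use res in auto)
  then have "finite (fiber G (Theta G) \<theta>)"
    using bij_betw_finite[OF R.fiber_bij_betw[OF \<theta>(1) fac, of E]] E by blast
  with inf[OF \<theta>] show False by blast
qed

text \<open>Over the complex numbers two more conditions are generic only: nonzero fillers and
  nonzero pivots of Omega. Each is added by finding a common non-zero of two polynomials; the count
  is then that of a finite product.\<close>

lemma h_to_one_if_components:
  fixes h :: "nat set \<Rightarrow> nat"
  assumes "\<And>C. C \<in> bicomponents G \<Longrightarrow> generically_h_to_one (mixed_component G C) (enat (h C))"
  shows "generically_h_to_one G (enat (\<Prod>C\<in>bicomponents G. h C))"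
proof -
  interpret R: parameter_family G r "ThetaC G" "\<lambda>C. ThetaC (mixed_component G C)" "\<lambda>_. True"
    by (rule parameter_family_ThetaC)
  have "\<forall>C\<in>bicomponents G. \<exists>p. p \<in> polyfuns (param_coords (mixed_component G C)) \<and>
      (\<exists>\<eta>\<in>ThetaC (mixed_component G C). p \<eta> \<noteq> 0) \<and>
      (\<forall>\<theta>\<in>ThetaC (mixed_component G C). p \<theta> \<noteq> 0 \<longrightarrow>
        ecard (fiber (mixed_component G C) (ThetaC (mixed_component G C)) \<theta>) = enat (h C))"
    using assms unfolding generically_h_to_one_iff by blast
  then obtain p where p: "\<And>C. C \<in> bicomponents G \<Longrightarrow> p C \<in> polyfuns (param_coords (mixed_component G C))"
    "\<And>C. C \<in> bicomponents G \<Longrightarrow> \<exists>\<eta>\<in>ThetaC (mixed_component G C). p C \<eta> \<noteq> 0"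
    and card: "\<And>C \<eta>. C \<in> bicomponents G \<Longrightarrow> \<eta> \<in> ThetaC (mixed_component G C) \<Longrightarrow> p C \<eta> \<noteq> 0 \<Longrightarrow>
        ecard (fiber (mixed_component G C) (ThetaC (mixed_component G C)) \<eta>) = enat (h C)"
    unfolding bchoice_iff by blast
  \<comment> \<open>Nonzero source variances are demanded because they become the fillers, hence
    pivots.\<close>
  let ?F = "\<lambda>C. {\<eta> \<in> ThetaC (mixed_component G C). p C \<eta> \<noteq> 0 \<and> (\<forall>v\<in>comp_nodes C - C. snd \<eta> v v \<noteq> 0)}"
  have id: "((\<lambda>_ _. 0), idm V) \<in> ThetaC G" by (simp add: ThetaC_eq identity_params)
  have F_ne: "?F C \<noteq> {}" if C: "C \<in> bicomponents G" for C
  proof -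
    interpret bidirected_component G r C by unfold_locales (rule C)
    define q :: "complex mat \<times> complex mat \<Rightarrow> complex"
      where "q = (\<lambda>\<eta>. \<Prod>v\<in>comp_nodes C - C. snd \<eta> v v)"
    have "q \<in> polyfuns (param_coords (mixed_component G C))"
      unfolding q_def by (intro polyfuns_prod param_coords_polyfuns) auto
    moreover have "q ((\<lambda>_ _. 0), idm (comp_nodes C)) \<noteq> 0" by (simp add: q_def idm_def)
    moreover obtain \<eta> where "\<eta> \<in> component.params" "p C \<eta> \<noteq> 0"
      using p(2)[OF C] component.ThetaC_eq by blast
    ultimately obtain \<eta> where "\<eta> \<in> component.params" "p C \<eta> \<noteq> 0" "q \<eta> \<noteq> 0"
      using component.params_nonzero_both[OF p(1)[OF C]] component.identity_params by blast
    then have "\<eta> \<in> ?F C" by (simp add: q_def component.ThetaC_eq)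
    then show ?thesis by blast
  qed
  obtain \<theta>0 E where \<theta>0: "\<theta>0 \<in> ThetaC G"
    and res0: "\<And>C. C \<in> bicomponents G \<Longrightarrow> restrict_param G C (E C) \<theta>0 \<in> ?F C"
  proof (rule R.exists_components[OF id, of "\<lambda>_. 1" ?F])
    show "\<exists>\<eta>\<in>?F C. (1::complex) \<noteq> 0" if "C \<in> bicomponents G" for C
      using F_ne[OF that] one_neq_zero by blast
  qed auto
  have E: "True \<and> E C v \<noteq> 0" if "C \<in> bicomponents G" "v \<in> comp_nodes C - C" for C v
    using res0[OF that(1)] that(2) by (fastforce simp: restrict_param_def)
  define q where "q = (\<lambda>\<theta>. \<Prod>C\<in>bicomponents G. p C (restrict_param G C (E C) \<theta>))"
  have q: "q \<in> polyfuns (param_coords G)" unfolding q_def by (rule restrict_prod_polyfuns[OF p(1)])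
  have q0: "q \<theta>0 \<noteq> 0" using res0 by (auto simp: q_def finite_bicomponents)
  obtain s :: "complex mat \<times> complex mat \<Rightarrow> complex" where s: "s \<in> polyfuns (param_coords G)"
    "s ((\<lambda>_ _. 0), idm V) \<noteq> 0"
    "\<And>\<theta>. \<theta> \<in> params \<Longrightarrow> s \<theta> \<noteq> 0 \<Longrightarrow> \<exists>U d. ldl r V bicomp (snd \<theta>) U d"
    using generic_ldl by blast
  \<comment> \<open>\<open>q\<close> is nonzero at \<open>\<theta>0\<close> and \<open>s\<close> at
    the identity, which are different points in general.\<close>
  obtain \<theta>1 where \<theta>1: "\<theta>1 \<in> ThetaC G" "q \<theta>1 * s \<theta>1 \<noteq> 0"
    using params_nonzero_both[OF q s(1) \<theta>0[unfolded ThetaC_eq] q0 identity_params s(2)]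
    by (auto simp: ThetaC_eq)
  have "ecard (fiber G (ThetaC G) \<theta>) = enat (\<Prod>C\<in>bicomponents G. h C)"
    if \<theta>: "\<theta> \<in> ThetaC G" "q \<theta> * s \<theta> \<noteq> 0" for \<theta>
  proof -
    obtain U d where fac: "ldl r V bicomp (snd \<theta>) U d"
      using s(3)[of \<theta>] \<theta> by (auto simp: ThetaC_eq)
    let ?B = "\<lambda>C. fiber (mixed_component G C) (ThetaC (mixed_component G C)) (restrict_param G C (E C) \<theta>)"
    have "ecard (?B C) = enat (h C)" if C: "C \<in> bicomponents G" for C
      using that \<theta> by (intro card R.T_restrict) (auto simp: q_def finite_bicomponents)
    then have B: "finite (?B C)" "card (?B C) = h C" if "C \<in> bicomponents G" for C
      using that by (force simp: ecard_def split: if_splits)+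
    have bij: "bij_betw (\<lambda>\<theta>'. \<lambda>C\<in>bicomponents G. restrict_param G C (E C) \<theta>')
        (fiber G (ThetaC G) \<theta>) (PiE (bicomponents G) ?B)"
      by (rule R.fiber_bij_betw[OF \<theta>(1) fac E])
    have "finite (PiE (bicomponents G) ?B)" by (rule finite_PiE[OF finite_bicomponents B(1)])
    moreover have "card (PiE (bicomponents G) ?B) = (\<Prod>C\<in>bicomponents G. h C)"
      using B(2) by (simp add: card_PiE finite_bicomponents)
    ultimately show ?thesis
      using bij_betw_same_card[OF bij] bij_betw_finite[OF bij] by (simp add: ecard_def)
  qed
  with \<theta>1 show ?thesis
    unfolding generically_h_to_one_iff
    by (intro bexI[of _ "\<lambda>\<theta>. q \<theta> * s \<theta>"] polyfuns.mult q s(1)) auto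
qed

end

text \<open>The number of strict ancestors grows along each edge, since the tail is an ancestor of
  the head but not of itself. Ties are broken by the node number.\<close>

lemma acyclic_rank_exists:
  fixes D :: "(nat \<times> nat) set"
  assumes "finite V" "D \<subseteq> V \<times> V" "acyclic D"
  shows "\<exists>r :: nat \<Rightarrow> nat. inj_on r V \<and> (\<forall>(v, w)\<in>D. r v < r w)"
proof -
  define anc where "anc = (\<lambda>v. {u. (u, v) \<in> D\<^sup>+})"
  have fin: "finite (anc v)" for v
  proof (rule finite_subset[OF _ assms(1)])
    have "D\<^sup>+ \<subseteq> V \<times> V" by (rule trancl_subset_Sigma[OF assms(2)])
    then show "anc v \<subseteq> V" by (auto simp: anc_def)
  qed
  have less: "card (anc v) < card (anc w)" if "(v, w) \<in> D" for v w
  proof (rule psubset_card_mono[OF fin], rule psubsetI)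
    show "anc v \<subseteq> anc w" using that by (auto simp: anc_def)
    have "v \<in> anc w" "v \<notin> anc v" using that assms(3) by (auto simp: anc_def acyclic_def)
    then show "anc v \<noteq> anc w" by blast
  qed
  obtain N where N: "\<forall>v\<in>V. v < N" using assms(1) finite_nat_set_iff_bounded by blast
  \<comment> \<open>With all nodes below \<open>N\<close>, the node is the remainder modulo
    \<open>N\<close>, and one more ancestor outweighs any tie-breaker.\<close>
  let ?r = "\<lambda>v. card (anc v) * N + v"
  have "inj_on ?r V"
  proof (rule inj_onI)
    fix v w assume *: "v \<in> V" "w \<in> V" "?r v = ?r w"
    have "v = ?r v mod N" using N *(1,2) by simp
    also have "\<dots> = w" unfolding *(3) using N *(1,2) by simp
    finally show "v = w" .
  qed
  moreover have "?r v < ?r w" if "(v, w) \<in> D" for v w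
  proof -
    have "v < N" using N that assms(2) by auto
    then have "?r v < Suc (card (anc v)) * N" by simp
    also have "\<dots> \<le> card (anc w) * N" using less[OF that] by (intro mult_le_mono1) simp
    finally show ?thesis by simp
  qed
  ultimately show ?thesis by blast
qed

theorem mainTheorem11:
  fixes G :: mgraph and m :: nat
  assumes "mixed_graph G" and "nodes G = {1..m}" and "acyclic_mg G"
  shows "(rationally_identifiable G \<longleftrightarrow>
            (\<forall>C\<in>bicomponents G. rationally_identifiable (mixed_component G C)))
       \<and> (generically_identifiable G \<longleftrightarrow>
            (\<forall>C\<in>bicomponents G. generically_identifiable (mixed_component G C)))
       \<and> (generically_infinite_to_one G \<longleftrightarrow>
            (\<exists>C\<in>bicomponents G. generically_infinite_to_one (mixed_component G C)))
       \<and> (\<forall>h :: nat set \<Rightarrow> nat.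
            (\<forall>C\<in>bicomponents G. generically_h_to_one (mixed_component G C) (enat (h C)))
            \<longrightarrow> generically_h_to_one G (enat (\<Prod>C\<in>bicomponents G. h C)))"
proof -
  obtain r :: "nat \<Rightarrow> nat" where r: "inj_on r (nodes G)" "\<forall>(v, w)\<in>dedges G. r v < r w"
    using acyclic_rank_exists[of "nodes G" "dedges G"] assms(1,3)
    by (auto simp: mixed_graph_def acyclic_mg_def)
  interpret acyclic_mixed_graph G r
    by unfold_locales (use assms(1) r in auto)
  have component: "bidirected_component G r C" if "C \<in> bicomponents G" for C
    using that by unfold_locales
  show ?thesis
    using rationally_identifiable_if_components generically_identifiable_if_components
      bidirected_component.rationally_identifiable_component[OF component]
      bidirected_component.generically_identifiable_component[OF component]
      infinite_to_one_if_component infinite_to_one_component h_to_one_if_components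
    by blast
qed

end
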